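(* Let $\{p_j\}_{j=0}^\infty$ be the Bergman polynomials with respect to $\mu$, where $\mu$ is a strictly positive finite Borel measure on $\mathbb{D}$, absolutely continuous with respect to planar Lebesgue measure, and regular in the sense of Stahl, Totik, and Ullman. Assume that $\mu$ has a positive weight function $w$ that is continuous on $\mathbb{T}$. Then for every $v\in\mathbb{C}$, $$\lim_{n\to\infty}\mathbb{E}\left[\frac1n\,N_{\mathbb{D}}^{\Phi_n,v}\right]=\frac23.$$
   Context: $\mathbb{D}$ is the open unit disk, $\mathbb{T}$ the unit circle. The measure is $d\mu(z)=w\,dx\,dy$; the weight $w$ is regarded as a positive function on $\overline{\mathbb{D}}$, and "continuous on $\mathbb{T}$" means that it is continuous (as a function on $\overline{\mathbb{D}}$) at every point of $\mathbb{T}$. The Bergman polynomials $p_j(z)=\kappa_jz^j+\cdots$, $\kappa_j>0$, of degree $j$, satisfy $\int_{\mathbb{D}}p_j(z)\overline{p_k(z)}\,d\mu(z)=\delta_{jk}$. $\mu$ is regular in the sense of Stahl, Totik, and Ullman if $\lim_{j\to\infty}\kappa_j^{1/j}=1$. The random polynomial is $\Phi_n(z)=\sum_{j=0}^n\eta_jp_j(z)$, where $\eta_0,\eta_1,\dots$ are i.i.d. standard complex normal random variables (density $\frac1\pi e^{-|z|^2}$ on $\mathbb{C}$, mean $0$, $\mathbb{E}|\eta_j|^2=1$). $N_{\mathbb{D}}^{\Phi_n,v}$ is the (random) number of roots in $\mathbb{D}$, counted with multiplicity, of the equation $\Phi_n(z)=v$. *)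

theory Defs
  imports "HOL-Probability.Probability" "HOL-Computational_Algebra.Polynomial"
begin

definition disk_area :: "complex measure" where
  "disk_area = restrict_space lborel (ball 0 1)"

text \<open>The integrals below always exist when \<open>\<mu>\<close> is a finite Borel measure on the disk, since
  polynomials are bounded there.\<close>

definition bergman_polynomials :: "complex measure \<Rightarrow> (nat \<Rightarrow> complex poly) \<Rightarrow> bool" where
  "bergman_polynomials \<mu> p \<longleftrightarrow>
     (\<forall>j. degree (p j) = j \<and> lead_coeff (p j) \<in> \<real> \<and> Re (lead_coeff (p j)) > 0) \<and>
     (\<forall>j k. (\<integral>z. poly (p j) z * cnj (poly (p k) z) \<partial>\<mu>) = (if j = k then 1 else 0))"

text \<open>Regularity in the sense of Stahl, Totik and Ullman (for measures on the unit disk),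
  expressed through the sequence \<open>p\<close> of Bergman polynomials of the measure; their leading
  coefficients are positive reals, so \<^term>\<open>Re\<close> only changes the type. The value at
  \<open>j = 0\<close> is irrelevant for the limit.\<close>

definition STU_regular :: "(nat \<Rightarrow> complex poly) \<Rightarrow> bool" where
  "STU_regular p \<longleftrightarrow> (\<lambda>j. root j (Re (lead_coeff (p j)))) \<longlonglongrightarrow> 1"

definition std_complex_normal_density :: "complex \<Rightarrow> real" where
  "std_complex_normal_density z = 1 / pi * exp (- (cmod z)\<^sup>2)"

definition random_poly ::
  "(nat \<Rightarrow> complex poly) \<Rightarrow> (nat \<Rightarrow> 'a \<Rightarrow> complex) \<Rightarrow> nat \<Rightarrow> 'a \<Rightarrow> complex poly" where
  "random_poly p \<eta> n \<omega> = (\<Sum>j\<le>n. smult (\<eta> j \<omega>) (p j))"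

text \<open>Number of solutions in the open unit disk of \<open>q(z) = v\<close>, counted with multiplicity. If
  \<open>q\<close> is identically \<open>v\<close> the count is \<open>0\<close> by the convention for \<^term>\<open>proots\<close>;
  for the random polynomials this is an event of probability zero.\<close>

definition root_count_disk :: "complex poly \<Rightarrow> complex \<Rightarrow> nat" where
  "root_count_disk q v = size (filter_mset (\<lambda>z. z \<in> ball 0 1) (proots (q - [:v:])))"

end

theory Submission
  imports Defs
    "HOL-Complex_Analysis.Cauchy_Integral_Formula"
    "HOL-Computational_Algebra.Fundamental_Theorem_Algebra"
    "HOL-Real_Asymp.Real_Asymp"
begin

text \<open>
Let \<open>\<Phi>\<close> be the random polynomial of degree \<open>n\<close> and \<open>K(z) = \<Sum>j\<le>n. \<bar>p\<^sub>j(z)\<bar>\<^sup>2\<close> the kernel on the diagonal.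

By Jensen's formula the mean \<open>J(s)\<close> of \<open>ln \<bar>\<Phi> - v\<bar>\<close> over the circle of radius \<open>exp s\<close> is, up to a
constant, the sum of \<open>max s (ln \<bar>a\<bar>)\<close> over the roots \<open>a\<close> of \<open>\<Phi> - v\<close>. This is a convex function of \<open>s\<close>
with left derivative \<open>N\<close> at \<open>0\<close>, where \<open>N\<close> counts the roots in the open disk. Hence
\<open>s N \<le> J(s) - J(0)\<close> for all real \<open>s\<close> of either sign (\<open>root_count_subgradient\<close>). It is therefore enough
to bound the expectation of \<open>J(t/n) - J(0)\<close> from above, in the limit, by \<open>2t/3 + t\<^sup>2\<close> for all small \<open>t\<close>
(\<open>mean_root_count_bound\<close>): division by \<open>t > 0\<close> bounds the mean of \<open>N/n\<close> from above, division by
\<open>t < 0\<close> bounds it from below, and both bounds tend to \<open>2/3\<close> as \<open>t\<close> tends to \<open>0\<close>.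

For fixed \<open>z\<close> the value \<open>\<Phi>(z)\<close> is centred complex normal with variance \<open>K(z)\<close>, so the mean of
\<open>ln \<bar>\<Phi>(z) - v\<bar>\<close> is \<open>ln K(z) / 2 + L(v / sqrt K(z))\<close>, where \<open>L(b)\<close> is the mean of \<open>ln \<bar>X - b\<bar>\<close> for a
standard complex normal \<open>X\<close>. As \<open>L\<close> is continuous at \<open>0\<close> and \<open>K\<close> tends to infinity uniformly on the
circles of radius \<open>exp (t/n)\<close> (\<open>kernel_unbounded\<close>), the value \<open>v\<close> disappears in the limit, and only
the ratio of \<open>K(exp (t/n) \<zeta>)\<close> and \<open>K(\<zeta>)\<close> for \<open>\<bar>\<zeta>\<bar> = 1\<close> matters.

That ratio is asymptotically the one of the unweighted area measure (\<open>kernel_ratio\<close>). Kernels are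
compared through their extremal property \<open>\<bar>q(z)\<bar>\<^sup>2 \<le> K(z) \<integral>\<bar>q\<bar>\<^sup>2 d\<mu>\<close>. Multiplication by the peak
polynomial \<open>((\<zeta> + z)/2)^m\<close> concentrates \<open>q\<close> near \<open>\<zeta>\<close>, where the weight is almost the constant \<open>w(\<zeta>)\<close>;
with \<open>m\<close> of order \<open>sqrt n\<close> the degree changes by \<open>o(n)\<close> only, while everything far from \<open>\<zeta>\<close> is
suppressed faster than any power of \<open>n\<close>. The kernel of the area measure is
\<open>(\<Sum>j\<le>n. (j + 1) \<bar>z\<bar>^(2j)) / \<pi>\<close>, and its ratio is at most \<open>1 + 4t/3 + 2t\<^sup>2\<close> in the limit; half the
logarithm of this is at most \<open>2t/3 + t\<^sup>2\<close>. The number \<open>2/3\<close> is the limit of the mean of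
\<open>j/n\<close> over \<open>j \<le> n\<close> under the weights \<open>j + 1\<close>.
\<close>

section \<open>Integration over the complex plane\<close>

lemma has_bochner_integral_AE_eq:
  assumes "has_bochner_integral M g x" "f \<in> borel_measurable M" "AE t in M. f t = g t"
  shows "has_bochner_integral M f x"
proof -
  have "g \<in> borel_measurable M" using assms(1) by (rule borel_measurable_has_bochner_integral)
  from has_bochner_integral_cong_AE[OF assms(2) this assms(3)] assms(1) show ?thesis by simp
qed

lemma ball_measurable [measurable]: "ball (c :: complex) r \<in> sets borel"
  by simp

lemma nn_integral_lborel_plus:
  fixes f :: "'a::euclidean_space \<Rightarrow> ennreal"
  assumes [measurable]: "f \<in> borel_measurable borel"
  shows "(\<integral>\<^sup>+x. f (a + x) \<partial>lborel) = (\<integral>\<^sup>+x. f x \<partial>lborel)"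
proof -
  have "(\<integral>\<^sup>+x. f x \<partial>lborel) = (\<integral>\<^sup>+x. f x \<partial>distr lborel borel ((+) a))"
    by (simp add: lborel_distr_plus)
  then show ?thesis by (simp add: nn_integral_distr)
qed

text \<open>Translation invariance alone forces this. Integrate \<open>indicator B y * indicator A (c * u + y)\<close> over
\<open>u\<close> and \<open>y\<close>, with \<open>B\<close> the unit disk. Integrating over \<open>u\<close> first gives the measure of \<open>B\<close> times that of
the rotated set; integrating over \<open>y\<close> first gives the measure of \<open>B\<close> times that of \<open>A\<close>, because \<open>B\<close>
is itself invariant under rotations.\<close>

lemma emeasure_lborel_rotation:
  fixes c :: complex
  assumes c: "cmod c = 1" and [measurable]: "A \<in> sets borel"
  shows "emeasure lborel {u. c * u \<in> A} = emeasure lborel A"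
proof -
  let ?B = "ball (0::complex) 1"
  have c0: "c \<noteq> 0" using c by auto
  have M [measurable]: "{u. c * u \<in> A} \<in> sets borel"
    using measurable_sets[of "(*) c" borel borel A] by (simp add: vimage_def)
  let ?I = "\<lambda>y u. indicator ?B y * indicator A (c * u + y) :: ennreal"
  have "(\<integral>\<^sup>+y. \<integral>\<^sup>+u. ?I y u \<partial>lborel \<partial>lborel) = (\<integral>\<^sup>+y. indicator ?B y * emeasure lborel {u. c * u \<in> A} \<partial>lborel)"
  proof (rule nn_integral_cong)
    fix y
    have "(\<integral>\<^sup>+u. ?I y u \<partial>lborel) = indicator ?B y * (\<integral>\<^sup>+u. indicator A (c * u + y) \<partial>lborel)"
      by (rule nn_integral_cmult) measurable
    also have "(\<integral>\<^sup>+u. indicator A (c * u + y) \<partial>lborel) = (\<integral>\<^sup>+u. indicator {u. c * u \<in> A} (y / c + u) \<partial>lborel :: ennreal)"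
    proof (rule nn_integral_cong)
      fix u
      have "c * (y / c + u) = c * u + y" using c0 by (simp add: distrib_left)
      then show "(indicator A (c * u + y) :: ennreal) = indicator {u. c * u \<in> A} (y / c + u)"
        by (simp add: indicator_def)
    qed
    also have "\<dots> = (\<integral>\<^sup>+u. indicator {u. c * u \<in> A} u \<partial>lborel)"
      by (rule nn_integral_lborel_plus) measurable
    finally show "(\<integral>\<^sup>+u. ?I y u \<partial>lborel) = indicator ?B y * emeasure lborel {u. c * u \<in> A}" by simp
  qed
  also have "\<dots> = (\<integral>\<^sup>+y. indicator ?B y \<partial>lborel) * emeasure lborel {u. c * u \<in> A}"
    by (rule nn_integral_multc) measurable
  also have "(\<integral>\<^sup>+y. indicator ?B y \<partial>lborel) = emeasure lborel ?B"
    by (rule nn_integral_indicator) simp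
  finally have 1: "(\<integral>\<^sup>+y. \<integral>\<^sup>+u. ?I y u \<partial>lborel \<partial>lborel) = emeasure lborel ?B * emeasure lborel {u. c * u \<in> A}" .
  have "(\<integral>\<^sup>+y. \<integral>\<^sup>+u. ?I y u \<partial>lborel \<partial>lborel) = (\<integral>\<^sup>+u. \<integral>\<^sup>+y. ?I y u \<partial>lborel \<partial>lborel)"
    by (rule lborel_pair.Fubini') measurable
  also have "\<dots> = (\<integral>\<^sup>+u. \<integral>\<^sup>+y. indicator ?B (y - c * u) * indicator A y \<partial>lborel \<partial>lborel)"
  proof (rule nn_integral_cong)
    fix u
    show "(\<integral>\<^sup>+y. ?I y u \<partial>lborel) = (\<integral>\<^sup>+y. indicator ?B (y - c * u) * indicator A y \<partial>lborel)"
      using nn_integral_lborel_plus[of "\<lambda>y. indicator ?B (y - c * u) * indicator A y" "c * u"] by simp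
  qed
  also have "\<dots> = (\<integral>\<^sup>+y. \<integral>\<^sup>+u. indicator ?B (y - c * u) * indicator A y \<partial>lborel \<partial>lborel)"
    by (rule lborel_pair.Fubini') measurable
  also have "\<dots> = (\<integral>\<^sup>+y. emeasure lborel ?B * indicator A y \<partial>lborel)"
  proof (rule nn_integral_cong)
    fix y
    have "(\<integral>\<^sup>+u. indicator ?B (y - c * u) * indicator A y \<partial>lborel) =
        (\<integral>\<^sup>+u. indicator ?B (y - c * u) \<partial>lborel) * indicator A y"
      by (rule nn_integral_multc) measurable
    also have "(\<integral>\<^sup>+u. indicator ?B (y - c * u) \<partial>lborel) = (\<integral>\<^sup>+u. indicator ?B (- (y / c) + u) \<partial>lborel :: ennreal)"
    proof (rule nn_integral_cong)
      fix u
      have "cmod (y - c * u) = cmod (- c * (- (y / c) + u))"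
        using c0 by (simp add: right_diff_distrib norm_minus_commute)
      also have "\<dots> = cmod (- (y / c) + u)" by (subst norm_mult) (simp add: c)
      finally show "(indicator ?B (y - c * u) :: ennreal) = indicator ?B (- (y / c) + u)"
        by (auto simp: indicator_def)
    qed
    also have "\<dots> = (\<integral>\<^sup>+u. indicator ?B u \<partial>lborel)"
      by (rule nn_integral_lborel_plus) measurable
    finally show "(\<integral>\<^sup>+u. indicator ?B (y - c * u) * indicator A y \<partial>lborel) = emeasure lborel ?B * indicator A y"
      by simp
  qed
  also have "\<dots> = emeasure lborel ?B * emeasure lborel A"
    by (simp add: nn_integral_cmult)
  finally have "emeasure lborel ?B * emeasure lborel {u. c * u \<in> A} = emeasure lborel ?B * emeasure lborel A"
    using 1 by simp
  moreover have "emeasure lborel ?B = ennreal pi"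
    by (simp add: emeasure_ball eval_unit_ball_vol)
  ultimately show ?thesis
    by (simp add: ennreal_mult_cancel_left)
qed

lemma lborel_rotation:
  assumes "cmod c = 1"
  shows "distr lborel borel ((*) c) = lborel"
proof (rule measure_eqI)
  fix A assume "A \<in> sets (distr lborel borel ((*) c))"
  then show "emeasure (distr lborel borel ((*) c)) A = emeasure lborel A"
    using emeasure_lborel_rotation[OF assms, of A] by (simp add: emeasure_distr vimage_def)
qed simp

lemma nn_integral_complex_mult:
  fixes f :: "complex \<Rightarrow> ennreal"
  assumes c: "c \<noteq> 0" and [measurable]: "f \<in> borel_measurable borel"
  shows "(\<integral>\<^sup>+x. f x \<partial>lborel) = ennreal ((cmod c)\<^sup>2) * (\<integral>\<^sup>+x. f (c * x) \<partial>lborel)"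
proof -
  define s where "s = sgn c"
  have s: "cmod s = 1" using c by (simp add: s_def norm_sgn)
  have rot: "distr lborel borel ((*) s) = lborel" by (rule lborel_rotation[OF s])
  have "(\<integral>\<^sup>+x. f x \<partial>lborel) = ennreal (\<bar>cmod c\<bar> ^ DIM(complex)) * (\<integral>\<^sup>+x. f (0 + cmod c *\<^sub>R x) \<partial>lborel)"
    using c by (subst lborel_affine[of "cmod c" 0])
      (auto simp: nn_integral_density nn_integral_distr nn_integral_cmult ennreal_power)
  also have "(\<integral>\<^sup>+x. f (0 + cmod c *\<^sub>R x) \<partial>lborel) = (\<integral>\<^sup>+x. f (cmod c *\<^sub>R x) \<partial>distr lborel borel ((*) s))"
    by (simp add: rot)
  also have "\<dots> = (\<integral>\<^sup>+x. f (cmod c *\<^sub>R (s * x)) \<partial>lborel)"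
    by (subst nn_integral_distr) auto
  also have "\<dots> = (\<integral>\<^sup>+x. f (c * x) \<partial>lborel)"
  proof (rule nn_integral_cong)
    fix x
    have "cmod c *\<^sub>R (s * x) = c * x" using c by (simp add: s_def sgn_div_norm)
    then show "f (cmod c *\<^sub>R (s * x)) = f (c * x)" by simp
  qed
  finally show ?thesis by simp
qed

text \<open>Polar coordinates in the variable \<open>t = \<bar>z\<bar>\<^sup>2\<close>: a disk of radius \<open>r\<close> has area \<open>\<pi> r\<^sup>2\<close>, so both sides are
integrals against measures on the line that agree on half-lines. The reflection of \<open>t\<close> makes these
half-lines have finite measure.\<close>

lemma nn_integral_radial:
  fixes f :: "real \<Rightarrow> ennreal"
  assumes [measurable]: "f \<in> borel_measurable borel"
  shows "(\<integral>\<^sup>+z. f ((cmod z)\<^sup>2) \<partial>lborel) = (\<integral>\<^sup>+t. ennreal pi * (f t * indicator {0..} t) \<partial>lborel)"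
proof -
  let ?M = "distr (lborel :: complex measure) borel (\<lambda>z. - ((cmod z)\<^sup>2))"
  let ?N = "density lborel (\<lambda>t. ennreal pi * indicator {..0::real} t)"
  have MN: "emeasure ?M {x<..} = emeasure ?N {x<..} \<and> emeasure ?M {x<..} < \<infinity>" for x :: real
  proof (cases "x < 0")
    case True
    have "emeasure ?M {x<..} = emeasure lborel ((\<lambda>z::complex. - ((cmod z)\<^sup>2)) -` {x<..})"
      by (subst emeasure_distr) auto
    also have "(\<lambda>z::complex. - ((cmod z)\<^sup>2)) -` {x<..} = ball 0 (sqrt (- x))"
      by (auto simp: real_less_rsqrt) (metis neg_less_iff_less minus_minus norm_ge_zero real_sqrt_abs real_sqrt_less_iff abs_of_nonneg real_sqrt_less_mono real_sqrt_pow2_iff real_sqrt_power)+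
    also have "emeasure lborel (ball (0::complex) (sqrt (- x))) = ennreal (pi * - x)"
      using True by (simp add: emeasure_ball eval_unit_ball_vol)
    finally have M: "emeasure ?M {x<..} = ennreal (pi * - x)" .
    have "emeasure ?N {x<..} = (\<integral>\<^sup>+t. ennreal pi * indicator {x<..0} t \<partial>lborel)"
      by (subst emeasure_density) (auto intro!: nn_integral_cong simp: indicator_def)
    also have "\<dots> = ennreal pi * ennreal (- x)"
      using True by (subst nn_integral_cmult) auto
    also have "\<dots> = ennreal (pi * - x)" by (rule ennreal_mult[symmetric]) (use True in auto)
    finally show ?thesis using M by simp
  next
    case False
    have "emeasure ?M {x<..} = emeasure lborel ((\<lambda>z::complex. - ((cmod z)\<^sup>2)) -` {x<..})"
      by (subst emeasure_distr) auto
    also have "(\<lambda>z::complex. - ((cmod z)\<^sup>2)) -` {x<..} = {}"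
      using False by (auto simp: not_less) (smt (verit) zero_le_power2)
    finally have M: "emeasure ?M {x<..} = 0" by simp
    have "emeasure ?N {x<..} = (\<integral>\<^sup>+t. ennreal pi * indicator {..0} t * indicator {x<..} t \<partial>lborel)"
      by (subst emeasure_density) auto
    also have "\<dots> = (\<integral>\<^sup>+t. 0 \<partial>(lborel :: real measure))"
      using False by (intro nn_integral_cong) (auto simp: indicator_def)
    finally have "emeasure ?N {x<..} = 0" by simp
    with M show ?thesis by simp
  qed
  have eq: "?M = ?N"
  proof (rule measure_eqI_lessThan)
    show "emeasure ?M {x<..} < \<infinity>" "emeasure ?M {x<..} = emeasure ?N {x<..}" for x
      using MN[of x] by blast+
  qed auto
  have "(\<integral>\<^sup>+z. f ((cmod z)\<^sup>2) \<partial>lborel) = (\<integral>\<^sup>+t. f (- t) \<partial>?M)"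
    by (subst nn_integral_distr) auto
  also have "\<dots> = (\<integral>\<^sup>+t. ennreal pi * indicator {..0::real} t * f (- t) \<partial>lborel)"
    unfolding eq by (subst nn_integral_density) auto
  also have "\<dots> = (\<integral>\<^sup>+t. ennreal pi * (f (- t) * indicator {0..} (- t)) \<partial>lborel)"
    by (intro nn_integral_cong) (auto simp: indicator_def mult_ac)
  also have "\<dots> = (\<integral>\<^sup>+t. ennreal pi * (f t * indicator {0..} t) \<partial>distr lborel borel uminus)"
    by (subst nn_integral_distr) auto
  finally show ?thesis by (simp only: lborel_distr_uminus)
qed

section \<open>Complex normal variables\<close>

text \<open>The centred circular normal law with \<open>E \<bar>X\<bar>\<^sup>2 = k\<close>.\<close>

definition cnormal_density :: "real \<Rightarrow> complex \<Rightarrow> real" where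
  "cnormal_density k z = 1 / (pi * k) * exp (- (cmod z)\<^sup>2 / k)"

lemma cnormal_density_measurable [measurable]: "cnormal_density k \<in> borel_measurable borel"
  unfolding cnormal_density_def by measurable

lemma cnormal_density_nonneg: "k > 0 \<Longrightarrow> cnormal_density k z \<ge> 0"
  by (simp add: cnormal_density_def)

lemma cnormal_density_1: "cnormal_density 1 = std_complex_normal_density"
  by (simp add: cnormal_density_def std_complex_normal_density_def fun_eq_iff)

lemma nn_integral_exp_sq:
  assumes "k > 0"
  shows "(\<integral>\<^sup>+z. ennreal (exp (- (cmod z)\<^sup>2 / k)) \<partial>lborel) = ennreal (pi * k)"
proof -
  have "(\<integral>\<^sup>+z. ennreal (exp (- (cmod z)\<^sup>2 / k)) \<partial>lborel) =
     (\<integral>\<^sup>+t. ennreal pi * (ennreal (exp (- t / k)) * indicator {0..} t) \<partial>lborel)"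
    by (rule nn_integral_radial[of "\<lambda>t. ennreal (exp (- t / k))"]) measurable
  also have "\<dots> = ennreal pi * (\<integral>\<^sup>+t. ennreal (exp (- t / k)) * indicator {0..} t \<partial>lborel)"
    by (rule nn_integral_cmult) measurable
  also have "(\<integral>\<^sup>+t. ennreal (exp (- t / k)) * indicator {0..} t \<partial>lborel) = ennreal (0 - (- k * exp (- 0 / k)))"
  proof (rule nn_integral_FTC_atLeast)
    show "((\<lambda>t. - k * exp (- t / k)) has_real_derivative exp (- x / k)) (at x)" for x
      using assms by (auto intro!: derivative_eq_intros)
    have "((\<lambda>t. exp (- t / k)) \<longlongrightarrow> 0) at_top"
      using assms by real_asymp
    then show "((\<lambda>t. - k * exp (- t / k)) \<longlongrightarrow> 0) at_top"
      by (intro tendsto_mult_right_zero)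
  qed auto
  finally show ?thesis using assms by (simp add: ennreal_mult)
qed

lemma nn_integral_cnormal_density:
  assumes "k > 0"
  shows "(\<integral>\<^sup>+z. ennreal (cnormal_density k z) \<partial>lborel) = 1"
proof -
  have "(\<integral>\<^sup>+z. ennreal (cnormal_density k z) \<partial>lborel) =
      (\<integral>\<^sup>+z. ennreal (1 / (pi * k)) * ennreal (exp (- (cmod z)\<^sup>2 / k)) \<partial>lborel)"
    using assms by (intro nn_integral_cong) (auto simp: cnormal_density_def simp flip: ennreal_mult)
  also have "\<dots> = ennreal (1 / (pi * k)) * ennreal (pi * k)"
    unfolding nn_integral_exp_sq[OF assms, symmetric] by (rule nn_integral_cmult) measurable
  also have "\<dots> = 1" using assms by (simp flip: ennreal_mult ennreal_1)
  finally show ?thesis .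
qed

lemma prob_space_cnormal:
  assumes "k > 0" shows "prob_space (density lborel (cnormal_density k))"
  by (rule prob_spaceI) (simp add: emeasure_density nn_integral_cnormal_density[OF assms])

text \<open>Completing the square: as a function of \<open>x\<close> the product of the densities is, up to the factor
\<open>cnormal_density (a + b) z\<close>, again a normal density, with centre \<open>c z\<close> and variance \<open>m\<close>.\<close>

lemma cnormal_density_convolution:
  assumes "a > 0" "b > 0"
  shows "(\<integral>\<^sup>+x. ennreal (cnormal_density a x) * ennreal (cnormal_density b (z - x)) \<partial>lborel) =
    ennreal (cnormal_density (a + b) z)"
proof -
  define c where "c = a / (a + b)"
  define m where "m = a * b / (a + b)"
  have m: "m > 0" and ab: "a + b > 0" using assms by (auto simp: m_def)
  have "(cmod x)\<^sup>2 / a + (cmod (z - x))\<^sup>2 / b = (cmod (- (c *\<^sub>R z) + x))\<^sup>2 / m + (cmod z)\<^sup>2 / (a + b)" for x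
  proof -
    have r: "x1\<^sup>2 / a + (z1 - x1)\<^sup>2 / b = (- (c * z1) + x1)\<^sup>2 / m + z1\<^sup>2 / (a + b)" for x1 z1 :: real
    proof -
      have "- (c * z1) + x1 = ((a + b) * x1 - a * z1) / (a + b)"
        using ab by (simp add: c_def field_simps)
      then have "(- (c * z1) + x1)\<^sup>2 / m = ((a + b) * x1 - a * z1)\<^sup>2 / (a * b * (a + b))"
        using ab assms by (simp add: m_def power_divide power2_eq_square)
      then have "(- (c * z1) + x1)\<^sup>2 / m + z1\<^sup>2 / (a + b) = (((a + b) * x1 - a * z1)\<^sup>2 + a * b * z1\<^sup>2) / (a * b * (a + b))"
        using ab assms by (simp add: add_divide_distrib)
      also have "((a + b) * x1 - a * z1)\<^sup>2 + a * b * z1\<^sup>2 = (b * x1\<^sup>2 + a * (z1 - x1)\<^sup>2) * (a + b)"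
        by (simp add: power2_eq_square algebra_simps)
      also have "\<dots> / (a * b * (a + b)) = x1\<^sup>2 / a + (z1 - x1)\<^sup>2 / b"
        using ab assms by (simp add: add_divide_distrib)
      finally show ?thesis by simp
    qed
    show ?thesis
      using r[of "Re x" "Re z"] r[of "Im x" "Im z"]
      unfolding cmod_power2 by (simp add: add_divide_distrib)
  qed
  then have e: "exp (- (cmod x)\<^sup>2 / a) * exp (- (cmod (z - x))\<^sup>2 / b) =
      exp (- (cmod (- (c *\<^sub>R z) + x))\<^sup>2 / m) * exp (- (cmod z)\<^sup>2 / (a + b))" for x
    unfolding exp_add[symmetric] by (smt (verit) minus_divide_left)
  have "cnormal_density a x * cnormal_density b (z - x) =
      cnormal_density (a + b) z * cnormal_density m (- (c *\<^sub>R z) + x)" for x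
  proof -
    have "1 / (pi * a) * (1 / (pi * b)) = 1 / (pi * (a + b)) * (1 / (pi * m))"
      using assms ab by (simp add: m_def)
    then have "(1 / (pi * a) * (1 / (pi * b))) * (exp (- (cmod x)\<^sup>2 / a) * exp (- (cmod (z - x))\<^sup>2 / b)) =
        (1 / (pi * (a + b)) * (1 / (pi * m))) *
        (exp (- (cmod (- (c *\<^sub>R z) + x))\<^sup>2 / m) * exp (- (cmod z)\<^sup>2 / (a + b)))"
      using e[of x] by (simp only:)
    then show ?thesis unfolding cnormal_density_def by (simp only: mult_ac)
  qed
  then have "(\<integral>\<^sup>+x. ennreal (cnormal_density a x) * ennreal (cnormal_density b (z - x)) \<partial>lborel) =
    (\<integral>\<^sup>+x. ennreal (cnormal_density (a + b) z) * ennreal (cnormal_density m (- (c *\<^sub>R z) + x)) \<partial>lborel)"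
    using assms ab m by (simp add: cnormal_density_nonneg flip: ennreal_mult)
  also have "\<dots> = ennreal (cnormal_density (a + b) z) * (\<integral>\<^sup>+x. ennreal (cnormal_density m (- (c *\<^sub>R z) + x)) \<partial>lborel)"
    by (rule nn_integral_cmult) measurable
  also have "(\<integral>\<^sup>+x. ennreal (cnormal_density m (- (c *\<^sub>R z) + x)) \<partial>lborel) = 1"
    using nn_integral_cnormal_density[OF m]
      nn_integral_lborel_plus[of "\<lambda>x. ennreal (cnormal_density m x)" "- (c *\<^sub>R z)"] by simp
  finally show ?thesis by simp
qed

text \<open>Multiplication by a complex number is a dilation followed by a rotation; this is where the rotation
invariance of the area is used.\<close>

lemma distributed_cmult_cnormal:
  assumes "c \<noteq> 0" and X: "distributed M lborel X (\<lambda>z. ennreal (cnormal_density 1 z))"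
  shows "distributed M lborel (\<lambda>\<omega>. c * X \<omega>) (\<lambda>z. ennreal (cnormal_density ((cmod c)\<^sup>2) z))"
proof -
  have [measurable]: "X \<in> M \<rightarrow>\<^sub>M borel" using X by (simp add: distributed_def)
  have D: "distr M lborel X = density lborel (\<lambda>z. ennreal (cnormal_density 1 z))"
    using X by (simp add: distributed_def)
  have "distr M lborel (\<lambda>\<omega>. c * X \<omega>) = distr (distr M lborel X) lborel ((*) c)"
    by (subst distr_distr) (auto simp: o_def)
  also have "\<dots> = density lborel (\<lambda>z. ennreal (cnormal_density ((cmod c)\<^sup>2) z))"
  proof (rule measure_eqI)
    fix A assume "A \<in> sets (distr (distr M lborel X) lborel ((*) c))"
    then have [measurable]: "A \<in> sets borel" by simp
    have [measurable]: "((*) c) -` A \<in> sets borel"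
      using measurable_sets[of "(*) c" borel borel A] by simp
    have "emeasure (distr (distr M lborel X) lborel ((*) c)) A =
        (\<integral>\<^sup>+z. ennreal (cnormal_density 1 z) * indicator A (c * z) \<partial>lborel)"
      unfolding D by (simp add: emeasure_distr emeasure_density) (simp add: indicator_def)
    also have "\<dots> = (\<integral>\<^sup>+z. ennreal ((cmod c)\<^sup>2) *
        (ennreal (cnormal_density ((cmod c)\<^sup>2) (c * z)) * indicator A (c * z)) \<partial>lborel)"
    proof (rule nn_integral_cong)
      fix z
      have "cnormal_density 1 z = (cmod c)\<^sup>2 * cnormal_density ((cmod c)\<^sup>2) (c * z)"
        using assms by (simp add: cnormal_density_def norm_mult power_mult_distrib)
      then show "ennreal (cnormal_density 1 z) * indicator A (c * z) = ennreal ((cmod c)\<^sup>2) *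
        (ennreal (cnormal_density ((cmod c)\<^sup>2) (c * z)) * indicator A (c * z))"
        using assms by (simp add: ennreal_mult cnormal_density_nonneg mult.assoc)
    qed
    also have "\<dots> = ennreal ((cmod c)\<^sup>2) *
       (\<integral>\<^sup>+z. ennreal (cnormal_density ((cmod c)\<^sup>2) (c * z)) * indicator A (c * z) \<partial>lborel)"
      by (rule nn_integral_cmult) measurable
    also have "\<dots> = (\<integral>\<^sup>+z. ennreal (cnormal_density ((cmod c)\<^sup>2) z) * indicator A z \<partial>lborel)"
      by (rule nn_integral_complex_mult[OF \<open>c \<noteq> 0\<close>, symmetric]) measurable
    finally show "emeasure (distr (distr M lborel X) lborel ((*) c)) A =
       emeasure (density lborel (\<lambda>z. ennreal (cnormal_density ((cmod c)\<^sup>2) z))) A"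
      by (simp add: emeasure_density)
  qed simp
  finally show ?thesis by (simp add: distributed_def)
qed

lemma (in prob_space) distributed_add_cnormal:
  assumes indep: "indep_var borel X borel Y" and ab: "a > 0" "b > 0"
    and X: "distributed M lborel X (\<lambda>z. ennreal (cnormal_density a z))"
    and Y: "distributed M lborel Y (\<lambda>z. ennreal (cnormal_density b z))"
  shows "distributed M lborel (\<lambda>\<omega>. X \<omega> + Y \<omega>) (\<lambda>z. ennreal (cnormal_density (a + b) z))"
proof -
  have [measurable]: "X \<in> M \<rightarrow>\<^sub>M borel" "Y \<in> M \<rightarrow>\<^sub>M borel"
    using X Y by (auto simp: distributed_def)
  have DX: "distr M borel X = density lborel (\<lambda>z. ennreal (cnormal_density a z))"
    and DY: "distr M borel Y = density lborel (\<lambda>z. ennreal (cnormal_density b z))"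
    using X Y by (auto simp: distributed_def cong: distr_cong)
  have fin: "finite_measure (density lborel (\<lambda>z. ennreal (cnormal_density k z)))" if "k > 0" for k
    using prob_space_cnormal[OF that] prob_space.axioms(1) by auto
  have "distr M lborel (\<lambda>\<omega>. X \<omega> + Y \<omega>) = distr M borel (\<lambda>\<omega>. X \<omega> + Y \<omega>)"
    by (auto cong: distr_cong)
  also have "\<dots> = distr (distr M (borel \<Otimes>\<^sub>M borel) (\<lambda>\<omega>. (X \<omega>, Y \<omega>))) borel (\<lambda>(x, y). x + y)"
    by (subst distr_distr) (auto simp: o_def)
  also have "distr M (borel \<Otimes>\<^sub>M borel) (\<lambda>\<omega>. (X \<omega>, Y \<omega>)) = distr M borel X \<Otimes>\<^sub>M distr M borel Y"
    using indep by (simp add: indep_var_distribution_eq)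
  also have "distr (distr M borel X \<Otimes>\<^sub>M distr M borel Y) borel (\<lambda>(x, y). x + y) =
      density lborel (\<lambda>z. ennreal (cnormal_density (a + b) z))"
    unfolding DX DY
  proof (rule measure_eqI)
    fix A :: "complex set"
    assume "A \<in> sets (distr (density lborel (\<lambda>z. ennreal (cnormal_density a z)) \<Otimes>\<^sub>M
        density lborel (\<lambda>z. ennreal (cnormal_density b z))) borel (\<lambda>(x, y). x + y))"
    then have [measurable]: "A \<in> sets borel" by simp
    let ?f = "\<lambda>x. ennreal (cnormal_density a x)" and ?g = "\<lambda>x. ennreal (cnormal_density b x)"
    interpret g: finite_measure "density lborel ?g" using fin ab by auto
    have "emeasure (distr (density lborel ?f \<Otimes>\<^sub>M density lborel ?g) borel (\<lambda>(x, y). x + y)) A =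
        (\<integral>\<^sup>+p. indicator A p \<partial>distr (density lborel ?f \<Otimes>\<^sub>M density lborel ?g) borel (\<lambda>(x, y). x + y))"
      by (rule nn_integral_indicator[symmetric]) simp
    also have "\<dots> = (\<integral>\<^sup>+p. indicator A (fst p + snd p) \<partial>(density lborel ?f \<Otimes>\<^sub>M density lborel ?g))"
      by (subst nn_integral_distr) (auto simp: case_prod_beta)
    also have "\<dots> = (\<integral>\<^sup>+x. \<integral>\<^sup>+y. indicator A (x + y) \<partial>density lborel ?g \<partial>density lborel ?f)"
      by (subst g.nn_integral_fst[symmetric]) auto
    also have "\<dots> = (\<integral>\<^sup>+x. ?f x * (\<integral>\<^sup>+y. ?g y * indicator A (x + y) \<partial>lborel) \<partial>lborel)"
      by (subst nn_integral_density) (auto simp: nn_integral_density)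
    also have "\<dots> = (\<integral>\<^sup>+x. \<integral>\<^sup>+z. ?f x * ?g (z - x) * indicator A z \<partial>lborel \<partial>lborel)"
    proof (rule nn_integral_cong)
      fix x
      have "(\<integral>\<^sup>+y. ?g y * indicator A (x + y) \<partial>lborel) = (\<integral>\<^sup>+z. ?g (z - x) * indicator A z \<partial>lborel)"
        using nn_integral_lborel_plus[of "\<lambda>z. ?g (z - x) * indicator A z" x] by simp
      then show "?f x * (\<integral>\<^sup>+y. ?g y * indicator A (x + y) \<partial>lborel) =
         (\<integral>\<^sup>+z. ?f x * ?g (z - x) * indicator A z \<partial>lborel)"
        by (simp add: nn_integral_cmult mult.assoc)
    qed
    also have "\<dots> = (\<integral>\<^sup>+z. \<integral>\<^sup>+x. ?f x * ?g (z - x) * indicator A z \<partial>lborel \<partial>lborel)"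
      by (rule lborel_pair.Fubini') measurable
    also have "\<dots> = (\<integral>\<^sup>+z. ennreal (cnormal_density (a + b) z) * indicator A z \<partial>lborel)"
      by (subst nn_integral_multc) (auto simp: cnormal_density_convolution[OF ab])
    finally show "emeasure (distr (density lborel ?f \<Otimes>\<^sub>M density lborel ?g) borel (\<lambda>(x, y). x + y)) A =
        emeasure (density lborel (\<lambda>z. ennreal (cnormal_density (a + b) z))) A"
      by (simp add: emeasure_density)
  qed simp
  finally show ?thesis by (simp add: distributed_def)
qed

lemma (in prob_space) indep_var_sum_lessThan:
  fixes X :: "nat \<Rightarrow> 'a \<Rightarrow> complex"
  assumes "indep_vars (\<lambda>_. borel) X UNIV"
  shows "indep_var borel (\<lambda>\<omega>. \<Sum>j\<le>n. X j \<omega>) borel (X (Suc n))"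
proof -
  have "indep_var
      borel ((\<lambda>f. \<Sum>j\<le>n. f j) \<circ> (\<lambda>\<omega>. restrict (\<lambda>i. X i \<omega>) {..n}))
      borel ((\<lambda>f. f (Suc n)) \<circ> (\<lambda>\<omega>. restrict (\<lambda>i. X i \<omega>) {Suc n}))"
    by (intro indep_var_compose[OF indep_var_restrict[OF assms]]) auto
  also have "((\<lambda>f. f (Suc n)) \<circ> (\<lambda>\<omega>. restrict (\<lambda>i. X i \<omega>) {Suc n})) = X (Suc n)"
    by auto
  also have "((\<lambda>f. \<Sum>j\<le>n. f j) \<circ> (\<lambda>\<omega>. restrict (\<lambda>i. X i \<omega>) {..n})) = (\<lambda>\<omega>. \<Sum>j\<le>n. X j \<omega>)"
    by (auto simp: fun_eq_iff)
  finally show ?thesis .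
qed

lemma (in prob_space) distributed_lincomb_cnormal:
  fixes X :: "nat \<Rightarrow> 'a \<Rightarrow> complex"
  assumes indep: "indep_vars (\<lambda>_. borel) X UNIV"
    and X: "\<And>j. distributed M lborel (X j) (\<lambda>z. ennreal (cnormal_density 1 z))"
    and a0: "a 0 \<noteq> 0"
  shows "distributed M lborel (\<lambda>\<omega>. \<Sum>j\<le>n. a j * X j \<omega>)
           (\<lambda>z. ennreal (cnormal_density (\<Sum>j\<le>n. (cmod (a j))\<^sup>2) z))"
proof (induction n)
  case 0
  show ?case using distributed_cmult_cnormal[OF a0 X] by simp
next
  case (Suc n)
  have pos: "(\<Sum>j\<le>n. (cmod (a j))\<^sup>2) > 0"
    using a0 by (intro sum_pos2[of _ 0]) auto
  show ?case
  proof (cases "a (Suc n) = 0")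
    case True
    with Suc show ?thesis by simp
  next
    case False
    have "indep_vars (\<lambda>_. borel) (\<lambda>j \<omega>. a j * X j \<omega>) UNIV"
      by (rule indep_vars_compose2[OF indep]) auto
    from indep_var_sum_lessThan[OF this, of n]
    have "distributed M lborel (\<lambda>\<omega>. (\<Sum>j\<le>n. a j * X j \<omega>) + a (Suc n) * X (Suc n) \<omega>)
        (\<lambda>z. ennreal (cnormal_density ((\<Sum>j\<le>n. (cmod (a j))\<^sup>2) + (cmod (a (Suc n)))\<^sup>2) z))"
      by (rule distributed_add_cnormal[OF _ pos _ Suc distributed_cmult_cnormal[OF False X]])
        (use False in simp)
    then show ?thesis by simp
  qed
qed

section \<open>Logarithmic moments of normal variables\<close>

text \<open>An integrable function that dominates \<open>\<bar>ln \<bar>x\<bar>\<bar>\<close> times every normal density of variance \<open>1\<close> whose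
centre has modulus at most \<open>1\<close>. Integrability, continuity in the centre and the uniform bounds for
Fubini's theorem all come from it.\<close>

definition log_dominant :: "complex \<Rightarrow> real" where
  "log_dominant x = \<bar>ln (cmod x)\<bar> * indicator (ball 0 1) x + exp 1 * exp (- (cmod x)\<^sup>2 / 4)"

lemma log_dominant_measurable [measurable]: "log_dominant \<in> borel_measurable borel"
  unfolding log_dominant_def by measurable

text \<open>The layer cake formula: \<open>- ln \<bar>x\<bar>\<close> is the length of the set of \<open>s \<ge> 0\<close> with \<open>\<bar>x\<bar> < exp (- s)\<close>, and the
disk of radius \<open>exp (- s)\<close> has area \<open>\<pi> exp (- 2 s)\<close>.\<close>

lemma nn_integral_ln_disc: "(\<integral>\<^sup>+x. ennreal (\<bar>ln (cmod x)\<bar> * indicator (ball 0 1) x) \<partial>lborel) < \<infinity>"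
proof -
  let ?R = "\<lambda>(x::complex) s::real. indicator {0..} s * (if cmod x < exp (- s) then 1 else 0) :: ennreal"
  have "(\<integral>\<^sup>+x. ennreal (\<bar>ln (cmod x)\<bar> * indicator (ball 0 1) x) \<partial>lborel) \<le> (\<integral>\<^sup>+x. \<integral>\<^sup>+s. ?R x s \<partial>lborel \<partial>lborel)"
  proof (rule nn_integral_mono)
    fix x :: complex
    show "ennreal (\<bar>ln (cmod x)\<bar> * indicator (ball 0 1) x) \<le> (\<integral>\<^sup>+s. ?R x s \<partial>lborel)"
    proof (cases "x \<noteq> 0 \<and> cmod x < 1")
      case True
      have "ennreal (\<bar>ln (cmod x)\<bar> * indicator (ball 0 1) x) = ennreal (- ln (cmod x) - 0)"
        using True by (simp add: indicator_def)
      also have "\<dots> = emeasure lborel {0..<- ln (cmod x)}"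
        using True by (subst emeasure_lborel_Ico) auto
      also have "\<dots> = (\<integral>\<^sup>+s. indicator {0..<- ln (cmod x)} s \<partial>lborel)" by simp
      also have "\<dots> \<le> (\<integral>\<^sup>+s. ?R x s \<partial>lborel)"
      proof (rule nn_integral_mono)
        fix s :: real
        have "cmod x < exp (- s)" if "s < - ln (cmod x)"
        proof -
          have "exp (ln (cmod x)) < exp (- s)" using that by simp
          then show ?thesis using True by simp
        qed
        then show "(indicator {0..<- ln (cmod x)} s :: ennreal) \<le> ?R x s"
          by (auto simp: indicator_def)
      qed
      finally show ?thesis .
    qed (auto simp: indicator_def)
  qed
  also have "\<dots> = (\<integral>\<^sup>+s. \<integral>\<^sup>+x. ?R x s \<partial>lborel \<partial>lborel)"
    by (rule lborel_pair.Fubini') measurable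
  also have "\<dots> = (\<integral>\<^sup>+s. ennreal pi * (ennreal (exp (- 2 * s)) * indicator {0..} s) \<partial>lborel)"
  proof (rule nn_integral_cong)
    fix s :: real
    have "(\<integral>\<^sup>+x. ?R x s \<partial>lborel) = (\<integral>\<^sup>+x. indicator {0..} s * indicator (ball 0 (exp (- s))) x \<partial>(lborel :: complex measure))"
      by (intro nn_integral_cong) (auto simp: indicator_def)
    also have "\<dots> = indicator {0..} s * emeasure lborel (ball (0::complex) (exp (- s)))"
      by (subst nn_integral_cmult) auto
    also have "emeasure lborel (ball (0::complex) (exp (- s))) = ennreal (pi * exp (- 2 * s))"
      by (simp add: emeasure_ball eval_unit_ball_vol power2_eq_square flip: exp_add)
    finally show "(\<integral>\<^sup>+x. ?R x s \<partial>lborel) = ennreal pi * (ennreal (exp (- 2 * s)) * indicator {0..} s)"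
      by (simp add: ennreal_mult mult_ac)
  qed
  also have "\<dots> = ennreal pi * (\<integral>\<^sup>+s. ennreal (exp (- 2 * s)) * indicator {0..} s \<partial>lborel)"
    by (rule nn_integral_cmult) measurable
  also have "(\<integral>\<^sup>+s. ennreal (exp (- 2 * s)) * indicator {0..} s \<partial>lborel) = ennreal (0 - (- (1 / 2) * exp (- 2 * 0)))"
  proof (rule nn_integral_FTC_atLeast)
    show "((\<lambda>t. - (1 / 2) * exp (- 2 * t)) has_real_derivative exp (- 2 * x)) (at x)" for x :: real
      by (auto intro!: derivative_eq_intros)
    show "((\<lambda>t::real. - (1 / 2) * exp (- 2 * t)) \<longlongrightarrow> 0) at_top" by real_asymp
  qed auto
  also have "ennreal pi * ennreal (0 - (- (1 / 2) * exp (- 2 * 0))) < \<infinity>"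
    by (metis ennreal_mult_less_top ennreal_less_top infinity_ennreal_def)
  finally show ?thesis .
qed

lemma log_dominant_nonneg: "log_dominant x \<ge> 0"
  by (simp add: log_dominant_def)

lemma integrable_log_dominant: "integrable lborel log_dominant"
proof (rule integrableI_bounded)
  have "(\<integral>\<^sup>+x. ennreal (norm (log_dominant x)) \<partial>lborel) =
     (\<integral>\<^sup>+x. ennreal (\<bar>ln (cmod x)\<bar> * indicator (ball 0 1) x) +
        ennreal (exp 1) * ennreal (exp (- (cmod x)\<^sup>2 / 4)) \<partial>lborel)"
    by (intro nn_integral_cong)
       (auto simp: log_dominant_def simp flip: ennreal_mult ennreal_plus)
  also have "\<dots> = (\<integral>\<^sup>+x. ennreal (\<bar>ln (cmod x)\<bar> * indicator (ball 0 1) x) \<partial>lborel) +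
        (\<integral>\<^sup>+x. ennreal (exp 1) * ennreal (exp (- (cmod x)\<^sup>2 / 4)) \<partial>lborel)"
    by (rule nn_integral_add) measurable
  also have "(\<integral>\<^sup>+x. ennreal (exp 1) * ennreal (exp (- (cmod x)\<^sup>2 / 4)) \<partial>lborel) =
      ennreal (exp 1) * ennreal (pi * 4)"
    by (subst nn_integral_cmult) (measurable, simp add: nn_integral_exp_sq[of 4, simplified])
  also have "(\<integral>\<^sup>+x. ennreal (\<bar>ln (cmod x)\<bar> * indicator (ball 0 1) x) \<partial>lborel) +
     ennreal (exp 1) * ennreal (pi * 4) < \<infinity>"
    using nn_integral_ln_disc by (simp add: ennreal_mult_less_top ennreal_add_less_top)
  finally show "(\<integral>\<^sup>+x. ennreal (norm (log_dominant x)) \<partial>lborel) < \<infinity>" .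
qed measurable

lemma log_normal_dominated:
  assumes "cmod b \<le> 1"
  shows "\<bar>ln (cmod x)\<bar> * cnormal_density 1 (b + x) \<le> log_dominant x"
proof -
  have d: "cnormal_density 1 (b + x) \<le> exp (- (cmod (b + x))\<^sup>2)"
    using pi_ge_two by (simp add: cnormal_density_def divide_le_eq)
  show ?thesis
  proof (cases "cmod x < 1")
    case True
    have "exp (- (cmod (b + x))\<^sup>2) \<le> 1" by simp
    then have "cnormal_density 1 (b + x) \<le> 1" using d by linarith
    then have "\<bar>ln (cmod x)\<bar> * cnormal_density 1 (b + x) \<le> \<bar>ln (cmod x)\<bar>"
      by (simp add: mult_left_le)
    also have "\<dots> \<le> log_dominant x" using True by (simp add: log_dominant_def)
    finally show ?thesis .
  next
    case False
    define y where "y = cmod x"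
    have y: "y \<ge> 1" using False by (simp add: y_def)
    have "cmod (b + x) \<ge> y - 1"
      using norm_triangle_ineq2[of x "- b"] assms by (simp add: y_def add.commute)
    then have "(y - 1)\<^sup>2 \<le> (cmod (b + x))\<^sup>2" using y by (intro power_mono) auto
    \<comment> \<open>One half of \<open>y\<^sup>2 / 2\<close> is spent on absorbing the factor \<open>ln y \<le> y \<le> exp (y\<^sup>2 / 4)\<close>.\<close>
    moreover have "y\<^sup>2 / 2 - 1 \<le> (y - 1)\<^sup>2"
      using zero_le_power2[of "y - 2"] by (simp add: power2_eq_square algebra_simps)
    ultimately have "- (cmod (b + x))\<^sup>2 \<le> 1 + (- y\<^sup>2 / 4) + (- (y\<^sup>2 / 4))" by simp
    then have e: "exp (- (cmod (b + x))\<^sup>2) \<le> exp 1 * exp (- y\<^sup>2 / 4) * exp (- (y\<^sup>2 / 4))"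
      by (simp flip: exp_add)
    have "y \<le> 1 + y\<^sup>2 / 4" using zero_le_power2[of "y - 2"] by (simp add: power2_eq_square algebra_simps)
    also have "\<dots> \<le> exp (y\<^sup>2 / 4)" by (rule exp_ge_add_one_self)
    finally have y2: "y \<le> exp (y\<^sup>2 / 4)" .
    have "\<bar>ln (cmod x)\<bar> \<le> y" using y ln_le_minus_one[of y] by (simp add: y_def[symmetric])
    then have "\<bar>ln (cmod x)\<bar> * cnormal_density 1 (b + x) \<le>
        exp (y\<^sup>2 / 4) * (exp 1 * exp (- y\<^sup>2 / 4) * exp (- (y\<^sup>2 / 4)))"
      using y2 d e by (intro mult_mono) (auto simp: cnormal_density_nonneg)
    also have "\<dots> = exp 1 * exp (- y\<^sup>2 / 4)" by (simp add: exp_minus field_simps)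
    also have "\<dots> = log_dominant x" using y by (simp add: log_dominant_def y_def)
    finally show ?thesis .
  qed
qed

text \<open>The mean of \<open>ln \<bar>X - b\<bar>\<close> for a standard complex normal \<open>X\<close>, after the translation that moves the
singularity to the origin: the dependence on \<open>b\<close> then sits in a smooth density.\<close>

definition log_potential :: "complex \<Rightarrow> real" where
  "log_potential b = (\<integral>x. ln (cmod x) * cnormal_density 1 (b + x) \<partial>lborel)"

lemma integrable_log_normal:
  assumes "cmod b \<le> 1"
  shows "integrable lborel (\<lambda>x. ln (cmod x) * cnormal_density 1 (b + x))"
proof (rule Bochner_Integration.integrable_bound[OF integrable_log_dominant])
  show "AE x in lborel. norm (ln (cmod x) * cnormal_density 1 (b + x)) \<le> norm (log_dominant x)"
    using log_normal_dominated[OF assms] by (auto simp: abs_mult cnormal_density_nonneg log_dominant_nonneg)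
qed measurable

lemma log_potential_tendsto: "(log_potential \<longlongrightarrow> log_potential 0) (nhds 0)"
proof -
  have "log_potential \<midarrow>0\<rightarrow> log_potential 0"
    unfolding tendsto_at_iff_sequentially
  proof safe
    fix b :: "nat \<Rightarrow> complex" assume b: "b \<longlonglongrightarrow> 0"
    then have "\<forall>\<^sub>F i in sequentially. cmod (b i) < 1"
      using order_tendstoD(2)[OF tendsto_norm_zero[OF b], of 1] by simp
    then obtain N where N: "\<And>i. i \<ge> N \<Longrightarrow> cmod (b i) < 1" by (auto simp: eventually_sequentially)
    have "(\<lambda>i. log_potential (b (i + N))) \<longlonglongrightarrow> log_potential 0"
      unfolding log_potential_def
    proof (rule integral_dominated_convergence[OF _ _ integrable_log_dominant])
      show "AE x in lborel. (\<lambda>i. ln (cmod x) * cnormal_density 1 (b (i + N) + x)) \<longlonglongrightarrow>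
          ln (cmod x) * cnormal_density 1 (0 + x)"
        unfolding cnormal_density_def
        by (intro AE_I2 tendsto_intros LIMSEQ_ignore_initial_segment[OF b]) auto
      show "AE x in lborel. norm (ln (cmod x) * cnormal_density 1 (b (i + N) + x)) \<le> log_dominant x" for i
        using log_normal_dominated[of "b (i + N)"] N[of "i + N"] less_imp_le
        by (auto simp: abs_mult cnormal_density_nonneg)
    qed measurable
    then show "(log_potential \<circ> b) \<longlonglongrightarrow> log_potential 0"
      unfolding o_def by (rule LIMSEQ_offset)
  qed
  then show ?thesis by (simp add: tendsto_nhds_iff)
qed

lemma nn_integral_cnormal_scale:
  fixes f :: "complex \<Rightarrow> ennreal" and v :: complex
  assumes k: "k > 0" and [measurable]: "f \<in> borel_measurable borel"
  shows "(\<integral>\<^sup>+u. f u * ennreal (cnormal_density k u) \<partial>lborel) =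
         (\<integral>\<^sup>+x. f (v + of_real (sqrt k) * x) * ennreal (cnormal_density 1 (v / of_real (sqrt k) + x)) \<partial>lborel)"
proof -
  define c where "c = complex_of_real (sqrt k)"
  have c: "c \<noteq> 0" "(cmod c)\<^sup>2 = k" using k by (auto simp: c_def)
  have "(\<integral>\<^sup>+u. f u * ennreal (cnormal_density k u) \<partial>lborel) =
     ennreal k * (\<integral>\<^sup>+x. f (c * x) * ennreal (cnormal_density k (c * x)) \<partial>lborel)"
    using nn_integral_complex_mult[OF c(1), of "\<lambda>u. f u * ennreal (cnormal_density k u)"] c(2) by simp
  also have "\<dots> = (\<integral>\<^sup>+x. ennreal k * (f (c * x) * ennreal (cnormal_density k (c * x))) \<partial>lborel)"
    by (rule nn_integral_cmult[symmetric]) measurable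
  also have "\<dots> = (\<integral>\<^sup>+x. f (c * x) * ennreal (cnormal_density 1 x) \<partial>lborel)"
  proof (rule nn_integral_cong)
    fix x
    have "cnormal_density 1 x = k * cnormal_density k (c * x)"
      using k c by (simp add: cnormal_density_def norm_mult power_mult_distrib)
    then show "ennreal k * (f (c * x) * ennreal (cnormal_density k (c * x))) =
        f (c * x) * ennreal (cnormal_density 1 x)"
      using k by (simp add: ennreal_mult cnormal_density_nonneg mult_ac)
  qed
  also have "\<dots> = (\<integral>\<^sup>+x. f (c * (v / c + x)) * ennreal (cnormal_density 1 (v / c + x)) \<partial>lborel)"
    by (rule nn_integral_lborel_plus[symmetric]) measurable
  finally show ?thesis using c(1) by (simp add: c_def distrib_left)
qed

lemma has_bochner_integral_cnormal_scale:
  fixes f :: "complex \<Rightarrow> real" and v :: complex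
  assumes k: "k > 0" and [measurable]: "f \<in> borel_measurable borel"
    and i: "integrable lborel (\<lambda>x. f (v + of_real (sqrt k) * x) * cnormal_density 1 (v / of_real (sqrt k) + x))"
  shows "has_bochner_integral lborel (\<lambda>u. f u * cnormal_density k u)
     (\<integral>x. f (v + of_real (sqrt k) * x) * cnormal_density 1 (v / of_real (sqrt k) + x) \<partial>lborel)"
proof -
  let ?F = "\<lambda>u. f u * cnormal_density k u"
  let ?G = "\<lambda>x. f (v + of_real (sqrt k) * x) * cnormal_density 1 (v / of_real (sqrt k) + x)"
  have eq: "(\<integral>\<^sup>+u. ennreal (s * ?F u) \<partial>lborel) = (\<integral>\<^sup>+x. ennreal (s * ?G x) \<partial>lborel)" for s
    using nn_integral_cnormal_scale[OF k, of "\<lambda>u. ennreal (s * f u)" v] k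
    by (simp add: cnormal_density_nonneg mult.assoc flip: ennreal_mult'')
  have eq_norm: "(\<integral>\<^sup>+u. ennreal (norm (?F u)) \<partial>lborel) = (\<integral>\<^sup>+x. ennreal (norm (?G x)) \<partial>lborel)"
    using nn_integral_cnormal_scale[OF k, of "\<lambda>u. ennreal (norm (f u))" v] k
    by (simp add: cnormal_density_nonneg abs_mult flip: ennreal_mult'')
  have iF: "integrable lborel ?F"
  proof (rule integrableI_bounded)
    show "(\<integral>\<^sup>+u. ennreal (norm (?F u)) \<partial>lborel) < \<infinity>"
      unfolding eq_norm using i by (simp add: integrable_iff_bounded)
  qed measurable
  have "integral\<^sup>L lborel ?F = integral\<^sup>L lborel ?G"
    unfolding real_lebesgue_integral_def[OF iF] real_lebesgue_integral_def[OF i]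
    using eq[of 1] eq[of "-1"] by simp
  with iF show ?thesis by (simp add: has_bochner_integral_iff)
qed

text \<open>The substitution \<open>u = v + sqrt k * x\<close> turns \<open>ln \<bar>u - v\<bar>\<close> into \<open>ln k / 2 + ln \<bar>x\<bar>\<close>. The bound on the
absolute moment is what Fubini's theorem requires when the point \<open>z\<close> moves along a circle.\<close>

lemma has_bochner_integral_ln_cnormal:
  assumes k: "k > 0" and v: "cmod v \<le> sqrt k"
  shows "has_bochner_integral lborel (\<lambda>u. ln (cmod (u - v)) * cnormal_density k u)
     (ln k / 2 + log_potential (v / of_real (sqrt k)))"
    and "(\<integral>u. \<bar>ln (cmod (u - v))\<bar> * cnormal_density k u \<partial>lborel) \<le> \<bar>ln k\<bar> / 2 + integral\<^sup>L lborel log_dominant"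
proof -
  let ?b = "v / of_real (sqrt k)"
  let ?g = "\<lambda>x. cnormal_density 1 (?b + x)"
  have b: "cmod ?b \<le> 1" using assms by (simp add: norm_divide)
  have ng: "(\<integral>\<^sup>+x. ennreal (?g x) \<partial>lborel) = 1"
    using nn_integral_lborel_plus[of "\<lambda>x. ennreal (cnormal_density 1 x)" ?b]
      nn_integral_cnormal_density[of 1] by simp
  have ig: "has_bochner_integral lborel ?g 1"
    by (rule has_bochner_integral_nn_integral) (auto simp: ng cnormal_density_nonneg)
  have ln_eq: "ln (cmod (v + of_real (sqrt k) * x - v)) = ln k / 2 + ln (cmod x)" if "x \<noteq> 0" for x
    using that k by (simp add: norm_mult ln_mult ln_sqrt)
  have ae: "AE x in lborel. ln (cmod (v + of_real (sqrt k) * x - v)) * ?g x = ln k / 2 * ?g x + ln (cmod x) * ?g x"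
    using AE_lborel_singleton[of 0]
  proof eventually_elim
    case (elim x)
    show ?case unfolding ln_eq[OF elim] by (rule distrib_right)
  qed
  have h: "has_bochner_integral lborel (\<lambda>x. ln k / 2 * ?g x + ln (cmod x) * ?g x) (ln k / 2 * 1 + log_potential ?b)"
    using integrable_log_normal[OF b] unfolding log_potential_def
    by (intro has_bochner_integral_add has_bochner_integral_mult_right ig has_bochner_integral_integrable)
  then have h': "has_bochner_integral lborel (\<lambda>x. ln (cmod (v + of_real (sqrt k) * x - v)) * ?g x) (ln k / 2 * 1 + log_potential ?b)"
    by (rule has_bochner_integral_AE_eq[OF _ _ ae]) measurable
  then show "has_bochner_integral lborel (\<lambda>u. ln (cmod (u - v)) * cnormal_density k u)
     (ln k / 2 + log_potential ?b)"
    using has_bochner_integral_cnormal_scale[OF k, of "\<lambda>u. ln (cmod (u - v))" v] by (simp add: has_bochner_integral_iff)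
  have ia: "integrable lborel (\<lambda>x. \<bar>ln (cmod (v + of_real (sqrt k) * x - v))\<bar> * ?g x)"
    using h' integrable_abs[of lborel "\<lambda>x. ln (cmod (v + of_real (sqrt k) * x - v)) * ?g x"]
    by (simp add: has_bochner_integral_iff abs_mult cnormal_density_nonneg)
  have "(\<integral>u. \<bar>ln (cmod (u - v))\<bar> * cnormal_density k u \<partial>lborel) =
      (\<integral>x. \<bar>ln (cmod (v + of_real (sqrt k) * x - v))\<bar> * ?g x \<partial>lborel)"
    using has_bochner_integral_cnormal_scale[OF k, of "\<lambda>u. \<bar>ln (cmod (u - v))\<bar>" v] ia by (simp add: has_bochner_integral_iff)
  also have "\<dots> \<le> (\<integral>x. \<bar>ln k\<bar> / 2 * ?g x + log_dominant x \<partial>lborel)"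
  proof (rule integral_mono_AE[OF ia])
    show "integrable lborel (\<lambda>x. \<bar>ln k\<bar> / 2 * ?g x + log_dominant x)"
      using ig integrable_log_dominant by (auto simp: has_bochner_integral_iff)
    show "AE x in lborel. \<bar>ln (cmod (v + of_real (sqrt k) * x - v))\<bar> * ?g x \<le> \<bar>ln k\<bar> / 2 * ?g x + log_dominant x"
      using AE_lborel_singleton[of 0]
    proof eventually_elim
      case (elim x)
      have "\<bar>ln (cmod (v + of_real (sqrt k) * x - v))\<bar> * ?g x \<le> (\<bar>ln k\<bar> / 2 + \<bar>ln (cmod x)\<bar>) * ?g x"
        unfolding ln_eq[OF elim] by (intro mult_right_mono) (auto simp: cnormal_density_nonneg)
      then show ?case using log_normal_dominated[OF b, of x] by (simp add: distrib_right)
    qed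
  qed
  also have "\<dots> = \<bar>ln k\<bar> / 2 + integral\<^sup>L lborel log_dominant"
    using ig integrable_log_dominant by (simp add: has_bochner_integral_iff)
  finally show "(\<integral>u. \<bar>ln (cmod (u - v))\<bar> * cnormal_density k u \<partial>lborel) \<le> \<bar>ln k\<bar> / 2 + integral\<^sup>L lborel log_dominant" .
qed

section \<open>Jensen's formula\<close>

text \<open>Circles are parametrised by the logarithm \<open>s\<close> of the radius, the variable in which circle means of
\<open>ln \<bar>q\<bar>\<close> are convex, and by \<open>t\<close> in the unit interval, so that means are integrals against a
probability measure.\<close>

definition circle_pt :: "real \<Rightarrow> real \<Rightarrow> complex" where
  "circle_pt s t = of_real (exp s) * cis (2 * pi * t)"

definition unit_interval :: "real measure" where
  "unit_interval = restrict_space lborel {0..1}"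

definition log_mean :: "complex poly \<Rightarrow> real \<Rightarrow> real" where
  "log_mean q s = (\<integral>t. ln (cmod (poly q (circle_pt s t))) \<partial>unit_interval)"

lemma prob_space_unit_interval: "prob_space unit_interval"
  unfolding unit_interval_def
  by (rule prob_spaceI) (simp add: space_restrict_space emeasure_restrict_space)

lemma measurable_unit_interval:
  "f \<in> borel_measurable borel \<Longrightarrow> f \<in> borel_measurable unit_interval"
  unfolding unit_interval_def by (simp add: measurable_restrict_space1)

lemma cmod_circle_pt [simp]: "cmod (circle_pt s t) = exp s"
  by (simp add: circle_pt_def norm_mult)

lemma continuous_on_circle_pt [continuous_intros]: "continuous_on A (circle_pt s)"
  unfolding circle_pt_def by (intro continuous_intros)

lemma measurable_circle_pt [measurable]: "circle_pt s \<in> borel_measurable borel"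
  by (intro borel_measurable_continuous_onI continuous_intros)

lemma has_bochner_integral_unit_interval:
  fixes f :: "real \<Rightarrow> real"
  assumes "continuous_on {0..1} f" "(f has_integral x) {0..1}"
  shows "has_bochner_integral unit_interval f x"
proof -
  have i: "set_integrable lborel {0..1} f"
    by (rule borel_integrable_atLeastAtMost'[OF assms(1)])
  have "integrable unit_interval f"
    using i unfolding unit_interval_def set_integrable_def
    by (subst integrable_restrict_space) auto
  moreover have "integral\<^sup>L unit_interval f = (LINT x:{0..1}|lborel. f x)"
    unfolding unit_interval_def set_lebesgue_integral_def
    by (subst integral_restrict_space) auto
  ultimately show ?thesis
    using set_borel_integral_eq_integral(2)[OF i] assms(2)
    by (simp add: has_bochner_integral_iff integral_unique)
qed

text \<open>Cauchy's integral formula for the value at the centre.\<close>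

lemma holomorphic_circle_mean:
  assumes "f holomorphic_on cball 0 1"
  shows "((\<lambda>t. f (cis (2 * pi * t))) has_integral f 0) {0..1}"
proof -
  have "((\<lambda>u. f u / (u - 0)) has_contour_integral (2 * of_real pi * \<i> * f 0)) (circlepath 0 1)"
    by (rule Cauchy_integral_circlepath_simple[OF assms]) simp
  then have "((\<lambda>x. f (circlepath 0 1 x) / circlepath 0 1 x *
      vector_derivative (circlepath 0 1) (at x within {0..1})) has_integral 2 * of_real pi * \<i> * f 0) {0..1}"
    by (simp add: has_contour_integral_def)
  then have "((\<lambda>t. 2 * of_real pi * \<i> * f (cis (2 * pi * t))) has_integral 2 * of_real pi * \<i> * f 0) {0..1}"
  proof (rule has_integral_eq[rotated])
    fix t :: real assume "t \<in> {0..1}"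
    moreover have "circlepath 0 1 t = cis (2 * pi * t)"
      by (simp add: circlepath cis_conv_exp mult_ac)
    moreover have "exp (2 * of_real pi * \<i> * of_real t) = cis (2 * pi * t)"
      by (simp add: cis_conv_exp mult_ac)
    ultimately show "f (circlepath 0 1 t) / circlepath 0 1 t *
        vector_derivative (circlepath 0 1) (at t within {0..1}) = 2 * of_real pi * \<i> * f (cis (2 * pi * t))"
      by (simp add: vector_derivative_circlepath01)
  qed
  then have "((\<lambda>t. inverse (2 * of_real pi * \<i>) * (2 * of_real pi * \<i> * f (cis (2 * pi * t))))
     has_integral inverse (2 * of_real pi * \<i>) * (2 * of_real pi * \<i> * f 0)) {0..1}"
    by (rule has_integral_mult_right)
  then show ?thesis by (simp add: field_simps)
qed

lemma ln_circle_mean_inside: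
  assumes "cmod a < 1"
  shows "has_bochner_integral unit_interval (\<lambda>t. ln (cmod (1 - a * cis (2 * pi * t)))) 0"
proof (rule has_bochner_integral_unit_interval)
  have *: "1 - a * z \<notin> \<real>\<^sub>\<le>\<^sub>0" if "cmod z \<le> 1" for z
  proof -
    have "cmod (a * z) < 1"
      using assms that by (metis mult_left_le norm_mult norm_ge_zero order_le_less_trans)
    then have "Re (a * z) < 1" using complex_Re_le_cmod[of "a*z"] by linarith
    then show ?thesis by (auto simp: complex_nonpos_Reals_iff)
  qed
  show "continuous_on {0..1} (\<lambda>t. ln (cmod (1 - a * cis (2 * pi * t))))"
  proof (intro continuous_intros ballI)
    fix t :: real assume "t \<in> {0..1}"
    show "cmod (1 - a * cis (2 * pi * t)) \<noteq> 0"
      using *[of "cis (2 * pi * t)"] by auto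
  qed
  have "(\<lambda>z. Ln (1 - a * z)) holomorphic_on cball 0 1"
    using * by (intro holomorphic_intros) auto
  from holomorphic_circle_mean[OF this]
  have "((\<lambda>t. Re (Ln (1 - a * cis (2 * pi * t)))) has_integral 0) {0..1}"
    by (auto dest: has_integral_Re)
  moreover have "Re (Ln (1 - a * cis (2 * pi * t))) = ln (cmod (1 - a * cis (2 * pi * t)))" for t
    using *[of "cis (2 * pi * t)"] by (intro Re_Ln) auto
  ultimately show "((\<lambda>t. ln (cmod (1 - a * cis (2 * pi * t)))) has_integral 0) {0..1}"
    by simp
qed

lemma AE_circle_neq: "AE t in unit_interval. of_real r * cis (2 * pi * t) \<noteq> a" if "a \<noteq> 0"
proof -
  let ?A = "{t::real. of_real r * cis (2 * pi * t) = a}"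
  have "countable ?A"
  proof (cases "?A = {}")
    case False
    then obtain t0 where t0: "of_real r * cis (2 * pi * t0) = a" by auto
    have "?A \<subseteq> range (\<lambda>n::int. t0 + of_int n)"
    proof
      fix t assume "t \<in> ?A"
      with t0 that have "cis (2 * pi * t) = cis (2 * pi * t0)" by auto
      then have "exp (\<i> * (2 * pi * t)) = exp (\<i> * (2 * pi * t0))" by (simp add: cis_conv_exp)
      then obtain n :: int where "\<i> * (2 * pi * t) = \<i> * (2 * pi * t0) + (of_int (2 * n) * pi) * \<i>"
        unfolding exp_eq by auto
      then have "Im (\<i> * (2 * pi * t)) = Im (\<i> * (2 * pi * t0) + (of_int (2 * n) * pi) * \<i>)" by simp
      then have "(2 * pi) * t = (2 * pi) * (t0 + of_int n)" by (simp add: algebra_simps)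
      then have "t = t0 + n" by simp
      then show "t \<in> range (\<lambda>n::int. t0 + of_int n)" by auto
    qed
    then show ?thesis by (rule countable_subset) auto
  qed (metis countable_empty)
  then have "AE t in lborel. t \<notin> ?A"
    by (intro AE_not_in countable_imp_null_set_lborel)
  then show ?thesis unfolding unit_interval_def
    by (subst AE_restrict_space_iff) auto
qed

text \<open>On the unit circle the integrand has a logarithmic singularity. For \<open>0 < \<rho> < 1\<close> and \<open>\<bar>c\<bar> = 1\<close>,
\<open>\<bar>1 - \<rho> c\<bar>\<^sup>2 / \<rho> = \<rho> + 1 / \<rho> - 2 Re c\<close> decreases as \<open>\<rho>\<close> increases to \<open>1\<close>. So the mean can be computed
by monotone convergence from the means inside the disk, which also yields integrability.\<close>

lemma ln_circle_mean_boundary: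
  assumes "cmod a = 1"
  shows "has_bochner_integral unit_interval (\<lambda>t. ln (cmod (1 - a * cis (2 * pi * t)))) 0"
proof -
  define \<rho> where "\<rho> k = 1 - 1 / (real k + 2)" for k
  have \<rho>: "0 < \<rho> k" "\<rho> k < 1" for k by (auto simp: \<rho>_def field_simps)
  have \<rho>_mono: "\<rho> k \<le> \<rho> l" if "k \<le> l" for k l using that by (auto simp: \<rho>_def field_simps)
  have \<rho>_lim: "\<rho> \<longlonglongrightarrow> 1" unfolding \<rho>_def by real_asymp
  define c where "c t = a * cis (2 * pi * t)" for t
  have c: "cmod (c t) = 1" for t by (simp add: c_def norm_mult assms)
  \<comment> \<open>The sign makes the sequence increasing; its integrals are \<open>ln (\<rho> k)\<close>.\<close>
  define g where "g k t = - 2 * ln (cmod (1 - of_real (\<rho> k) * c t)) + ln (\<rho> k)" for k t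
  have ne: "cmod (1 - of_real (\<rho> k) * c t) > 0" for k t
  proof -
    have "cmod (of_real (\<rho> k) * c t) < 1" using \<rho>[of k] by (simp add: norm_mult c)
    then show ?thesis by (metis norm_one order_less_irrefl right_minus_eq zero_less_norm_iff)
  qed
  have sq: "(cmod (1 - of_real x * c t))\<^sup>2 = 1 + x\<^sup>2 - 2 * x * Re (c t)" for x t
  proof -
    have "(Re (c t))\<^sup>2 + (Im (c t))\<^sup>2 = 1" using c[of t] by (simp add: cmod_def)
    then have "x\<^sup>2 = x\<^sup>2 * ((Re (c t))\<^sup>2 + (Im (c t))\<^sup>2)" by simp
    then show ?thesis unfolding cmod_power2
      by (simp add: power2_eq_square algebra_simps)
  qed
  have g_eq: "g k t = - ln (\<rho> k + 1 / \<rho> k - 2 * Re (c t))" for k t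
  proof -
    have "g k t = - (ln ((cmod (1 - of_real (\<rho> k) * c t))\<^sup>2) - ln (\<rho> k))"
      using ne[of k t] by (simp add: g_def ln_realpow)
    also have "\<dots> = - ln ((cmod (1 - of_real (\<rho> k) * c t))\<^sup>2 / \<rho> k)"
      using ne[of k t] \<rho>[of k] by (subst ln_div) auto
    also have "(cmod (1 - of_real (\<rho> k) * c t))\<^sup>2 / \<rho> k = \<rho> k + 1 / \<rho> k - 2 * Re (c t)"
      unfolding sq using \<rho>[of k] by (simp add: field_simps power2_eq_square)
    finally show ?thesis .
  qed
  have pos: "0 < \<rho> k + 1 / \<rho> k - 2 * Re (c t)" for k t
  proof -
    have "\<rho> k + 1 / \<rho> k - 2 * Re (c t) = (cmod (1 - of_real (\<rho> k) * c t))\<^sup>2 / \<rho> k"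
      unfolding sq using \<rho>[of k] by (simp add: field_simps power2_eq_square)
    then show ?thesis using ne[of k t] \<rho>[of k] by simp
  qed
  have 1: "has_bochner_integral unit_interval (g k) (ln (\<rho> k))" for k
  proof -
    interpret prob_space unit_interval by (rule prob_space_unit_interval)
    have "has_bochner_integral unit_interval (\<lambda>t. ln (cmod (1 - (of_real (\<rho> k) * a) * cis (2 * pi * t)))) 0"
      using \<rho>[of k] assms by (intro ln_circle_mean_inside) (simp add: norm_mult)
    then show ?thesis
      by (auto simp: has_bochner_integral_iff g_def[abs_def] c_def mult_ac prob_space)
  qed
  have "mono (\<lambda>k. g k t)" for t
  proof (rule monoI)
    fix k l :: nat assume "k \<le> l"
    have "\<rho> l + 1 / \<rho> l \<le> \<rho> k + 1 / \<rho> k"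
    proof -
      have "\<rho> k + 1 / \<rho> k - (\<rho> l + 1 / \<rho> l) = (\<rho> l - \<rho> k) * (1 - \<rho> k * \<rho> l) / (\<rho> k * \<rho> l)"
        using \<rho>[of k] \<rho>[of l] by (simp add: field_simps)
      moreover have "\<rho> k * \<rho> l \<le> 1" using \<rho>[of k] \<rho>[of l] by (simp add: mult_le_one)
      ultimately show ?thesis using \<rho>_mono[OF \<open>k \<le> l\<close>] \<rho>[of k] \<rho>[of l]
        by (smt (verit) divide_nonneg_pos mult_nonneg_nonneg mult_pos_pos)
    qed
    then show "g k t \<le> g l t" unfolding g_eq using pos[of k t] pos[of l t] by simp
  qed
  moreover have "AE t in unit_interval. (\<lambda>k. g k t) \<longlonglongrightarrow> - 2 * ln (cmod (1 - c t))"
  proof -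
    have "inverse a \<noteq> 0" using assms by auto
    from AE_circle_neq[OF this, of 1] show ?thesis
    proof eventually_elim
      case (elim t)
      have "1 - c t \<noteq> 0"
      proof
        assume "1 - c t = 0"
        then have "a * cis (2 * pi * t) = 1" by (simp add: c_def)
        then have "cis (2 * pi * t) = inverse a" by (rule inverse_unique[symmetric])
        with elim show False by simp
      qed
      then have "(\<lambda>k. g k t) \<longlonglongrightarrow> - 2 * ln (cmod (1 - of_real 1 * c t)) + ln 1"
        unfolding g_def using \<rho>_lim by (intro tendsto_intros) auto
      then show ?case by simp
    qed
  qed
  moreover have "(\<lambda>k. integral\<^sup>L unit_interval (g k)) \<longlonglongrightarrow> 0"
  proof -
    have "(\<lambda>k. ln (\<rho> k)) \<longlonglongrightarrow> ln 1" using \<rho>_lim by (intro tendsto_intros) auto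
    then show ?thesis using 1 by (simp add: has_bochner_integral_iff)
  qed
  moreover have [measurable]: "c \<in> borel_measurable borel"
    unfolding c_def by (intro borel_measurable_continuous_onI continuous_intros)
  have "(\<lambda>t. - 2 * ln (cmod (1 - c t))) \<in> borel_measurable unit_interval"
    by (intro measurable_unit_interval) measurable
  ultimately have "has_bochner_integral unit_interval (\<lambda>t. - 2 * ln (cmod (1 - c t))) 0"
    using 1 by (intro has_bochner_integral_monotone_convergence[where f=g])
      (auto simp: has_bochner_integral_iff c_def)
  from has_bochner_integral_mult_right[OF this, of "- 1 / 2"]
  show ?thesis by (simp add: c_def)
qed

lemma ln_circle_mean:
  assumes "cmod a \<le> 1"
  shows "has_bochner_integral unit_interval (\<lambda>t. ln (cmod (1 - a * cis (2 * pi * t)))) 0"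
  using ln_circle_mean_inside[of a] ln_circle_mean_boundary[of a] assms by (cases "cmod a < 1") auto

text \<open>The mean of \<open>ln \<bar>z - a\<bar>\<close> over the circle of radius \<open>exp s\<close>. The root \<open>a = 0\<close> is separate because
\<open>ln 0 = 0\<close>, whereas the formula calls for minus infinity.\<close>

definition log_max_root :: "real \<Rightarrow> complex \<Rightarrow> real" where
  "log_max_root s a = (if a = 0 then s else max s (ln (cmod a)))"

text \<open>Factoring out the larger of \<open>exp s\<close> and \<open>\<bar>a\<bar>\<close> leaves \<open>1 - b c\<close> with \<open>\<bar>b\<bar> \<le> 1\<close> and \<open>\<bar>c\<bar> = 1\<close>. If the
circle surrounds \<open>a\<close>, this requires the conjugate of \<open>a\<close>, since \<open>z - a\<close> has the same modulus as
\<open>\<bar>z\<bar> - a (z / \<bar>z\<bar>)^(-1)\<close>.\<close>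

lemma has_bochner_integral_ln_linear:
  "has_bochner_integral unit_interval (\<lambda>t. ln (cmod (circle_pt s t - a))) (log_max_root s a)"
proof -
  interpret prob_space unit_interval by (rule prob_space_unit_interval)
  show ?thesis
  proof (cases "cmod a \<le> exp s")
    case True
    define b where "b = cnj a / of_real (exp s)"
    have b: "cmod b \<le> 1" using True by (simp add: b_def norm_divide)
    have eq: "cmod (circle_pt s t - a) = exp s * cmod (1 - b * cis (2 * pi * t))" for t
    proof -
      have "cmod (circle_pt s t - a) = cmod (circle_pt s t - a) * cmod (cis (- (2 * pi * t)))" by simp
      also have "\<dots> = cmod (of_real (exp s) * (1 - cnj (b * cis (2 * pi * t))))"
        unfolding norm_mult[symmetric]
        by (rule arg_cong[where f=cmod]) (simp add: circle_pt_def b_def field_simps cis_mult cis_cnj)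
      also have "\<dots> = exp s * cmod (1 - b * cis (2 * pi * t))"
        by (metis complex_cnj_diff complex_cnj_one complex_mod_cnj norm_mult norm_of_real abs_exp_cancel)
      finally show ?thesis .
    qed
    have ae: "AE t in unit_interval. ln (cmod (circle_pt s t - a)) = s + ln (cmod (1 - b * cis (2 * pi * t)))"
    proof (cases "a = 0")
      case True then show ?thesis by (simp add: b_def)
    next
      case False
      from AE_circle_neq[OF False, of "exp s"] show ?thesis
      proof eventually_elim
        case (elim t)
        then have "cmod (circle_pt s t - a) > 0" by (simp add: circle_pt_def)
        then show ?case unfolding eq by (subst ln_mult) (auto simp: zero_less_mult_iff)
      qed
    qed
    have "has_bochner_integral unit_interval (\<lambda>t. s + ln (cmod (1 - b * cis (2 * pi * t)))) s"
      using ln_circle_mean[OF b] by (auto simp: has_bochner_integral_iff prob_space)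
    moreover have "log_max_root s a = s"
    proof (cases "a = 0")
      case False
      then have "ln (cmod a) \<le> ln (exp s)" using True by (subst ln_le_cancel_iff) auto
      then show ?thesis by (simp add: log_max_root_def)
    qed (simp add: log_max_root_def)
    moreover have m: "(\<lambda>t. ln (cmod (circle_pt s t - a))) \<in> borel_measurable unit_interval"
      by (intro measurable_unit_interval) measurable
    ultimately show ?thesis
      using has_bochner_integral_AE_eq[OF _ m ae] by simp
  next
    case False
    then have a0: "a \<noteq> 0" by (auto simp: not_le)
    define b where "b = of_real (exp s) / a"
    have b: "cmod b < 1" using False a0 by (simp add: b_def norm_divide divide_less_eq)
    have "ln (cmod (circle_pt s t - a)) = ln (cmod a) + ln (cmod (1 - b * cis (2 * pi * t)))" for t
    proof -
      have "cmod (b * cis (2 * pi * t)) < 1" using b by (simp add: norm_mult)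
      then have "1 - b * cis (2 * pi * t) \<noteq> 0" by auto
      moreover have "circle_pt s t - a = - a * (1 - b * cis (2 * pi * t))"
        using a0 by (simp add: circle_pt_def b_def field_simps)
      ultimately show ?thesis using a0 by (simp add: norm_mult ln_mult)
    qed
    moreover have "has_bochner_integral unit_interval (\<lambda>t. ln (cmod a) + ln (cmod (1 - b * cis (2 * pi * t)))) (ln (cmod a))"
      using ln_circle_mean_inside[OF b] by (auto simp: has_bochner_integral_iff prob_space)
    moreover have "ln (exp s) < ln (cmod a)"
      using False a0 by (subst ln_less_cancel_iff) auto
    then have "log_max_root s a = ln (cmod a)"
      using a0 by (simp add: log_max_root_def)
    ultimately show ?thesis by (simp only:)
  qed
qed

lemma AE_circle_pt_neq: "AE t in unit_interval. circle_pt s t \<noteq> a"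
proof (cases "a = 0")
  case True
  have "circle_pt s t \<noteq> 0" for t by (simp add: circle_pt_def)
  with True show ?thesis by simp
next
  case False
  from AE_circle_neq[OF this, of "exp s"] show ?thesis by (simp add: circle_pt_def)
qed

lemma jensen_formula_multiset:
  assumes "c \<noteq> 0"
  shows "has_bochner_integral unit_interval
           (\<lambda>t. ln (cmod (c * (\<Prod>a\<in>#X. circle_pt s t - a)))) (ln (cmod c) + (\<Sum>a\<in>#X. log_max_root s a))"
proof (induction X)
  case empty
  interpret prob_space unit_interval by (rule prob_space_unit_interval)
  show ?case by (simp add: has_bochner_integral_iff prob_space)
next
  case (add b X)
  have "AE t in unit_interval. \<forall>a \<in> set_mset (add_mset b X). circle_pt s t \<noteq> a"
    by (intro AE_finite_allI AE_circle_pt_neq) auto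
  then have ae: "AE t in unit_interval. ln (cmod (c * (\<Prod>a\<in>#add_mset b X. circle_pt s t - a))) =
     ln (cmod (circle_pt s t - b)) + ln (cmod (c * (\<Prod>a\<in>#X. circle_pt s t - a)))"
  proof eventually_elim
    case (elim t)
    then have "(\<Prod>a\<in>#X. circle_pt s t - a) \<noteq> 0" "circle_pt s t - b \<noteq> 0" by auto
    then show ?case using assms by (simp add: norm_mult ln_mult)
  qed
  have m: "(\<lambda>t. ln (cmod (c * (\<Prod>a\<in>#add_mset b X. circle_pt s t - a)))) \<in> borel_measurable unit_interval"
    for X
  proof -
    have "continuous_on UNIV (\<lambda>t. \<Prod>a\<in>#X. circle_pt s t - a)" for X
      by (induction X) (auto intro!: continuous_intros)
    then have "(\<lambda>t. \<Prod>a\<in>#add_mset b X. circle_pt s t - a) \<in> borel_measurable borel"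
      by (rule borel_measurable_continuous_onI)
    then show ?thesis
      by (intro measurable_unit_interval borel_measurable_ln borel_measurable_norm borel_measurable_times) auto
  qed
  have h: "has_bochner_integral unit_interval
      (\<lambda>t. ln (cmod (circle_pt s t - b)) + ln (cmod (c * (\<Prod>a\<in>#X. circle_pt s t - a))))
      (log_max_root s b + (ln (cmod c) + (\<Sum>a\<in>#X. log_max_root s a)))"
    by (intro has_bochner_integral_add has_bochner_integral_ln_linear add)
  have "has_bochner_integral unit_interval (\<lambda>t. ln (cmod (c * (\<Prod>a\<in>#add_mset b X. circle_pt s t - a))))
      (log_max_root s b + (ln (cmod c) + (\<Sum>a\<in>#X. log_max_root s a)))"
    by (rule has_bochner_integral_AE_eq[OF h m ae])
  moreover have "log_max_root s b + (ln (cmod c) + (\<Sum>a\<in>#X. log_max_root s a)) =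
      ln (cmod c) + (\<Sum>a\<in>#add_mset b X. log_max_root s a)"
    by simp
  ultimately show ?case by (simp only:)
qed

lemma jensen_formula:
  assumes "q \<noteq> 0"
  shows "log_mean q s = ln (cmod (lead_coeff q)) + (\<Sum>a\<in>#proots q. log_max_root s a)"
proof -
  have poly_prod: "poly (\<Prod>x\<in>#X. [:-x, 1:]) z = (\<Prod>a\<in>#X. z - a)" for X and z :: complex
    by (simp add: poly_prod_mset)
  have "poly q z = lead_coeff q * (\<Prod>a\<in>#proots q. z - a)" for z
    using arg_cong[OF complex_poly_decompose_multiset[of q], of "\<lambda>p. poly p z"]
    by (simp only: poly_smult poly_prod)
  then show ?thesis
    unfolding log_mean_def
    using jensen_formula_multiset[of "lead_coeff q" s "proots q"] assms
    by (simp add: has_bochner_integral_iff)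
qed

lemma log_mean_diff:
  assumes "q \<noteq> 0"
  shows "log_mean q s - log_mean q r = (\<Sum>a\<in>#proots q. log_max_root s a - log_max_root r a)"
proof -
  have "(\<Sum>a\<in>#X. log_max_root s a) - (\<Sum>a\<in>#X. log_max_root r a) =
      (\<Sum>a\<in>#X. log_max_root s a - log_max_root r a)" for X
  proof (induction X)
    case (add b X)
    from add[symmetric] show ?case by simp
  qed simp
  then show ?thesis by (simp add: jensen_formula[OF assms])
qed

lemma root_count_disk_sum:
  "real (root_count_disk q v) = (\<Sum>a\<in>#proots (q - [:v:]). if cmod a < 1 then 1 else 0)"
proof -
  have "real (size (filter_mset (\<lambda>z. z \<in> ball 0 1) X)) = (\<Sum>a\<in>#X. if cmod a < 1 then 1 else 0)" for X
    by (induction X) auto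
  then show ?thesis by (simp add: root_count_disk_def)
qed

text \<open>Each root in the open disk contributes at least \<open>s\<close> to the difference and each other root a
nonnegative amount, whatever the sign of \<open>s\<close>. The statement includes the zero polynomial: then both
sides vanish, since \<open>ln 0 = 0\<close>.\<close>

lemma root_count_subgradient:
  "s * real (root_count_disk q v) \<le> log_mean (q - [:v:]) s - log_mean (q - [:v:]) 0"
proof (cases "q - [:v:] = 0")
  case True
  then show ?thesis by (simp add: root_count_disk_sum log_mean_def)
next
  case False
  have "s * (if cmod a < 1 then 1 else 0) \<le> log_max_root s a - log_max_root 0 a" for a
    by (auto simp: log_max_root_def max_def)
  then have "(\<Sum>a\<in>#X. s * (if cmod a < 1 then 1 else 0)) \<le> (\<Sum>a\<in>#X. log_max_root s a - log_max_root 0 a)" for X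
    by (intro sum_mset_mono)
  then show ?thesis
    unfolding log_mean_diff[OF False] root_count_disk_sum sum_mset_distrib_left by simp
qed

text \<open>The left derivative of \<open>log_mean\<close> at \<open>0\<close>. Its purpose is measurability: it exhibits the root count as
a pointwise limit of integrals depending on a parameter.\<close>

lemma root_count_derivative:
  "(\<lambda>k. (log_mean (q - [:v:]) 0 - log_mean (q - [:v:]) (- (1 / real (Suc k)))) * real (Suc k))
     \<longlonglongrightarrow> real (root_count_disk q v)"
proof (cases "q - [:v:] = 0")
  case True
  then show ?thesis by (simp add: root_count_disk_sum log_mean_def)
next
  case False
  have lim: "(\<lambda>k. (log_max_root 0 a - log_max_root (- (1 / real (Suc k))) a) * real (Suc k))
     \<longlonglongrightarrow> (if cmod a < 1 then 1 else 0)" for a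
  proof (cases "a = 0")
    case True then show ?thesis by (simp add: log_max_root_def)
  next
    case a: False
    show ?thesis
    proof (cases "cmod a < 1")
      case False
      then have "ln (cmod a) \<ge> 0" by simp
      then have "max 0 (ln (cmod a)) = max (- (1 / real (Suc k))) (ln (cmod a))" for k
        by (smt (verit) divide_nonneg_nonneg of_nat_0_le_iff)
      then show ?thesis using False a by (simp add: log_max_root_def)
    next
      case True
      then have neg: "ln (cmod a) < 0" using a by simp
      have "\<forall>\<^sub>F k in sequentially. ln (cmod a) < - (1 / real (Suc k))"
      proof (rule order_tendstoD)
        show "(\<lambda>k. - (1 / real (Suc k))) \<longlonglongrightarrow> 0" by real_asymp
      qed (rule neg)
      then have "\<forall>\<^sub>F k in sequentially. (log_max_root 0 a - log_max_root (- (1 / real (Suc k))) a) * real (Suc k) = 1"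
        by eventually_elim (use neg a in \<open>auto simp: log_max_root_def max_def field_simps\<close>)
      then show ?thesis using True by (simp add: tendsto_eventually)
    qed
  qed
  have "(\<lambda>k. \<Sum>a\<in>#X. (log_max_root 0 a - log_max_root (- (1 / real (Suc k))) a) * real (Suc k))
     \<longlonglongrightarrow> (\<Sum>a\<in>#X. if cmod a < 1 then 1 else 0)" for X
  proof (induction X)
    case (add b X)
    from tendsto_add[OF lim[of b] add] show ?case by (simp del: of_nat_Suc)
  qed simp
  then show ?thesis
    unfolding log_mean_diff[OF False] root_count_disk_sum sum_mset_distrib_right .
qed

section \<open>Christoffel-Darboux kernels\<close>

definition L2sq :: "complex measure \<Rightarrow> complex poly \<Rightarrow> real" where
  "L2sq \<mu> q = (\<integral>z. (cmod (poly q z))\<^sup>2 \<partial>\<mu>)"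

text \<open>The Christoffel-Darboux kernel on the diagonal, the reciprocal of the Christoffel function.\<close>

definition cd_kernel :: "(nat \<Rightarrow> complex poly) \<Rightarrow> nat \<Rightarrow> complex \<Rightarrow> real" where
  "cd_kernel p n z = (\<Sum>j\<le>n. (cmod (poly (p j) z))\<^sup>2)"

definition kernel_poly :: "(nat \<Rightarrow> complex poly) \<Rightarrow> nat \<Rightarrow> complex \<Rightarrow> complex poly" where
  "kernel_poly p n z = (\<Sum>j\<le>n. smult (cnj (poly (p j) z)) (p j))"

text \<open>Subtracting the multiple of \<open>p n\<close> that cancels the leading coefficient lowers the degree.\<close>

lemma poly_expansion_by_degree:
  fixes p :: "nat \<Rightarrow> complex poly"
  assumes deg: "\<And>j. degree (p j) = j" and nz: "\<And>j. p j \<noteq> 0"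
  shows "degree q \<le> n \<Longrightarrow> \<exists>c. q = (\<Sum>j\<le>n. smult (c j) (p j))"
proof (induction n arbitrary: q)
  case 0
  then obtain a where "q = [:a:]" by (metis degree_eq_zeroE le_zero_eq)
  moreover obtain b where b: "p 0 = [:b:]" using deg[of 0] by (metis degree_eq_zeroE)
  moreover have "b \<noteq> 0" using nz[of 0] b by auto
  ultimately have "q = (\<Sum>j\<le>0. smult (a / b) (p j))" by simp
  then show ?case by (intro exI[of _ "\<lambda>_. a / b"])
next
  case (Suc n)
  define b where "b = coeff q (Suc n) / lead_coeff (p (Suc n))"
  have "degree (q - smult b (p (Suc n))) \<le> n"
  proof (rule degree_le, safe)
    fix i assume "n < i"
    show "coeff (q - smult b (p (Suc n))) i = 0"
    proof (cases "i = Suc n")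
      case True
      have "coeff (p (Suc n)) (Suc n) = lead_coeff (p (Suc n))" by (simp add: deg)
      moreover have "lead_coeff (p (Suc n)) \<noteq> 0" using nz by simp
      ultimately show ?thesis using True by (simp add: b_def)
    next
      case False
      then have "i > Suc n" using \<open>n < i\<close> by simp
      then show ?thesis using Suc.prems deg[of "Suc n"] by (simp add: coeff_eq_0)
    qed
  qed
  from Suc.IH[OF this] obtain c where c: "q - smult b (p (Suc n)) = (\<Sum>j\<le>n. smult (c j) (p j))" by blast
  have "q = (\<Sum>j\<le>Suc n. smult ((c(Suc n := b)) j) (p j))"
    using c by (simp add: algebra_simps)
  then show ?case by blast
qed

lemma space_disk_area [simp]: "space disk_area = ball 0 1"
  by (simp add: disk_area_def space_restrict_space)

lemma measurable_disk_area: "f \<in> borel_measurable borel \<Longrightarrow> f \<in> borel_measurable disk_area"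
  unfolding disk_area_def by (simp add: measurable_restrict_space1)

lemma measurable_poly [measurable]: "poly q \<in> borel_measurable borel" for q :: "complex poly"
  by (intro borel_measurable_continuous_onI continuous_intros)

lemma poly_bounded_cball: "\<exists>B. \<forall>z\<in>cball 0 1. cmod (poly q z) \<le> B" for q :: "complex poly"
proof -
  have "compact (poly q ` cball 0 1)"
    by (intro compact_continuous_image continuous_intros) auto
  then show ?thesis using compact_imp_bounded bounded_iff by (metis imageI)
qed

locale bergman_measure = finite_measure \<mu> for \<mu> :: "complex measure" +
  fixes p :: "nat \<Rightarrow> complex poly"
  assumes sets_eq: "sets \<mu> = sets disk_area"
    and bergman: "bergman_polynomials \<mu> p"
begin

lemma space_eq: "space \<mu> = ball 0 1"
  using sets_eq_imp_space_eq[OF sets_eq] by simp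

lemma measurable_mu: "f \<in> borel_measurable borel \<Longrightarrow> f \<in> borel_measurable \<mu>"
  using measurable_disk_area[of f] measurable_cong_sets[OF sets_eq refl] by blast

lemma degree_p: "degree (p j) = j"
  using bergman unfolding bergman_polynomials_def by blast

lemma orthonormal: "(\<integral>z. poly (p j) z * cnj (poly (p k) z) \<partial>\<mu>) = (if j = k then 1 else 0)"
  using bergman unfolding bergman_polynomials_def by blast

lemma p_nonzero: "p j \<noteq> 0"
proof
  assume "p j = 0"
  then show False using orthonormal[of j j] by simp
qed

lemma integrable_poly_prod: "integrable \<mu> (\<lambda>z. poly q z * cnj (poly r z))"
proof -
  obtain B where B: "\<And>z. z \<in> cball 0 1 \<Longrightarrow> cmod (poly (q) z) \<le> B" using poly_bounded_cball by blast
  obtain C where C: "\<And>z. z \<in> cball 0 1 \<Longrightarrow> cmod (poly (r) z) \<le> C" using poly_bounded_cball by blast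
  show ?thesis
  proof (rule integrable_const_bound)
    show "AE z in \<mu>. norm (poly q z * cnj (poly r z)) \<le> B * C"
    proof (rule AE_I2)
      fix z assume "z \<in> space \<mu>"
      then have z: "z \<in> cball 0 1" by (simp add: space_eq)
      then show "norm (poly q z * cnj (poly r z)) \<le> B * C"
        unfolding norm_mult complex_mod_cnj
        using B[OF z] C[OF z] order_trans[OF norm_ge_zero B[OF z]] by (intro mult_mono) simp_all
    qed
    show "(\<lambda>z. poly q z * cnj (poly r z)) \<in> borel_measurable \<mu>"
      by (intro measurable_mu borel_measurable_continuous_onI continuous_intros)
  qed
qed

lemma cmod_sq_eq: "complex_of_real ((cmod z)\<^sup>2) = z * cnj z"
  by (rule complex_norm_square)

lemma integrable_cmod_sq: "integrable \<mu> (\<lambda>z. (cmod (poly q z))\<^sup>2)"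
proof -
  have "integrable \<mu> (\<lambda>z. Re (poly q z * cnj (poly q z)))"
    by (rule integrable_Re[OF integrable_poly_prod])
  then show ?thesis by (simp only: cmod_sq_eq[symmetric] Re_complex_of_real)
qed

lemma parseval: "L2sq \<mu> (\<Sum>j\<le>n. smult (c j) (p j)) = (\<Sum>j\<le>n. (cmod (c j))\<^sup>2)"
proof -
  have "complex_of_real (L2sq \<mu> (\<Sum>j\<le>n. smult (c j) (p j))) =
    (\<integral>z. poly (\<Sum>j\<le>n. smult (c j) (p j)) z * cnj (poly (\<Sum>j\<le>n. smult (c j) (p j)) z) \<partial>\<mu>)"
    unfolding L2sq_def by (subst integral_complex_of_real[symmetric]) (simp only: cmod_sq_eq)
  also have "\<dots> = (\<integral>z. (\<Sum>j\<le>n. \<Sum>k\<le>n. (c j * cnj (c k)) * (poly (p j) z * cnj (poly (p k) z))) \<partial>\<mu>)"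
  proof (rule Bochner_Integration.integral_cong[OF refl])
    fix z
    show "poly (\<Sum>j\<le>n. smult (c j) (p j)) z * cnj (poly (\<Sum>j\<le>n. smult (c j) (p j)) z) =
        (\<Sum>j\<le>n. \<Sum>k\<le>n. (c j * cnj (c k)) * (poly (p j) z * cnj (poly (p k) z)))"
      unfolding poly_sum poly_smult cnj_sum complex_cnj_mult sum_product
      by (intro sum.cong refl) (simp only: mult_ac)
  qed
  also have "\<dots> = (\<Sum>j\<le>n. \<integral>z. (\<Sum>k\<le>n. (c j * cnj (c k)) * (poly (p j) z * cnj (poly (p k) z))) \<partial>\<mu>)"
    by (intro Bochner_Integration.integral_sum Bochner_Integration.integrable_sum integrable_mult_right integrable_poly_prod)
  also have "\<dots> = (\<Sum>j\<le>n. \<Sum>k\<le>n. \<integral>z. (c j * cnj (c k)) * (poly (p j) z * cnj (poly (p k) z)) \<partial>\<mu>)"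
    by (intro sum.cong refl Bochner_Integration.integral_sum integrable_mult_right integrable_poly_prod)
  also have "\<dots> = (\<Sum>j\<le>n. \<Sum>k\<le>n. (c j * cnj (c k)) * (if j = k then 1 else 0))"
    by (simp only: integral_mult_right_zero orthonormal)
  also have "\<dots> = (\<Sum>j\<le>n. c j * cnj (c j))"
    by (simp add: if_distrib cong: if_cong)
  also have "\<dots> = complex_of_real (\<Sum>j\<le>n. (cmod (c j))\<^sup>2)"
    by (simp only: of_real_sum complex_norm_square)
  finally show ?thesis by (simp only: of_real_eq_iff)
qed

lemma L2sq_nonneg: "L2sq \<mu> q \<ge> 0"
  by (simp add: L2sq_def)

text \<open>The Cauchy-Schwarz inequality for the coefficients of \<open>q\<close> in the orthonormal basis.\<close>

lemma kernel_extremal: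
  assumes "degree q \<le> n"
  shows "(cmod (poly q z))\<^sup>2 \<le> cd_kernel p n z * L2sq \<mu> q"
proof -
  obtain c where c: "q = (\<Sum>j\<le>n. smult (c j) (p j))"
    using poly_expansion_by_degree[OF degree_p p_nonzero assms] by blast
  have "cmod (poly q z) \<le> (\<Sum>j\<le>n. cmod (c j) * cmod (poly (p j) z))"
    unfolding c by (simp add: poly_sum) (rule order_trans[OF norm_sum], simp add: norm_mult)
  then have "(cmod (poly q z))\<^sup>2 \<le> (\<Sum>j\<le>n. cmod (c j) * cmod (poly (p j) z))\<^sup>2"
    by (intro power_mono) auto
  also have "\<dots> \<le> (\<Sum>j\<le>n. (cmod (c j))\<^sup>2) * (\<Sum>j\<le>n. (cmod (poly (p j) z))\<^sup>2)"
    by (rule Cauchy_Schwarz_ineq_sum)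
  finally show ?thesis by (simp add: cd_kernel_def parseval c mult.commute)
qed

lemma degree_kernel_poly: "degree (kernel_poly p n z) \<le> n"
  unfolding kernel_poly_def
  by (intro degree_sum_le) (auto intro: order_trans[OF degree_smult_le] simp: degree_p)

lemma poly_kernel_poly: "poly (kernel_poly p n z) z = of_real (cd_kernel p n z)"
  by (simp only: kernel_poly_def cd_kernel_def poly_sum poly_smult of_real_sum complex_norm_square mult.commute)

lemma L2sq_kernel_poly: "L2sq \<mu> (kernel_poly p n z) = cd_kernel p n z"
  unfolding kernel_poly_def parseval by (simp add: cd_kernel_def)

lemma kernel_pos: "cd_kernel p n z > 0"
proof -
  obtain b where b: "p 0 = [:b:]" using degree_p[of 0] by (metis degree_eq_zeroE)
  moreover have "b \<noteq> 0" using p_nonzero[of 0] b by auto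
  ultimately show ?thesis unfolding cd_kernel_def by (intro sum_pos2[of _ 0]) auto
qed

end

text \<open>Apply the extremal property of the second kernel to the product of \<open>S\<close> with the kernel polynomial of
the first measure, which attains equality in its own extremal property.\<close>

lemma kernel_comparison:
  assumes "bergman_measure \<mu> p" "bergman_measure \<nu> r"
    and deg: "degree S \<le> m"
    and le: "\<And>q. degree q \<le> n \<Longrightarrow> L2sq \<nu> (q * S) \<le> A * L2sq \<mu> q"
  shows "cd_kernel p n z * (cmod (poly S z))\<^sup>2 \<le> A * cd_kernel r (n + m) z"
proof -
  interpret \<mu>: bergman_measure \<mu> p by fact
  interpret \<nu>: bergman_measure \<nu> r by fact
  let ?k = "kernel_poly p n z"
  have "degree (?k * S) \<le> n + m"
    using degree_mult_le[of ?k S] \<mu>.degree_kernel_poly[of n z] deg by linarith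
  then have "(cmod (poly (?k * S) z))\<^sup>2 \<le> cd_kernel r (n + m) z * L2sq \<nu> (?k * S)"
    by (rule \<nu>.kernel_extremal)
  also have "\<dots> \<le> cd_kernel r (n + m) z * (A * cd_kernel p n z)"
    using le[OF \<mu>.degree_kernel_poly[of n z]] \<nu>.kernel_pos[of "n + m" z] \<mu>.L2sq_kernel_poly[of n z]
    by (intro mult_left_mono) auto
  finally have "cd_kernel p n z * (cd_kernel p n z * (cmod (poly S z))\<^sup>2) \<le> cd_kernel p n z * (A * cd_kernel r (n + m) z)"
    using \<mu>.kernel_pos[of n z]
    by (simp add: \<mu>.poly_kernel_poly norm_mult power_mult_distrib power2_eq_square mult_ac)
  then show ?thesis using \<mu>.kernel_pos[of n z] by (simp add: mult_le_cancel_left)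
qed

section \<open>The area measure of the disk\<close>

definition area_poly :: "nat \<Rightarrow> complex poly" where
  "area_poly j = monom (of_real (sqrt (real (Suc j) / pi))) j"

lemma nn_integral_disk_area:
  assumes "f \<in> borel_measurable borel"
  shows "(\<integral>\<^sup>+z. f z \<partial>disk_area) = (\<integral>\<^sup>+z. f z * indicator (ball 0 1) z \<partial>lborel)"
  unfolding disk_area_def by (rule nn_integral_restrict_space) simp

lemma emeasure_disk_area: "emeasure disk_area (ball 0 1) = ennreal pi"
  unfolding disk_area_def by (simp add: emeasure_restrict_space emeasure_ball eval_unit_ball_vol)

lemma finite_measure_disk_area: "finite_measure disk_area"
  by (rule finite_measureI) (simp add: emeasure_disk_area)

lemma nn_integral_disk_power:
  "(\<integral>\<^sup>+z. ennreal ((cmod z) ^ (2 * k)) \<partial>disk_area) = ennreal (pi / real (Suc k))"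
proof -
  have "(\<integral>\<^sup>+z. ennreal ((cmod z) ^ (2 * k)) \<partial>disk_area) =
      (\<integral>\<^sup>+z. ennreal ((cmod z) ^ (2 * k)) * indicator (ball 0 1) z \<partial>lborel)"
    by (rule nn_integral_disk_area) measurable
  also have "\<dots> = (\<integral>\<^sup>+z. ennreal (((cmod z)\<^sup>2) ^ k) * indicator {..<1} ((cmod z)\<^sup>2) \<partial>(lborel :: complex measure))"
    by (intro nn_integral_cong) (auto simp: indicator_def power_mult abs_square_less_1 power2_eq_square[symmetric])
  also have "\<dots> = (\<integral>\<^sup>+t. ennreal pi * (ennreal (t ^ k) * indicator {..<1} t * indicator {0..} t) \<partial>lborel)"
    by (rule nn_integral_radial[of "\<lambda>t. ennreal (t ^ k) * indicator {..<1} t"]) measurable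
  also have "\<dots> = (\<integral>\<^sup>+t. ennreal pi * (ennreal (t ^ k) * indicator {0..1} t) \<partial>lborel)"
    using AE_lborel_singleton[of "1::real"]
    by (intro nn_integral_cong_AE) (auto elim!: eventually_mono simp: indicator_def)
  also have "\<dots> = ennreal pi * (\<integral>\<^sup>+t. ennreal (t ^ k) * indicator {0..1} t \<partial>lborel)"
    by (rule nn_integral_cmult) measurable
  also have "(\<integral>\<^sup>+t. ennreal (t ^ k) * indicator {0..1} t \<partial>lborel) =
     ennreal (1 ^ Suc k / real (Suc k) - 0 ^ Suc k / real (Suc k))"
  proof (rule nn_integral_FTC_Icc)
    show "((\<lambda>t. t ^ Suc k / real (Suc k)) has_real_derivative x ^ k) (at x)" for x
      by (auto intro!: derivative_eq_intros simp del: of_nat_Suc power_Suc)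
  qed auto
  finally show ?thesis by (simp add: divide_inverse flip: ennreal_mult del: of_nat_Suc)
qed

text \<open>For \<open>j \<noteq> k\<close> rotation by the angle \<open>\<pi> / (j - k)\<close> changes the sign of the integrand but not the integral.\<close>

lemma integral_disk_monomials:
  "(\<integral>z. z ^ j * cnj z ^ k \<partial>disk_area) = (if j = k then of_real (pi / real (Suc k)) else 0)"
proof (cases "j = k")
  case True
  have "has_bochner_integral disk_area (\<lambda>z. (cmod z) ^ (2 * k)) (pi / real (Suc k))"
    by (rule has_bochner_integral_nn_integral)
      (auto simp: nn_integral_disk_power simp del: of_nat_Suc intro!: measurable_disk_area)
  then have "(\<integral>z. complex_of_real ((cmod z) ^ (2 * k)) \<partial>disk_area) = of_real (pi / real (Suc k))"
    unfolding integral_complex_of_real has_bochner_integral_iff by (simp only:)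
  moreover have "z ^ k * cnj z ^ k = of_real ((cmod z) ^ (2 * k))" for z
    unfolding power_mult of_real_power[of "(cmod z)\<^sup>2" k]
    by (simp only: complex_norm_square power_mult_distrib)
  ultimately show ?thesis using True by (simp only: if_True refl)
next
  case False
  define c where "c = cis (pi / (real j - real k))"
  have c1: "cmod c = 1" by (simp add: c_def)
  have "c ^ j * cnj c ^ k = cis (real j * (pi / (real j - real k)) + real k * - (pi / (real j - real k)))"
    by (simp only: c_def Complex.DeMoivre cis_cnj cis_mult)
  also have "real j * (pi / (real j - real k)) + real k * - (pi / (real j - real k)) = pi"
  proof -
    have "real j * \<theta> + real k * - \<theta> = (real j - real k) * \<theta>" for \<theta> :: real by (simp add: algebra_simps)
    from this[of "pi / (real j - real k)"] show ?thesis
      by (rule trans) (use False in simp)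
  qed
  finally have c2: "c ^ j * cnj c ^ k = -1" by simp
  define f where "f = (\<lambda>z. indicator (ball 0 1) z *\<^sub>R (z ^ j * cnj z ^ k))"
  have [measurable]: "f \<in> borel_measurable borel"
  proof -
    have "(\<lambda>z. z ^ j * cnj z ^ k) \<in> borel_measurable borel"
      by (intro borel_measurable_continuous_onI continuous_intros)
    then show ?thesis unfolding f_def by measurable
  qed
  have I: "(\<integral>z. z ^ j * cnj z ^ k \<partial>disk_area) = (\<integral>z. f z \<partial>lborel)"
    unfolding disk_area_def f_def by (subst integral_restrict_space) auto
  also have "\<dots> = (\<integral>z. f z \<partial>distr lborel borel ((*) c))"
    by (simp add: lborel_rotation[OF c1])
  also have "\<dots> = (\<integral>z. f (c * z) \<partial>lborel)"
    by (rule integral_distr) measurable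
  also have "\<dots> = (\<integral>z. - f z \<partial>lborel)"
  proof (rule Bochner_Integration.integral_cong[OF refl])
    fix z
    have "(c * z) ^ j * cnj (c * z) ^ k = (c ^ j * cnj c ^ k) * (z ^ j * cnj z ^ k)"
      by (simp add: power_mult_distrib)
    then show "f (c * z) = - f z" using c1 by (simp add: f_def c2 indicator_def norm_mult)
  qed
  also have "(\<integral>z. - f z \<partial>lborel) = - (\<integral>z. f z \<partial>lborel)" by simp
  finally show ?thesis using False I by simp
qed

lemma bergman_measure_area: "bergman_measure disk_area area_poly"
proof -
  have "bergman_polynomials disk_area area_poly"
    unfolding bergman_polynomials_def
  proof (intro conjI allI)
    fix j k
    have ne: "complex_of_real (sqrt (real (Suc j) / pi)) \<noteq> 0" for j by simp
    show "degree (area_poly j) = j"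
      unfolding area_poly_def by (rule degree_monom_eq[OF ne])
    then have lc: "lead_coeff (area_poly j) = of_real (sqrt (real (Suc j) / pi))"
      by (simp add: area_poly_def)
    show "lead_coeff (area_poly j) \<in> \<real>" unfolding lc by (rule Reals_of_real)
    show "Re (lead_coeff (area_poly j)) > 0" unfolding lc by simp
    let ?a = "\<lambda>j. complex_of_real (sqrt (real (Suc j) / pi))"
    have "(\<integral>z. poly (area_poly j) z * cnj (poly (area_poly k) z) \<partial>disk_area) =
        (\<integral>z. ?a j * ?a k * (z ^ j * cnj z ^ k) \<partial>disk_area)"
      by (simp add: area_poly_def poly_monom mult_ac del: of_nat_Suc of_real_divide)
    also have "\<dots> = ?a j * ?a k * (\<integral>z. z ^ j * cnj z ^ k \<partial>disk_area)" by simp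
    also have "\<dots> = (if j = k then 1 else 0)"
      unfolding integral_disk_monomials by (simp flip: of_real_mult del: of_nat_Suc)
    finally show "(\<integral>z. poly (area_poly j) z * cnj (poly (area_poly k) z) \<partial>disk_area) = (if j = k then 1 else 0)" .
  qed
  with finite_measure_disk_area show ?thesis
    by (intro bergman_measure.intro bergman_measure_axioms.intro) auto
qed

interpretation area: bergman_measure disk_area area_poly
  by (rule bergman_measure_area)

lemma kernel_area_eq: "cd_kernel area_poly n z = (\<Sum>j\<le>n. real (Suc j) * (cmod z) ^ (2 * j)) / pi"
  unfolding cd_kernel_def area_poly_def sum_divide_distrib
  by (intro sum.cong) (auto simp: poly_monom norm_mult norm_power power_mult_distrib
      simp flip: power_mult mult.commute[of 2] simp del: of_nat_Suc)

text \<open>Dilation multiplies the coefficient of degree \<open>j\<close> by \<open>\<rho>^j\<close>.\<close>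

lemma L2sq_area_dilate:
  assumes "0 \<le> \<rho>" "\<rho> \<le> 1"
  shows "L2sq disk_area (pcompose q [:0, of_real \<rho>:]) \<le> L2sq disk_area q"
proof -
  obtain c where c: "q = (\<Sum>j\<le>degree q. smult (c j) (area_poly j))"
    using poly_expansion_by_degree[OF area.degree_p area.p_nonzero order_refl] by blast
  have m: "pcompose (monom a j) [:0, of_real \<rho>:] = smult (of_real \<rho> ^ j) (monom a j)" for a :: complex and j
    by (rule poly_eq_poly_eq_iff[THEN iffD1])
       (auto simp: fun_eq_iff poly_pcompose poly_monom power_mult_distrib)
  have "pcompose q [:0, of_real \<rho>:] = (\<Sum>j\<le>degree q. smult (of_real \<rho> ^ j * c j) (area_poly j))"
    by (subst c) (simp add: pcompose_sum pcompose_smult area_poly_def m mult_ac)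
  then have "L2sq disk_area (pcompose q [:0, of_real \<rho>:]) = (\<Sum>j\<le>degree q. (cmod (of_real \<rho> ^ j * c j))\<^sup>2)"
    by (simp only: area.parseval)
  also have "\<dots> \<le> (\<Sum>j\<le>degree q. (cmod (c j))\<^sup>2)"
    using assms by (intro sum_mono power_mono) (auto simp: norm_mult norm_power mult_left_le_one_le power_le_one)
  also have "\<dots> = L2sq disk_area q"
    by (subst c) (simp only: area.parseval)
  finally show ?thesis .
qed

text \<open>A boundary annulus carries a fixed proportion of the area norm of every polynomial, whatever its
degree: by the substitution \<open>z \<mapsto> \<rho> z\<close>, the disk of radius \<open>\<rho>\<close> carries at most the proportion \<open>\<rho>\<^sup>2\<close>.\<close>

lemma L2sq_area_annulus:
  assumes "0 < \<rho>" "\<rho> < 1"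
  shows "(1 - \<rho>\<^sup>2) * L2sq disk_area q \<le> (\<integral>z. (cmod (poly q z))\<^sup>2 * indicator (- ball 0 \<rho>) z \<partial>disk_area)"
proof -
  have enn: "ennreal (L2sq disk_area r) = (\<integral>\<^sup>+z. ennreal ((cmod (poly r z))\<^sup>2) \<partial>disk_area)" for r
    unfolding L2sq_def by (rule nn_integral_eq_integral[symmetric, OF area.integrable_cmod_sq]) simp
  have int: "integrable disk_area (\<lambda>z. (cmod (poly q z))\<^sup>2 * indicator A z)" if [measurable]: "A \<in> sets borel" for A
  proof (rule Bochner_Integration.integrable_bound[OF area.integrable_cmod_sq[of q]])
    show "(\<lambda>z. (cmod (poly q z))\<^sup>2 * indicator A z) \<in> borel_measurable disk_area"
      by (intro measurable_disk_area) measurable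
  qed (auto simp: indicator_def)
  have i1: "integrable disk_area (\<lambda>z. (cmod (poly q z))\<^sup>2 * indicator (ball 0 \<rho>) z)"
    and i2: "integrable disk_area (\<lambda>z. (cmod (poly q z))\<^sup>2 * indicator (- ball 0 \<rho>) z)"
    by (auto intro!: int)
  have "ennreal (\<integral>z. (cmod (poly q z))\<^sup>2 * indicator (ball 0 \<rho>) z \<partial>disk_area) =
     (\<integral>\<^sup>+z. ennreal ((cmod (poly q z))\<^sup>2) * indicator (ball 0 \<rho>) z \<partial>disk_area)"
    by (subst nn_integral_eq_integral[symmetric, OF i1]) (auto intro!: nn_integral_cong simp: indicator_def)
  also have "\<dots> = (\<integral>\<^sup>+z. ennreal ((cmod (poly q z))\<^sup>2) * indicator (ball 0 \<rho>) z * indicator (ball 0 1) z \<partial>lborel)"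
    by (rule nn_integral_disk_area) measurable
  also have "\<dots> = ennreal ((cmod (of_real \<rho>))\<^sup>2) *
     (\<integral>\<^sup>+z. ennreal ((cmod (poly q (of_real \<rho> * z)))\<^sup>2) * indicator (ball 0 \<rho>) (of_real \<rho> * z) * indicator (ball 0 1) (of_real \<rho> * z) \<partial>lborel)"
    using assms by (intro nn_integral_complex_mult) auto
  also have "(\<integral>\<^sup>+z. ennreal ((cmod (poly q (of_real \<rho> * z)))\<^sup>2) * indicator (ball 0 \<rho>) (of_real \<rho> * z) * indicator (ball 0 1) (of_real \<rho> * z) \<partial>lborel) =
      (\<integral>\<^sup>+z. ennreal ((cmod (poly (pcompose q [:0, of_real \<rho>:]) z))\<^sup>2) * indicator (ball 0 1) z \<partial>lborel)"
  proof (rule nn_integral_cong)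
    fix z
    have "\<rho> * cmod z < \<rho> \<longleftrightarrow> cmod z < 1" using assms by simp
    moreover have "\<rho> * cmod z < 1" if "cmod z < 1"
    proof -
      have "\<rho> * cmod z \<le> cmod z" using assms by (intro mult_left_le_one_le) auto
      then show ?thesis using that by linarith
    qed
    ultimately show "ennreal ((cmod (poly q (of_real \<rho> * z)))\<^sup>2) * indicator (ball 0 \<rho>) (of_real \<rho> * z) * indicator (ball 0 1) (of_real \<rho> * z) =
        ennreal ((cmod (poly (pcompose q [:0, of_real \<rho>:]) z))\<^sup>2) * indicator (ball 0 1) z"
      using assms by (auto simp: indicator_def norm_mult poly_pcompose mult.commute)
  qed
  also have "\<dots> = ennreal (L2sq disk_area (pcompose q [:0, of_real \<rho>:]))"
    unfolding enn by (rule nn_integral_disk_area[symmetric]) measurable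
  also have "ennreal ((cmod (of_real \<rho>))\<^sup>2) * \<dots> \<le> ennreal (\<rho>\<^sup>2 * L2sq disk_area q)"
  proof -
    have "\<rho>\<^sup>2 * L2sq disk_area (pcompose q [:0, of_real \<rho>:]) \<le> \<rho>\<^sup>2 * L2sq disk_area q"
      using assms by (intro mult_left_mono L2sq_area_dilate) auto
    then show ?thesis
      using assms by (subst ennreal_mult[symmetric]) (auto simp: area.L2sq_nonneg intro: ennreal_leI)
  qed
  finally have le: "(\<integral>z. (cmod (poly q z))\<^sup>2 * indicator (ball 0 \<rho>) z \<partial>disk_area) \<le> \<rho>\<^sup>2 * L2sq disk_area q"
    using area.L2sq_nonneg[of q] by (simp add: ennreal_le_iff)
  have "L2sq disk_area q = (\<integral>z. (cmod (poly q z))\<^sup>2 * indicator (ball 0 \<rho>) z + (cmod (poly q z))\<^sup>2 * indicator (- ball 0 \<rho>) z \<partial>disk_area)"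
    unfolding L2sq_def by (intro Bochner_Integration.integral_cong) (auto simp: indicator_def)
  also have "\<dots> = (\<integral>z. (cmod (poly q z))\<^sup>2 * indicator (ball 0 \<rho>) z \<partial>disk_area) +
     (\<integral>z. (cmod (poly q z))\<^sup>2 * indicator (- ball 0 \<rho>) z \<partial>disk_area)"
    by (rule Bochner_Integration.integral_add[OF i1 i2])
  finally show ?thesis using le by (simp add: algebra_simps)
qed

lemma kernel_area_mono: "cmod z \<le> 1 \<Longrightarrow> cd_kernel area_poly n z \<le> cd_kernel area_poly n 1"
  unfolding kernel_area_eq by (intro divide_right_mono sum_mono mult_left_mono) (auto intro: power_le_one)

section \<open>Peak polynomials\<close>

text \<open>The polynomial \<open>((\<zeta> + z) / 2)^m\<close>, which has modulus \<open>1\<close> at \<open>\<zeta>\<close> and is exponentially small in \<open>m\<close> on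
the rest of the closed disk, away from \<open>\<zeta>\<close>.\<close>

definition peak :: "complex \<Rightarrow> nat \<Rightarrow> complex poly" where
  "peak \<zeta> m = [:\<zeta> / 2, 1 / 2:] ^ m"

lemma poly_peak: "poly (peak \<zeta> m) z = ((\<zeta> + z) / 2) ^ m"
  by (simp add: peak_def poly_power add_divide_distrib)

lemma degree_peak: "degree (peak \<zeta> m) \<le> m"
  unfolding peak_def by (rule order_trans[OF degree_power_le]) simp

text \<open>The parallelogram law for \<open>\<zeta>\<close> and \<open>z\<close>.\<close>

lemma peak_parallelogram:
  assumes "cmod \<zeta> = 1" "cmod z \<le> 1"
  shows "(cmod ((\<zeta> + z) / 2))\<^sup>2 \<le> 1 - (cmod (z - \<zeta>))\<^sup>2 / 4"
proof -
  have "(cmod (\<zeta> + z))\<^sup>2 + (cmod (z - \<zeta>))\<^sup>2 = 2 * (cmod \<zeta>)\<^sup>2 + 2 * (cmod z)\<^sup>2"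
    unfolding cmod_power2 by (simp add: power2_eq_square algebra_simps)
  moreover have "(cmod z)\<^sup>2 \<le> 1" using assms(2) by (simp add: power_le_one)
  ultimately show ?thesis using assms(1) by (simp add: norm_divide power_divide)
qed

lemma peak_le_1:
  assumes "cmod \<zeta> = 1" "cmod z \<le> 1"
  shows "(cmod (poly (peak \<zeta> m) z))\<^sup>2 \<le> 1"
proof -
  have "(cmod ((\<zeta> + z) / 2))\<^sup>2 \<le> 1"
    using peak_parallelogram[OF assms] zero_le_power2[of "cmod (z - \<zeta>)"] by linarith
  then have "((cmod ((\<zeta> + z) / 2))\<^sup>2) ^ m \<le> 1" by (rule power_le_one[OF zero_le_power2])
  then show ?thesis by (simp add: poly_peak norm_power flip: power_mult mult.commute[of 2])
qed

lemma peak_far: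
  assumes "cmod \<zeta> = 1" "cmod z \<le> 1" "\<delta> \<ge> 0" "cmod (z - \<zeta>) \<ge> \<delta>"
  shows "(cmod (poly (peak \<zeta> m) z))\<^sup>2 \<le> (1 - \<delta>\<^sup>2 / 4) ^ m"
proof -
  have "\<delta>\<^sup>2 \<le> (cmod (z - \<zeta>))\<^sup>2" using assms by (intro power_mono) auto
  then have "(cmod ((\<zeta> + z) / 2))\<^sup>2 \<le> 1 - \<delta>\<^sup>2 / 4"
    using peak_parallelogram[OF assms(1,2)] by linarith
  then have "((cmod ((\<zeta> + z) / 2))\<^sup>2) ^ m \<le> (1 - \<delta>\<^sup>2 / 4) ^ m" by (intro power_mono) auto
  then show ?thesis by (simp add: poly_peak norm_power flip: power_mult mult.commute[of 2])
qed

lemma peak_radial: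
  assumes "cmod \<zeta> = 1"
  shows "cmod (poly (peak \<zeta> m) (of_real (exp s) * \<zeta>)) = ((1 + exp s) / 2) ^ m"
proof -
  have "(\<zeta> + of_real (exp s) * \<zeta>) / 2 = of_real ((1 + exp s) / 2) * \<zeta>"
    by (simp add: field_simps)
  then have "poly (peak \<zeta> m) (of_real (exp s) * \<zeta>) = (of_real ((1 + exp s) / 2) * \<zeta>) ^ m"
    unfolding poly_peak by (simp only:)
  moreover have "\<bar>(1 + exp s) / 2\<bar> = (1 + exp s) / 2" by simp
  ultimately show ?thesis using assms by (simp only: norm_power norm_mult norm_of_real mult_1_right)
qed

section \<open>Weights that are continuous on the circle\<close>

text \<open>Only the behaviour of the weight near the circle is controlled; inside the disk it is an arbitrary
positive integrable function.\<close>

locale disk_weight =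
  fixes \<mu> :: "complex measure" and w :: "complex \<Rightarrow> real" and p :: "nat \<Rightarrow> complex poly"
  assumes w_measurable: "w \<in> borel_measurable disk_area"
    and w_pos: "\<And>z. z \<in> cball 0 1 \<Longrightarrow> w z > 0"
    and w_cont: "\<And>z. z \<in> sphere 0 1 \<Longrightarrow> continuous (at z within cball 0 1) w"
    and \<mu>_density: "\<mu> = density disk_area (\<lambda>z. ennreal (w z))"
    and \<mu>_finite: "finite_measure \<mu>"
    and bergman: "bergman_polynomials \<mu> p"
begin

sublocale mu: bergman_measure \<mu> p
  using \<mu>_finite bergman by (intro bergman_measure.intro bergman_measure_axioms.intro) (auto simp: \<mu>_density)

text \<open>
The modulus of continuity is uniform along the circle by compactness. The points \<open>z\<close> range over the
closed disk, not only over the circle.\<close>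

lemma w_uniform:
  assumes "\<eta> > 0"
  obtains \<delta> where "\<delta> > 0"
    "\<And>\<zeta> z. \<zeta> \<in> sphere 0 1 \<Longrightarrow> z \<in> cball 0 1 \<Longrightarrow> dist z \<zeta> < \<delta> \<Longrightarrow> \<bar>w z - w \<zeta>\<bar> < \<eta>"
proof -
  define G where "G = {B. open B \<and> (\<forall>z\<in>B \<inter> cball 0 1. \<forall>z'\<in>B \<inter> cball 0 1. \<bar>w z - w z'\<bar> < \<eta>)}"
  have sub: "sphere (0::complex) 1 \<subseteq> \<Union>G"
  proof
    fix \<zeta> :: complex assume \<zeta>: "\<zeta> \<in> sphere 0 1"
    have "\<eta> / 2 > 0" using assms by simp
    then obtain d where d: "d > 0" "\<And>z. z \<in> cball 0 1 \<Longrightarrow> dist z \<zeta> < d \<Longrightarrow> dist (w z) (w \<zeta>) < \<eta> / 2"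
      using w_cont[OF \<zeta>] unfolding continuous_within_eps_delta by metis
    have "ball \<zeta> d \<in> G"
      unfolding G_def
    proof (intro CollectI conjI ballI)
      fix z z' assume "z \<in> ball \<zeta> d \<inter> cball 0 1" "z' \<in> ball \<zeta> d \<inter> cball 0 1"
      then have "dist (w z) (w \<zeta>) < \<eta> / 2" "dist (w z') (w \<zeta>) < \<eta> / 2"
        using d(2)[of z] d(2)[of z'] by (simp_all add: dist_commute[of \<zeta>])
      then show "\<bar>w z - w z'\<bar> < \<eta>" unfolding dist_real_def by linarith
    qed simp
    then show "\<zeta> \<in> \<Union>G" using d(1) by (meson UnionI centre_in_ball)
  qed
  obtain e where e: "e > 0" "\<And>\<zeta>. \<zeta> \<in> sphere 0 1 \<Longrightarrow> \<exists>B\<in>G. ball \<zeta> e \<subseteq> B"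
  proof (rule Heine_Borel_lemma[OF compact_sphere sub])
    show "open B" if "B \<in> G" for B using that unfolding G_def by blast
  qed blast
  show ?thesis
  proof
    fix \<zeta> z :: complex assume *: "\<zeta> \<in> sphere 0 1" "z \<in> cball 0 1" "dist z \<zeta> < e"
    then obtain B where "B \<in> G" "ball \<zeta> e \<subseteq> B" using e(2) by blast
    moreover have "z \<in> ball \<zeta> e" "\<zeta> \<in> ball \<zeta> e" using * e(1) by (auto simp: dist_commute)
    moreover have "\<zeta> \<in> cball 0 1" using *(1) by auto
    ultimately show "\<bar>w z - w \<zeta>\<bar> < \<eta>" using *(2) unfolding G_def by blast
  qed (fact e(1))
qed

lemma w_bounds:
  obtains a b where "a > 0" "\<And>\<zeta>. \<zeta> \<in> sphere 0 1 \<Longrightarrow> a \<le> w \<zeta> \<and> w \<zeta> \<le> b"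
proof -
  have c: "continuous_on (sphere 0 1) w"
    unfolding continuous_on_eq_continuous_within
  proof
    fix z :: complex assume "z \<in> sphere 0 1"
    then show "continuous (at z within sphere 0 1) w"
      by (rule continuous_within_subset[OF w_cont]) auto
  qed
  obtain x where x: "x \<in> sphere 0 1" "\<And>y. y \<in> sphere 0 1 \<Longrightarrow> w x \<le> w y"
    using continuous_attains_inf[OF compact_sphere _ c] by auto
  obtain y where y: "y \<in> sphere 0 1" "\<And>z. z \<in> sphere 0 1 \<Longrightarrow> w z \<le> w y"
    using continuous_attains_sup[OF compact_sphere _ c] by auto
  show ?thesis
  proof (rule that)
    show "w x > 0" using x(1) by (intro w_pos) auto
    show "w x \<le> w \<zeta> \<and> w \<zeta> \<le> w y" if "\<zeta> \<in> sphere 0 1" for \<zeta>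
      using x(2)[OF that] y(2)[OF that] ..
  qed
qed

lemma w_relative:
  assumes "0 < \<epsilon>"
  obtains \<delta> where "0 < \<delta>" "\<delta> < 1"
    "\<And>\<zeta> z. \<zeta> \<in> sphere 0 1 \<Longrightarrow> z \<in> cball 0 1 \<Longrightarrow> cmod (z - \<zeta>) < \<delta> \<Longrightarrow> (1 - \<epsilon>) * w \<zeta> \<le> w z \<and> w z \<le> (1 + \<epsilon>) * w \<zeta>"
proof -
  obtain a b where a: "a > 0" and ab: "\<And>\<zeta>. \<zeta> \<in> sphere 0 1 \<Longrightarrow> a \<le> w \<zeta> \<and> w \<zeta> \<le> b"
    using w_bounds by blast
  have "\<epsilon> * a > 0" using a assms by simp
  then obtain \<delta> where \<delta>: "\<delta> > 0"
    "\<And>\<zeta> z. \<zeta> \<in> sphere 0 1 \<Longrightarrow> z \<in> cball 0 1 \<Longrightarrow> dist z \<zeta> < \<delta> \<Longrightarrow> \<bar>w z - w \<zeta>\<bar> < \<epsilon> * a"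
    using w_uniform by metis
  show ?thesis
  proof (rule that[of "min \<delta> (1/2)"])
    fix \<zeta> z :: complex assume *: "\<zeta> \<in> sphere 0 1" "z \<in> cball 0 1" "cmod (z - \<zeta>) < min \<delta> (1/2)"
    then have "\<bar>w z - w \<zeta>\<bar> < \<epsilon> * a" by (intro \<delta>(2)) (auto simp: dist_norm)
    moreover have "\<epsilon> * a \<le> \<epsilon> * w \<zeta>" using ab[OF *(1)] assms by simp
    ultimately have "\<bar>w z - w \<zeta>\<bar> \<le> \<epsilon> * w \<zeta>" by linarith
    then show "(1 - \<epsilon>) * w \<zeta> \<le> w z \<and> w z \<le> (1 + \<epsilon>) * w \<zeta>"
      unfolding left_diff_distrib distrib_right by linarith
  qed (use \<delta>(1) in auto)
qed

lemma AE_w_nonneg: "AE z in disk_area. 0 \<le> w z"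
proof (rule AE_I2)
  fix z assume "z \<in> space disk_area"
  then have "z \<in> cball 0 1" by simp
  then show "0 \<le> w z" by (rule less_imp_le[OF w_pos])
qed

lemma integrable_mu_iff:
  fixes f :: "complex \<Rightarrow> real"
  assumes "f \<in> borel_measurable borel"
  shows "integrable \<mu> f \<longleftrightarrow> integrable disk_area (\<lambda>z. w z * f z)"
  unfolding \<mu>_density
  by (subst integrable_density[OF measurable_disk_area[OF assms] w_measurable AE_w_nonneg]) simp

lemma integral_mu:
  fixes f :: "complex \<Rightarrow> real"
  assumes "f \<in> borel_measurable borel"
  shows "(\<integral>z. f z \<partial>\<mu>) = (\<integral>z. w z * f z \<partial>disk_area)"
  unfolding \<mu>_density
  by (subst integral_density[OF measurable_disk_area[OF assms] w_measurable AE_w_nonneg]) simp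

lemma integrable_w: "integrable disk_area w"
proof -
  have "integrable disk_area (\<lambda>z. w z * 1)"
    by (rule integrable_mu_iff[THEN iffD1, OF _ mu.integrable_const]) measurable
  then show ?thesis by (simp only: mult_1_right)
qed

lemma integrable_w_sq: "integrable disk_area (\<lambda>z. w z * (cmod (poly q z))\<^sup>2)"
  by (rule integrable_mu_iff[THEN iffD1, OF _ mu.integrable_cmod_sq]) measurable

lemma L2sq_weighted: "L2sq \<mu> q = (\<integral>z. w z * (cmod (poly q z))\<^sup>2 \<partial>disk_area)"
  unfolding L2sq_def by (rule integral_mu) measurable

definition total_mass :: real where "total_mass = (\<integral>z. w z \<partial>disk_area)"

lemma total_mass_nonneg: "total_mass \<ge> 0"
  unfolding total_mass_def by (rule integral_nonneg_AE[OF AE_w_nonneg])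

text \<open>
The weight may be arbitrarily small inside the disk, but it is bounded below on a boundary annulus,
and this annulus controls the area norm of polynomials of all degrees with one constant.\<close>

lemma L2sq_area_le_weighted:
  obtains C where "C \<ge> 0" "\<And>q. L2sq disk_area q \<le> C * L2sq \<mu> q"
proof -
  obtain a b where a: "a > 0" and ab: "\<And>\<zeta>. \<zeta> \<in> sphere 0 1 \<Longrightarrow> a \<le> w \<zeta> \<and> w \<zeta> \<le> b"
    using w_bounds by blast
  obtain \<delta> where \<delta>: "0 < \<delta>" "\<delta> < 1"
    "\<And>\<zeta> z. \<zeta> \<in> sphere 0 1 \<Longrightarrow> z \<in> cball 0 1 \<Longrightarrow> cmod (z - \<zeta>) < \<delta> \<Longrightarrow> (1 - 1/2) * w \<zeta> \<le> w z \<and> w z \<le> (1 + 1/2) * w \<zeta>"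
    by (rule w_relative[OF half_gt_zero[OF zero_less_one]]) blast
  define \<rho> where "\<rho> = 1 - \<delta> / 2"
  have \<rho>: "0 < \<rho>" "\<rho> < 1" using \<delta>(1,2) by (auto simp: \<rho>_def)
  have \<rho>2: "1 - \<rho>\<^sup>2 > 0" using \<rho> power_less_one_iff[of \<rho> 2] by simp
  have w_low: "a / 2 \<le> w z" if "cmod z < 1" "cmod z \<ge> \<rho>" for z
  proof -
    define \<zeta> where "\<zeta> = sgn z"
    have z: "z \<noteq> 0" using that \<rho> by auto
    then have \<zeta>: "\<zeta> \<in> sphere 0 1" by (simp add: \<zeta>_def norm_sgn)
    have zz: "z = of_real (cmod z) * \<zeta>" using z by (simp add: \<zeta>_def sgn_eq)
    have "z - \<zeta> = of_real (cmod z) * \<zeta> - \<zeta>" by (rule arg_cong[OF zz, of "\<lambda>x. x - \<zeta>"])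
    also have "\<dots> = of_real (cmod z - 1) * \<zeta>" by (simp add: algebra_simps)
    finally have "z - \<zeta> = of_real (cmod z - 1) * \<zeta>" .
    then have "cmod (z - \<zeta>) = \<bar>cmod z - 1\<bar>" using \<zeta> by (simp add: norm_mult del: of_real_diff)
    also have "\<dots> < \<delta>" using that \<delta>(1,2) unfolding \<rho>_def by linarith
    finally have "(1 - 1/2) * w \<zeta> \<le> w z" by (intro \<delta>(3)[THEN conjunct1] \<zeta>) (use that in auto)
    then show ?thesis using ab[OF \<zeta>] by simp
  qed
  have le: "L2sq disk_area q \<le> 2 / (a * (1 - \<rho>\<^sup>2)) * L2sq \<mu> q" for q
  proof -
    have "(1 - \<rho>\<^sup>2) * L2sq disk_area q \<le> (\<integral>z. (cmod (poly q z))\<^sup>2 * indicator (- ball 0 \<rho>) z \<partial>disk_area)"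
      by (rule L2sq_area_annulus[OF \<rho>])
    also have "\<dots> \<le> (\<integral>z. 2 / a * (w z * (cmod (poly q z))\<^sup>2) \<partial>disk_area)"
    proof (rule integral_mono_AE')
      show "integrable disk_area (\<lambda>z. 2 / a * (w z * (cmod (poly q z))\<^sup>2))"
        by (intro integrable_mult_right integrable_w_sq)
      show "AE z in disk_area. (cmod (poly q z))\<^sup>2 * indicator (- ball 0 \<rho>) z \<le> 2 / a * (w z * (cmod (poly q z))\<^sup>2)"
      proof (rule AE_I2)
        fix z assume "z \<in> space disk_area"
        then have z: "cmod z < 1" by simp
        show "(cmod (poly q z))\<^sup>2 * indicator (- ball 0 \<rho>) z \<le> 2 / a * (w z * (cmod (poly q z))\<^sup>2)"
        proof (cases "cmod z \<ge> \<rho>")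
          case True
          have "1 \<le> 2 / a * w z" using w_low[OF z True] a by (simp add: field_simps)
          then have "1 * (cmod (poly q z))\<^sup>2 \<le> 2 / a * w z * (cmod (poly q z))\<^sup>2"
            by (rule mult_right_mono) simp
          then show ?thesis using True by (simp add: mult.assoc)
        next
          case False
          then show ?thesis using w_pos[of z] z a by (simp add: less_imp_le)
        qed
      qed
      show "AE z in disk_area. 0 \<le> 2 / a * (w z * (cmod (poly q z))\<^sup>2)"
        using AE_w_nonneg by eventually_elim (use a in simp)
    qed
    also have "\<dots> = 2 / a * L2sq \<mu> q" by (simp add: L2sq_weighted)
    finally have "L2sq disk_area q \<le> 2 / a * L2sq \<mu> q / (1 - \<rho>\<^sup>2)"
      using \<rho>2 by (subst pos_le_divide_eq) (simp_all add: mult.commute)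
    then show ?thesis by simp
  qed
  show ?thesis
  proof (rule that[OF _ le])
    show "0 \<le> 2 / (a * (1 - \<rho>\<^sup>2))" using a \<rho>2 by simp
  qed
qed

text \<open>
Near \<open>\<zeta>\<close> the peak polynomial is at most \<open>1\<close> and \<open>1 \<le> w z / ((1 - \<epsilon>) w \<zeta>)\<close>; at distance at least \<open>\<delta>\<close> its
square is at most \<open>Q ^ m\<close>, and the full area norm of \<open>q\<close> is controlled by the weighted one.\<close>

lemma L2sq_peak_area_le:
  assumes \<epsilon>: "0 < \<epsilon>" "\<epsilon> < 1" and \<delta>: "0 < \<delta>"
    and rel: "\<And>\<zeta> z. \<zeta> \<in> sphere 0 1 \<Longrightarrow> z \<in> cball 0 1 \<Longrightarrow> cmod (z - \<zeta>) < \<delta> \<Longrightarrow> (1 - \<epsilon>) * w \<zeta> \<le> w z \<and> w z \<le> (1 + \<epsilon>) * w \<zeta>"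
    and C: "\<And>q. L2sq disk_area q \<le> C * L2sq \<mu> q"
    and \<zeta>: "\<zeta> \<in> sphere 0 1" and Q: "Q = 1 - \<delta>\<^sup>2 / 4" "Q \<ge> 0"
  shows "L2sq disk_area (q * peak \<zeta> m) \<le> (1 / ((1 - \<epsilon>) * w \<zeta>) + C * Q ^ m) * L2sq \<mu> q"
proof -
  have w0: "(1 - \<epsilon>) * w \<zeta> > 0" using w_pos[of \<zeta>] \<zeta> \<epsilon> by simp
  have "L2sq disk_area (q * peak \<zeta> m) \<le>
      (\<integral>z. 1 / ((1 - \<epsilon>) * w \<zeta>) * (w z * (cmod (poly q z))\<^sup>2) + Q ^ m * (cmod (poly q z))\<^sup>2 \<partial>disk_area)"
    unfolding L2sq_def
  proof (rule integral_mono_AE[OF area.integrable_cmod_sq])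
    show "integrable disk_area (\<lambda>z. 1 / ((1 - \<epsilon>) * w \<zeta>) * (w z * (cmod (poly q z))\<^sup>2) + Q ^ m * (cmod (poly q z))\<^sup>2)"
      by (intro Bochner_Integration.integrable_add integrable_mult_right integrable_w_sq area.integrable_cmod_sq)
    show "AE z in disk_area. (cmod (poly (q * peak \<zeta> m) z))\<^sup>2 \<le>
        1 / ((1 - \<epsilon>) * w \<zeta>) * (w z * (cmod (poly q z))\<^sup>2) + Q ^ m * (cmod (poly q z))\<^sup>2"
    proof (rule AE_I2)
      fix z assume "z \<in> space disk_area"
      then have z: "cmod z \<le> 1" by simp
      have eq: "(cmod (poly (q * peak \<zeta> m) z))\<^sup>2 = (cmod (poly (peak \<zeta> m) z))\<^sup>2 * (cmod (poly q z))\<^sup>2"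
        by (simp add: norm_mult power_mult_distrib)
      have wz: "w z > 0" using w_pos[of z] z by simp
      have nn: "0 \<le> Q ^ m" using Q by simp
      have "(cmod (poly (peak \<zeta> m) z))\<^sup>2 \<le> 1 / ((1 - \<epsilon>) * w \<zeta>) * w z + Q ^ m"
      proof (cases "cmod (z - \<zeta>) < \<delta>")
        case True
        have "1 \<le> 1 / ((1 - \<epsilon>) * w \<zeta>) * w z"
          using rel[OF \<zeta> _ True] z w0 by (simp add: pos_le_divide_eq)
        then show ?thesis using peak_le_1[of \<zeta> z m] \<zeta> z nn by simp
      next
        case False
        then have "(cmod (poly (peak \<zeta> m) z))\<^sup>2 \<le> Q ^ m"
          unfolding Q using \<zeta> z \<delta> by (intro peak_far) auto
        then show ?thesis using w0 wz by (simp add: add_increasing)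
      qed
      then have "(cmod (poly (peak \<zeta> m) z))\<^sup>2 * (cmod (poly q z))\<^sup>2 \<le> (1 / ((1 - \<epsilon>) * w \<zeta>) * w z + Q ^ m) * (cmod (poly q z))\<^sup>2"
        by (rule mult_right_mono) simp
      then show "(cmod (poly (q * peak \<zeta> m) z))\<^sup>2 \<le>
        1 / ((1 - \<epsilon>) * w \<zeta>) * (w z * (cmod (poly q z))\<^sup>2) + Q ^ m * (cmod (poly q z))\<^sup>2"
        unfolding eq by (simp only: distrib_right mult.assoc)
    qed
  qed
  also have "\<dots> = 1 / ((1 - \<epsilon>) * w \<zeta>) * L2sq \<mu> q + Q ^ m * L2sq disk_area q"
    unfolding L2sq_weighted L2sq_def[of disk_area]
    by (subst Bochner_Integration.integral_add)
       (auto intro!: integrable_mult_right integrable_w_sq area.integrable_cmod_sq)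
  also have "\<dots> \<le> 1 / ((1 - \<epsilon>) * w \<zeta>) * L2sq \<mu> q + Q ^ m * (C * L2sq \<mu> q)"
    using C Q(2) by (intro add_left_mono mult_left_mono zero_le_power)
  also have "\<dots> = (1 / ((1 - \<epsilon>) * w \<zeta>) + C * Q ^ m) * L2sq \<mu> q"
    by algebra
  finally show ?thesis .
qed

text \<open>
The reverse estimate. Far from \<open>\<zeta>\<close> the weight may be unbounded, so only its total mass is used
there, while \<open>\<bar>q\<bar>\<^sup>2\<close> is replaced by a bound for its supremum: the area kernel at \<open>1\<close>, which
is polynomial in \<open>n\<close>, times the area norm.\<close>

lemma L2sq_peak_weighted_le:
  assumes \<epsilon>: "0 < \<epsilon>" and \<delta>: "0 < \<delta>"
    and rel: "\<And>\<zeta> z. \<zeta> \<in> sphere 0 1 \<Longrightarrow> z \<in> cball 0 1 \<Longrightarrow> cmod (z - \<zeta>) < \<delta> \<Longrightarrow> (1 - \<epsilon>) * w \<zeta> \<le> w z \<and> w z \<le> (1 + \<epsilon>) * w \<zeta>"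
    and \<zeta>: "\<zeta> \<in> sphere 0 1" and Q: "Q = 1 - \<delta>\<^sup>2 / 4" "Q \<ge> 0" and deg: "degree q \<le> n"
  shows "L2sq \<mu> (q * peak \<zeta> m) \<le> ((1 + \<epsilon>) * w \<zeta> + Q ^ m * cd_kernel area_poly n 1 * total_mass) * L2sq disk_area q"
proof -
  have w0: "w \<zeta> > 0" using w_pos[of \<zeta>] \<zeta> by simp
  let ?K = "cd_kernel area_poly n 1" and ?L = "L2sq disk_area q"
  have "L2sq \<mu> (q * peak \<zeta> m) \<le>
      (\<integral>z. (1 + \<epsilon>) * w \<zeta> * (cmod (poly q z))\<^sup>2 + Q ^ m * ?K * ?L * w z \<partial>disk_area)"
    unfolding L2sq_weighted
  proof (rule integral_mono_AE[OF integrable_w_sq])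
    show "integrable disk_area (\<lambda>z. (1 + \<epsilon>) * w \<zeta> * (cmod (poly q z))\<^sup>2 + Q ^ m * ?K * ?L * w z)"
      by (intro Bochner_Integration.integrable_add integrable_mult_right integrable_w area.integrable_cmod_sq)
    show "AE z in disk_area. w z * (cmod (poly (q * peak \<zeta> m) z))\<^sup>2 \<le>
       (1 + \<epsilon>) * w \<zeta> * (cmod (poly q z))\<^sup>2 + Q ^ m * ?K * ?L * w z"
    proof (rule AE_I2)
      fix z assume "z \<in> space disk_area"
      then have z: "cmod z \<le> 1" by simp
      have eq: "(cmod (poly (q * peak \<zeta> m) z))\<^sup>2 = (cmod (poly (peak \<zeta> m) z))\<^sup>2 * (cmod (poly q z))\<^sup>2"
        by (simp add: norm_mult power_mult_distrib)
      have wz: "w z > 0" using w_pos[of z] z by simp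
      have nn: "0 \<le> Q ^ m" using Q by simp
      have K0: "?K * ?L \<ge> 0" using area.kernel_pos[of n 1] area.L2sq_nonneg[of q] by simp
      show "w z * (cmod (poly (q * peak \<zeta> m) z))\<^sup>2 \<le>
         (1 + \<epsilon>) * w \<zeta> * (cmod (poly q z))\<^sup>2 + Q ^ m * ?K * ?L * w z"
      proof (cases "cmod (z - \<zeta>) < \<delta>")
        case True
        have "w z * (cmod (poly (q * peak \<zeta> m) z))\<^sup>2 \<le> ((1 + \<epsilon>) * w \<zeta>) * (1 * (cmod (poly q z))\<^sup>2)"
          unfolding eq using rel[OF \<zeta> _ True] z peak_le_1[of \<zeta> z m] \<zeta> w0 \<epsilon>
          by (intro mult_mono) auto
        moreover have "0 \<le> Q ^ m * (?K * ?L) * w z" using nn K0 wz by simp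
        ultimately show ?thesis by (simp add: mult.assoc)
      next
        case False
        have "(cmod (poly q z))\<^sup>2 \<le> cd_kernel area_poly n z * ?L" by (rule area.kernel_extremal[OF deg])
        also have "\<dots> \<le> ?K * ?L" using kernel_area_mono[OF z] area.L2sq_nonneg by (intro mult_right_mono)
        finally have q: "(cmod (poly q z))\<^sup>2 \<le> ?K * ?L" .
        have "(cmod (poly (peak \<zeta> m) z))\<^sup>2 \<le> Q ^ m"
          unfolding Q using \<zeta> z \<delta> False by (intro peak_far) auto
        then have "(cmod (poly (peak \<zeta> m) z))\<^sup>2 * (cmod (poly q z))\<^sup>2 \<le> Q ^ m * (?K * ?L)"
          using q nn by (intro mult_mono) auto
        then have "w z * (cmod (poly (q * peak \<zeta> m) z))\<^sup>2 \<le> w z * (Q ^ m * (?K * ?L))"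
          unfolding eq using wz by (intro mult_left_mono) auto
        moreover have "0 \<le> (1 + \<epsilon>) * w \<zeta> * (cmod (poly q z))\<^sup>2" using w0 \<epsilon> by simp
        moreover have "w z * (Q ^ m * (?K * ?L)) = Q ^ m * ?K * ?L * w z" by (simp only: mult_ac)
        ultimately show ?thesis by linarith
      qed
    qed
  qed
  also have "\<dots> = (1 + \<epsilon>) * w \<zeta> * ?L + Q ^ m * ?K * ?L * total_mass"
    unfolding total_mass_def L2sq_def[of disk_area q]
    by (subst Bochner_Integration.integral_add)
       (auto intro!: integrable_mult_right integrable_w area.integrable_cmod_sq)
  also have "\<dots> = ((1 + \<epsilon>) * w \<zeta> + Q ^ m * ?K * total_mass) * ?L"
    by algebra
  finally show ?thesis .
qed

end

section \<open>Asymptotics of the kernel\<close>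

lemma exp_le_quadratic:
  fixes x :: real
  assumes "x \<le> 1"
  shows "exp x \<le> 1 + x + x\<^sup>2"
proof (cases "x \<ge> 0")
  case True
  then show ?thesis using exp_bound assms by blast
next
  case False
  define u where "u = - x"
  have u: "u \<ge> 0" using False by (simp add: u_def)
  have pos: "1 + u + u\<^sup>2 / 2 > 0" using u by (intro add_pos_nonneg) auto
  have "exp x = 1 / exp u" by (simp add: u_def exp_minus field_simps)
  also have "\<dots> \<le> 1 / (1 + u + u\<^sup>2 / 2)"
    using exp_lower_Taylor_quadratic[OF u] pos by (intro divide_left_mono) auto
  also have "\<dots> \<le> 1 - u + u\<^sup>2"
  proof -
    have "(1 - u + u\<^sup>2) * (1 + u + u\<^sup>2 / 2) = 1 + (u\<^sup>2 / 2 + u ^ 3 / 2 + u ^ 4 / 2)"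
      by (simp add: power2_eq_square power3_eq_cube power4_eq_xxxx field_simps)
    moreover have "0 \<le> u\<^sup>2 / 2 + u ^ 3 / 2 + u ^ 4 / 2" using u by simp
    ultimately show ?thesis using pos by (simp add: pos_divide_le_eq)
  qed
  finally show ?thesis by (simp add: u_def)
qed

text \<open>The diagonal kernel of the area measure as a function of the modulus.\<close>

definition area_diag :: "nat \<Rightarrow> real \<Rightarrow> real" where
  "area_diag n x = (\<Sum>j\<le>n. real (Suc j) * x ^ (2 * j)) / pi"

lemma cd_kernel_area_diag: "cd_kernel area_poly n z = area_diag n (cmod z)"
  by (simp add: kernel_area_eq area_diag_def)

lemma area_diag_pos: "x \<ge> 0 \<Longrightarrow> area_diag n x > 0"
  using area.kernel_pos[of n "of_real x"] by (simp add: cd_kernel_area_diag)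

text \<open>The closed form of \<open>(\<Sum>j\<le>N. (j + 1) (1 + j u + (j u)\<^sup>2)) / \<pi>\<close>, which arises from \<open>area_diag N (exp (u / 2))\<close>
by the quadratic bound for the exponential function.\<close>

definition diag_bound :: "nat \<Rightarrow> real \<Rightarrow> real" where
  "diag_bound N u = ((real N + 1) * (real N + 2) / 2 + u * (real N * (real N + 1) * (real N + 2) / 3) +
     u\<^sup>2 * (real N * (real N + 1) * (real N + 2) * (3 * real N + 1) / 12)) / pi"

lemma area_diag_le:
  assumes "real N * \<bar>u\<bar> \<le> 1"
  shows "area_diag N (exp (u / 2)) \<le> diag_bound N u"
proof -
  have "(\<Sum>j\<le>N. real (Suc j) * exp (u / 2) ^ (2 * j)) \<le> (\<Sum>j\<le>N. real (Suc j) * (1 + real j * u + (real j * u)\<^sup>2))"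
  proof (intro sum_mono mult_left_mono)
    fix j assume "j \<in> {..N}"
    then have "real j * \<bar>u\<bar> \<le> 1" using assms by (meson abs_ge_zero atMost_iff mult_right_mono of_nat_mono order_trans)
    moreover have "real j * u \<le> real j * \<bar>u\<bar>" by (intro mult_left_mono) auto
    ultimately have "real j * u \<le> 1" by linarith
    from exp_le_quadratic[OF this]
    show "exp (u / 2) ^ (2 * j) \<le> 1 + real j * u + (real j * u)\<^sup>2"
      by (simp add: exp_of_nat_mult[symmetric] mult.commute)
  qed simp
  also have "(\<Sum>j\<le>N. real (Suc j) * (1 + real j * u + (real j * u)\<^sup>2)) = diag_bound N u * pi"
  proof (induction N)
    case (Suc N)
    show ?case unfolding sum.atMost_Suc Suc.IH unfolding diag_bound_def
      by (simp add: field_simps power2_eq_square)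
  qed (simp add: diag_bound_def)
  finally show ?thesis by (simp add: area_diag_def divide_le_eq)
qed

lemma area_diag_1: "area_diag N 1 = (real N + 1) * (real N + 2) / (2 * pi)"
proof -
  have "(\<Sum>j\<le>N. real (Suc j)) = (real N + 1) * (real N + 2) / 2"
    by (induction N) (auto simp: field_simps)
  then have "area_diag N 1 = (real N + 1) * (real N + 2) / 2 / pi"
    unfolding area_diag_def by (simp only: power_one mult_1_right)
  then show ?thesis by simp
qed

definition isqrt :: "nat \<Rightarrow> nat" where "isqrt n = nat \<lfloor>sqrt (real n)\<rfloor>"

lemma isqrt_le: "real (isqrt n) \<le> sqrt (real n)" and isqrt_ge: "sqrt (real n) - 1 \<le> real (isqrt n)"
  unfolding isqrt_def by (auto simp: of_nat_nat)

lemma isqrt_le_self: "isqrt n \<le> n"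
proof -
  have "sqrt (real n) \<le> real n"
  proof (cases "n = 0")
    case False
    then have "real n \<le> real n * real n" by (simp add: mult_le_cancel_left1)
    then show ?thesis by (simp add: real_le_lsqrt power2_eq_square)
  qed simp
  then show ?thesis using isqrt_le[of n] by linarith
qed

lemma isqrt_ratio: "(\<lambda>n. real (isqrt n) / real n) \<longlonglongrightarrow> 0"
proof (rule tendsto_sandwich[OF _ _ tendsto_const])
  show "\<forall>\<^sub>F n in sequentially. real (isqrt n) / real n \<le> sqrt (real n) / real n"
    by (intro always_eventually allI divide_right_mono isqrt_le) simp
  show "(\<lambda>n. sqrt (real n) / real n) \<longlonglongrightarrow> 0" by real_asymp
qed auto

text \<open>The exponent \<open>sqrt n\<close> is small compared with \<open>n\<close>, but still makes \<open>Q ^ isqrt n\<close> decay faster than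
every power of \<open>n\<close>.\<close>

lemma power_isqrt_decay:
  assumes "0 \<le> Q" "Q < 1"
  shows "(\<lambda>n. Q ^ isqrt n * (real n + 2)\<^sup>2) \<longlonglongrightarrow> 0"
proof (rule tendsto_sandwich[OF _ _ tendsto_const])
  \<comment> \<open>A positive base is required for the logarithm, and \<open>Q = 0\<close> is allowed.\<close>
  define R where "R = max Q (1 / 2)"
  have R: "0 < R" "R < 1" "Q \<le> R" using assms by (auto simp: R_def)
  define c where "c = - ln R"
  have c: "c > 0" using R by (simp add: c_def)
  show "\<forall>\<^sub>F n in sequentially. Q ^ isqrt n * (real n + 2)\<^sup>2 \<le> exp (- c * (sqrt (real n) - 1)) * (real n + 2)\<^sup>2"
  proof (intro always_eventually allI mult_right_mono)
    fix n
    have "Q ^ isqrt n \<le> R ^ isqrt n" using R assms by (intro power_mono) auto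
    also have "\<dots> = exp (- c * real (isqrt n))"
    proof -
      have "exp (real (isqrt n) * ln R) = R ^ isqrt n"
        by (simp only: exp_of_nat_mult exp_ln[OF R(1)])
      then show ?thesis by (simp add: c_def mult.commute)
    qed
    also have "\<dots> \<le> exp (- c * (sqrt (real n) - 1))"
      using c isqrt_ge[of n] by simp
    finally show "Q ^ isqrt n \<le> exp (- c * (sqrt (real n) - 1))" .
  qed simp
  show "(\<lambda>n. exp (- c * (sqrt (real n) - 1)) * (real n + 2)\<^sup>2) \<longlonglongrightarrow> 0"
    using c by real_asymp
qed (use assms in auto)

text \<open>After division by \<open>n\<^sup>2\<close> the bound is a polynomial in \<open>x = N / n\<close> and \<open>d = 1 / n\<close>, which tend to \<open>1\<close>
and \<open>0\<close>.\<close>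

lemma diag_bound_limit:
  "(\<lambda>n. diag_bound (n + isqrt n) (2 * t / real n) / (real n)\<^sup>2) \<longlonglongrightarrow> (1 / 2 + 2 * t / 3 + t\<^sup>2) / pi"
proof -
  define x where "x n = 1 + real (isqrt n) / real n" for n
  define d where "d n = 1 / real n" for n
  have x: "x \<longlonglongrightarrow> 1" unfolding x_def using tendsto_add[OF tendsto_const isqrt_ratio, of 1] by simp
  have d: "d \<longlonglongrightarrow> 0" unfolding d_def by real_asymp
  have "(\<lambda>n. ((x n + d n) * (x n + 2 * d n) / 2 + 2 * t * (x n * (x n + d n) * (x n + 2 * d n) / 3) +
      (2 * t)\<^sup>2 * (x n * (x n + d n) * (x n + 2 * d n) * (3 * x n + d n) / 12)) / pi)
    \<longlonglongrightarrow> ((1 + 0) * (1 + 2 * 0) / 2 + 2 * t * (1 * (1 + 0) * (1 + 2 * 0) / 3) +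
      (2 * t)\<^sup>2 * (1 * (1 + 0) * (1 + 2 * 0) * (3 * 1 + 0) / 12)) / pi"
    by (intro tendsto_intros x d) simp_all
  also have "((1 + 0) * (1 + 2 * 0) / 2 + 2 * t * (1 * (1 + 0) * (1 + 2 * 0) / 3) +
      (2 * t)\<^sup>2 * (1 * (1 + 0) * (1 + 2 * 0) * (3 * 1 + 0) / 12)) / pi = (1 / 2 + 2 * t / 3 + t\<^sup>2) / pi"
    by (simp add: power2_eq_square)
  finally show ?thesis
  proof (rule Lim_transform_eventually)
    show "\<forall>\<^sub>F n in sequentially. ((x n + d n) * (x n + 2 * d n) / 2 + 2 * t * (x n * (x n + d n) * (x n + 2 * d n) / 3) +
      (2 * t)\<^sup>2 * (x n * (x n + d n) * (x n + 2 * d n) * (3 * x n + d n) / 12)) / pi =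
      diag_bound (n + isqrt n) (2 * t / real n) / (real n)\<^sup>2"
      using eventually_gt_at_top[of 0]
    proof eventually_elim
      case (elim n)
      define N where "N = real (n + isqrt n)"
      define r where "r = real n"
      have r: "r > 0" using elim by (simp add: r_def)
      have xd: "x n = N / r" "d n = 1 / r" using elim by (auto simp: x_def d_def N_def r_def field_simps)
      show ?case unfolding diag_bound_def xd N_def[symmetric] r_def[symmetric]
        using r by (simp add: field_simps power2_eq_square)
    qed
  qed
qed

lemma area_diag_1_limit:
  "(\<lambda>n. area_diag (n - isqrt n) 1 / (real n)\<^sup>2) \<longlonglongrightarrow> 1 / (2 * pi)"
proof -
  define x where "x n = 1 - real (isqrt n) / real n" for n
  define d where "d n = 1 / real n" for n
  have x: "x \<longlonglongrightarrow> 1" unfolding x_def using tendsto_diff[OF tendsto_const isqrt_ratio, of 1] by simp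
  have d: "d \<longlonglongrightarrow> 0" unfolding d_def by real_asymp
  have "(\<lambda>n. (x n + d n) * (x n + 2 * d n) / (2 * pi)) \<longlonglongrightarrow> (1 + 0) * (1 + 2 * 0) / (2 * pi)"
    by (intro tendsto_intros x d) simp_all
  then have "(\<lambda>n. (x n + d n) * (x n + 2 * d n) / (2 * pi)) \<longlonglongrightarrow> 1 / (2 * pi)" by simp
  then show ?thesis
  proof (rule Lim_transform_eventually)
    show "\<forall>\<^sub>F n in sequentially. (x n + d n) * (x n + 2 * d n) / (2 * pi) = area_diag (n - isqrt n) 1 / (real n)\<^sup>2"
      using eventually_gt_at_top[of 0]
    proof eventually_elim
      case (elim n)
      define N where "N = real (n - isqrt n)"
      define r where "r = real n"
      have r: "r > 0" using elim by (simp add: r_def)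
      have xd: "x n = N / r" "d n = 1 / r" using elim isqrt_le_self[of n]
        by (auto simp: x_def d_def N_def r_def field_simps of_nat_diff)
      show ?case unfolding area_diag_1 xd N_def[symmetric] r_def[symmetric]
        using r by (simp add: field_simps power2_eq_square)
    qed
  qed
qed

lemma peak_radial_ge: "exp (s * real m) \<le> (((1 + exp s) / 2) ^ m)\<^sup>2" for s :: real
proof -
  have "exp s \<le> ((1 + exp s) / 2)\<^sup>2"
    using zero_le_power2[of "1 - exp s"] by (simp add: power2_eq_square field_simps)
  then have "exp s ^ m \<le> (((1 + exp s) / 2)\<^sup>2) ^ m" by (intro power_mono) auto
  then show ?thesis by (simp add: exp_of_nat_mult[symmetric] mult.commute flip: power_mult)
qed

context disk_weight begin

text \<open>
The comparison with a peak polynomial as factor. At \<open>exp s * \<zeta>\<close> its squared modulus is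
\<open>((1 + exp s) / 2)^(2 m)\<close>, which is at least \<open>exp (s m)\<close> by the inequality of the arithmetic and
geometric means.\<close>

lemma kernel_upper:
  assumes \<epsilon>: "0 < \<epsilon>" "\<epsilon> < 1" and \<delta>: "0 < \<delta>"
    and rel: "\<And>\<zeta> z. \<zeta> \<in> sphere 0 1 \<Longrightarrow> z \<in> cball 0 1 \<Longrightarrow> cmod (z - \<zeta>) < \<delta> \<Longrightarrow> (1 - \<epsilon>) * w \<zeta> \<le> w z \<and> w z \<le> (1 + \<epsilon>) * w \<zeta>"
    and C: "\<And>q. L2sq disk_area q \<le> C * L2sq \<mu> q"
    and \<zeta>: "\<zeta> \<in> sphere 0 1" and Q: "Q = 1 - \<delta>\<^sup>2 / 4" "Q \<ge> 0"
  shows "cd_kernel p n (of_real (exp s) * \<zeta>) * exp (s * real m) \<le>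
    (1 / ((1 - \<epsilon>) * w \<zeta>) + C * Q ^ m) * area_diag (n + m) (exp s)"
proof -
  let ?z = "of_real (exp s) * \<zeta>"
  have "cd_kernel p n ?z * exp (s * real m) \<le> cd_kernel p n ?z * (cmod (poly (peak \<zeta> m) ?z))\<^sup>2"
    using \<zeta> mu.kernel_pos[of n ?z] peak_radial_ge[of s m] by (intro mult_left_mono) (auto simp: peak_radial)
  also have "\<dots> \<le> (1 / ((1 - \<epsilon>) * w \<zeta>) + C * Q ^ m) * cd_kernel area_poly (n + m) ?z"
    by (rule kernel_comparison[OF mu.bergman_measure_axioms bergman_measure_area degree_peak])
       (rule L2sq_peak_area_le[OF \<epsilon> \<delta> rel C \<zeta> Q])
  finally show ?thesis using \<zeta> by (simp add: cd_kernel_area_diag norm_mult)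
qed

text \<open>The comparison in the other direction, at the peak itself.\<close>

lemma kernel_lower:
  assumes \<epsilon>: "0 < \<epsilon>" and \<delta>: "0 < \<delta>"
    and rel: "\<And>\<zeta> z. \<zeta> \<in> sphere 0 1 \<Longrightarrow> z \<in> cball 0 1 \<Longrightarrow> cmod (z - \<zeta>) < \<delta> \<Longrightarrow> (1 - \<epsilon>) * w \<zeta> \<le> w z \<and> w z \<le> (1 + \<epsilon>) * w \<zeta>"
    and \<zeta>: "\<zeta> \<in> sphere 0 1" and Q: "Q = 1 - \<delta>\<^sup>2 / 4" "Q \<ge> 0"
  shows "area_diag n 1 \<le> ((1 + \<epsilon>) * w \<zeta> + Q ^ m * area_diag n 1 * total_mass) * cd_kernel p (n + m) \<zeta>"
proof -
  have pk: "cmod (poly (peak \<zeta> m) \<zeta>) = 1" using peak_radial[of \<zeta> m 0] \<zeta> by simp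
  have "cd_kernel area_poly n \<zeta> * (cmod (poly (peak \<zeta> m) \<zeta>))\<^sup>2 \<le>
     ((1 + \<epsilon>) * w \<zeta> + Q ^ m * cd_kernel area_poly n 1 * total_mass) * cd_kernel p (n + m) \<zeta>"
    by (rule kernel_comparison[OF bergman_measure_area mu.bergman_measure_axioms degree_peak])
       (rule L2sq_peak_weighted_le[OF \<epsilon> \<delta> rel \<zeta> Q])
  then show ?thesis using \<zeta> pk by (simp add: cd_kernel_area_diag)
qed

text \<open>
Divide \<open>kernel_upper\<close> at \<open>exp (t / n) * \<zeta>\<close> by \<open>kernel_lower\<close> at \<open>\<zeta>\<close>: the values \<open>w \<zeta>\<close> cancel, and what
remains no longer depends on \<open>\<zeta>\<close>.\<close>

lemma kernel_ratio:
  assumes t: "\<bar>t\<bar> \<le> 1 / 8" and \<eta>: "\<eta> > 0"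
  shows "\<forall>\<^sub>F n in sequentially. \<forall>\<zeta>\<in>sphere 0 1.
     cd_kernel p n (of_real (exp (t / real n)) * \<zeta>) \<le> (1 + 4 * t / 3 + 2 * t\<^sup>2 + \<eta>) * cd_kernel p n \<zeta>"
proof -
  define g where "g = 1 + 4 * t / 3 + 2 * t\<^sup>2"
  have g: "g > 0"
  proof -
    have "0 \<le> 2 * t\<^sup>2" by simp
    moreover have "4 * t / 3 \<ge> - (1 / 6)" using t by (simp add: abs_le_iff)
    ultimately show ?thesis unfolding g_def by linarith
  qed
  \<comment> \<open>This choice gives \<open>(1 + \<epsilon>) / (1 - \<epsilon>) \<le> 1 + 4 \<epsilon>\<close> and \<open>4 \<epsilon> g < \<eta>\<close>.\<close>
  define \<epsilon> where "\<epsilon> = min (1 / 2) (\<eta> / (8 * g))"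
  have \<epsilon>: "0 < \<epsilon>" "\<epsilon> < 1" "\<epsilon> \<le> 1 / 2" "\<epsilon> \<le> \<eta> / (8 * g)" using g \<eta> by (auto simp: \<epsilon>_def)
  have \<epsilon>_g: "(1 + \<epsilon>) / (1 - \<epsilon>) * g < g + \<eta>"
  proof -
    have "(1 + \<epsilon>) / (1 - \<epsilon>) \<le> 1 + 4 * \<epsilon>"
    proof -
      have "\<epsilon> * \<epsilon> \<le> \<epsilon> * (1 / 2)" using \<epsilon> by (intro mult_left_mono) auto
      then show ?thesis using \<epsilon> by (simp add: pos_divide_le_eq algebra_simps)
    qed
    then have "(1 + \<epsilon>) / (1 - \<epsilon>) * g \<le> (1 + 4 * \<epsilon>) * g" using g by (intro mult_right_mono) auto
    also have "\<dots> = g + 4 * (\<epsilon> * g)" by (simp add: algebra_simps)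
    also have "\<epsilon> * g \<le> \<eta> / 8" using \<epsilon>(4) g by (simp add: pos_le_divide_eq)
    finally show ?thesis using \<eta> by linarith
  qed
  obtain a b where a: "a > 0" and ab: "\<And>\<zeta>. \<zeta> \<in> sphere 0 1 \<Longrightarrow> a \<le> w \<zeta> \<and> w \<zeta> \<le> b"
    using w_bounds by blast
  obtain C where C0: "C \<ge> 0" and C: "\<And>q. L2sq disk_area q \<le> C * L2sq \<mu> q"
    using L2sq_area_le_weighted by blast
  obtain \<delta> where \<delta>: "0 < \<delta>" "\<delta> < 1"
    and rel: "\<And>\<zeta> z. \<zeta> \<in> sphere 0 1 \<Longrightarrow> z \<in> cball 0 1 \<Longrightarrow> cmod (z - \<zeta>) < \<delta> \<Longrightarrow> (1 - \<epsilon>) * w \<zeta> \<le> w z \<and> w z \<le> (1 + \<epsilon>) * w \<zeta>"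
    by (rule w_relative[OF \<epsilon>(1)]) blast
  define Q where "Q = 1 - \<delta>\<^sup>2 / 4"
  have Q: "0 \<le> Q" "Q < 1" using \<delta> power_less_one_iff[of \<delta> 2] by (auto simp: Q_def)
  define T where "T = total_mass"
  have T0: "T \<ge> 0" unfolding T_def by (rule total_mass_nonneg)
  \<comment> \<open>\<open>\<alpha> n\<close> and \<open>\<beta> n\<close> bound the constants of the two estimates, normalised by \<open>w \<zeta>\<close>, uniformly in \<open>\<zeta>\<close>.\<close>
  define \<alpha> where "\<alpha> n = 1 / (1 - \<epsilon>) + C * b * Q ^ isqrt n" for n
  define \<beta> where "\<beta> n = (1 + \<epsilon>) + Q ^ isqrt n * area_diag (n - isqrt n) 1 * T / a" for n
  define B where "B n = \<alpha> n * \<beta> n * (diag_bound (n + isqrt n) (2 * t / real n) / (real n)\<^sup>2) /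
      (area_diag (n - isqrt n) 1 / (real n)\<^sup>2) * exp (- (t * (real (isqrt n) / real n)))" for n
  have Qlim: "(\<lambda>n. Q ^ isqrt n * (real n + 2)\<^sup>2) \<longlonglongrightarrow> 0"
    by (rule power_isqrt_decay[OF Q])
  have Q1: "(\<lambda>n. Q ^ isqrt n) \<longlonglongrightarrow> 0"
  proof (rule tendsto_sandwich[OF _ _ tendsto_const Qlim])
    have "1 \<le> (real n + 2)\<^sup>2" for n by (simp add: one_le_power)
    then show "\<forall>\<^sub>F n in sequentially. Q ^ isqrt n \<le> Q ^ isqrt n * (real n + 2)\<^sup>2"
      using Q by (intro always_eventually allI) (simp add: mult_le_cancel_left1)
  qed (use Q in auto)
  have Q2: "(\<lambda>n. Q ^ isqrt n * area_diag (n - isqrt n) 1) \<longlonglongrightarrow> 0"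
  proof (rule tendsto_sandwich[OF _ _ tendsto_const Qlim])
    have "area_diag (n - isqrt n) 1 \<le> (real n + 2)\<^sup>2" for n
    proof -
      define N where "N = real (n - isqrt n)"
      have N: "0 \<le> N" "N \<le> real n" by (auto simp: N_def)
      have "(N + 1) * (N + 2) \<le> (real n + 2) * (real n + 2)" using N by (intro mult_mono) auto
      moreover have "(N + 1) * (N + 2) / (2 * pi) \<le> (N + 1) * (N + 2) / 1"
        using N pi_ge_two by (intro divide_left_mono mult_nonneg_nonneg) auto
      ultimately show ?thesis unfolding area_diag_1 N_def[symmetric] by (simp add: power2_eq_square)
    qed
    then show "\<forall>\<^sub>F n in sequentially. Q ^ isqrt n * area_diag (n - isqrt n) 1 \<le> Q ^ isqrt n * (real n + 2)\<^sup>2"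
      using Q by (intro always_eventually allI mult_left_mono) auto
    show "\<forall>\<^sub>F n in sequentially. 0 \<le> Q ^ isqrt n * area_diag (n - isqrt n) 1"
      using Q area_diag_pos[of 1] by (intro always_eventually allI mult_nonneg_nonneg) (auto intro: less_imp_le)
  qed
  have "B \<longlonglongrightarrow> (1 / (1 - \<epsilon>) + C * b * 0) * ((1 + \<epsilon>) + 0 * T / a) * ((1 / 2 + 2 * t / 3 + t\<^sup>2) / pi) /
      (1 / (2 * pi)) * exp (- (t * 0))"
    unfolding B_def \<alpha>_def \<beta>_def
    by (intro tendsto_intros Q1 Q2 diag_bound_limit area_diag_1_limit isqrt_ratio) (use a in auto)
  also have "(1 / (1 - \<epsilon>) + C * b * 0) * ((1 + \<epsilon>) + 0 * T / a) * ((1 / 2 + 2 * t / 3 + t\<^sup>2) / pi) /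
      (1 / (2 * pi)) * exp (- (t * 0)) = (1 + \<epsilon>) / (1 - \<epsilon>) * g"
  proof -
    have "(1 / 2 + 2 * t / 3 + t\<^sup>2) / pi / (1 / (2 * pi)) = g" by (simp add: g_def)
    then have "x * ((1 / 2 + 2 * t / 3 + t\<^sup>2) / pi) / (1 / (2 * pi)) = x * g" for x
      by (simp only: times_divide_eq_right[symmetric])
    then show ?thesis by simp
  qed
  finally have "\<forall>\<^sub>F n in sequentially. B n < g + \<eta>"
    using \<epsilon>_g by (rule order_tendstoD(2))
  then show ?thesis using eventually_gt_at_top[of 0]
  proof eventually_elim
    case (elim n)
    show ?case
    proof
      fix \<zeta> :: complex assume \<zeta>: "\<zeta> \<in> sphere 0 1"
      define m where "m = isqrt n"
      define s where "s = t / real n"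
      define K1 where "K1 = cd_kernel p n (of_real (exp s) * \<zeta>)"
      define K0 where "K0 = cd_kernel p n \<zeta>"
      define A0 where "A0 = area_diag (n - m) 1"
      define D where "D = diag_bound (n + m) (2 * t / real n)"
      have mn: "m \<le> n" unfolding m_def by (rule isqrt_le_self)
      have A0: "A0 > 0" unfolding A0_def by (rule area_diag_pos) simp
      have K0: "K0 > 0" and K1: "K1 > 0" unfolding K0_def K1_def by (rule mu.kernel_pos)+
      have wz: "w \<zeta> > 0" "a \<le> w \<zeta>" "w \<zeta> \<le> b" using ab[OF \<zeta>] a by auto
      have Qm: "0 \<le> Q ^ m" using Q by simp
      have "area_diag (n + m) (exp ((2 * t / real n) / 2)) \<le> D"
        unfolding D_def
      proof (rule area_diag_le)
        have "real (n + m) * \<bar>2 * t / real n\<bar> \<le> (2 * real n) * \<bar>2 * t / real n\<bar>"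
          using mn by (intro mult_right_mono) auto
        also have "\<dots> = 4 * \<bar>t\<bar>" using elim by (simp add: abs_mult abs_divide)
        finally show "real (n + m) * \<bar>2 * t / real n\<bar> \<le> 1" using t by linarith
      qed
      then have AD: "area_diag (n + m) (exp s) \<le> D" by (simp add: s_def)
      have D0: "D > 0" using AD area_diag_pos[of "exp s" "n + m"] by simp
      have up: "K1 * exp (s * real m) \<le> (1 / ((1 - \<epsilon>) * w \<zeta>) + C * Q ^ m) * D"
      proof -
        have "K1 * exp (s * real m) \<le> (1 / ((1 - \<epsilon>) * w \<zeta>) + C * Q ^ m) * area_diag (n + m) (exp s)"
          unfolding K1_def by (rule kernel_upper[OF \<epsilon>(1,2) \<delta>(1) rel C \<zeta> Q_def Q(1)])
        also have "\<dots> \<le> (1 / ((1 - \<epsilon>) * w \<zeta>) + C * Q ^ m) * D"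
          using AD \<epsilon> wz C0 Qm by (intro mult_left_mono) auto
        finally show ?thesis .
      qed
      have lo: "A0 \<le> ((1 + \<epsilon>) * w \<zeta> + Q ^ m * A0 * T) * K0"
        using kernel_lower[OF \<epsilon>(1) \<delta>(1) rel \<zeta> Q_def Q(1), of "n - m" m] mn
        by (simp add: A0_def T_def K0_def)
      have c1: "(1 / ((1 - \<epsilon>) * w \<zeta>) + C * Q ^ m) * w \<zeta> \<le> \<alpha> n"
      proof -
        have "(1 / ((1 - \<epsilon>) * w \<zeta>) + C * Q ^ m) * w \<zeta> = 1 / (1 - \<epsilon>) + C * w \<zeta> * Q ^ m"
          using wz \<epsilon> by (simp add: field_simps)
        also have "\<dots> \<le> \<alpha> n" unfolding \<alpha>_def m_def[symmetric]
          using wz C0 Qm by (intro add_left_mono mult_right_mono mult_left_mono) auto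
        finally show ?thesis .
      qed
      have c2: "((1 + \<epsilon>) * w \<zeta> + Q ^ m * A0 * T) / w \<zeta> \<le> \<beta> n"
      proof -
        have "((1 + \<epsilon>) * w \<zeta> + Q ^ m * A0 * T) / w \<zeta> = (1 + \<epsilon>) + Q ^ m * A0 * T / w \<zeta>"
          using wz by (simp add: field_simps)
        also have "\<dots> \<le> \<beta> n" unfolding \<beta>_def m_def[symmetric] A0_def[symmetric]
          using wz a Qm A0 T0 by (intro add_left_mono divide_left_mono mult_nonneg_nonneg) auto
        finally show ?thesis .
      qed
      have \<alpha>0: "0 \<le> (1 / ((1 - \<epsilon>) * w \<zeta>) + C * Q ^ m) * w \<zeta>" using \<epsilon> wz C0 Qm by simp
      have \<beta>0: "0 \<le> ((1 + \<epsilon>) * w \<zeta> + Q ^ m * A0 * T) / w \<zeta>" using \<epsilon> wz A0 T0 Qm by simp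
      have "(K1 * exp (s * real m)) * A0 \<le>
          ((1 / ((1 - \<epsilon>) * w \<zeta>) + C * Q ^ m) * D) * (((1 + \<epsilon>) * w \<zeta> + Q ^ m * A0 * T) * K0)"
        using A0 \<epsilon> wz C0 Qm D0 by (intro mult_mono[OF up lo]) auto
      also have "\<dots> = ((1 / ((1 - \<epsilon>) * w \<zeta>) + C * Q ^ m) * w \<zeta>) * (((1 + \<epsilon>) * w \<zeta> + Q ^ m * A0 * T) / w \<zeta>) * (D * K0)"
        using wz by simp
      also have "\<dots> \<le> \<alpha> n * \<beta> n * (D * K0)"
        using c1 c2 \<alpha>0 \<beta>0 D0 K0 by (intro mult_right_mono mult_mono) auto
      finally have main: "K1 * exp (s * real m) * A0 \<le> \<alpha> n * \<beta> n * (D * K0)" .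
      have "K1 = K1 * exp (s * real m) * A0 * exp (- (s * real m)) / A0"
        using A0 by (simp add: exp_minus)
      also have "\<dots> \<le> \<alpha> n * \<beta> n * (D * K0) * exp (- (s * real m)) / A0"
        using main A0 by (intro divide_right_mono mult_right_mono) auto
      also have "\<dots> = B n * K0"
        using elim A0 by (simp add: B_def m_def[symmetric] A0_def[symmetric] D_def[symmetric] s_def)
      also have "\<dots> \<le> (g + \<eta>) * K0" using elim K0 by (intro mult_right_mono) auto
      finally show "cd_kernel p n (of_real (exp (t / real n)) * \<zeta>) \<le> (1 + 4 * t / 3 + 2 * t\<^sup>2 + \<eta>) * cd_kernel p n \<zeta>"
        by (simp add: K1_def K0_def g_def s_def)
    qed
  qed
qed

text \<open>
The extremal property for the monomial \<open>z^n\<close>: its modulus on the circle in question is \<open>exp t\<close>, while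
its norm tends to \<open>0\<close> by dominated convergence, because \<open>\<mu>\<close> lives on the open disk.\<close>

lemma kernel_unbounded:
  "\<forall>\<^sub>F n in sequentially. \<forall>\<zeta>\<in>sphere 0 1. B \<le> cd_kernel p n (of_real (exp (t / real n)) * \<zeta>)"
proof -
  have lim: "(\<lambda>n. \<integral>z. (cmod (poly (monom 1 n) z))\<^sup>2 \<partial>\<mu>) \<longlonglongrightarrow> (\<integral>z. 0 \<partial>\<mu>)"
  proof (rule integral_dominated_convergence[where w="\<lambda>_. 1"])
    show "(\<lambda>z. (cmod (poly (monom 1 n) z))\<^sup>2) \<in> borel_measurable \<mu>" for n
      by (rule mu.measurable_mu) measurable
    show "AE z in \<mu>. (\<lambda>n. (cmod (poly (monom 1 n) z))\<^sup>2) \<longlonglongrightarrow> 0"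
    proof (rule AE_I2)
      fix z assume "z \<in> space \<mu>"
      then have "cmod z < 1" by (simp add: mu.space_eq)
      then have "(\<lambda>n. (cmod z ^ n)\<^sup>2) \<longlonglongrightarrow> 0\<^sup>2" by (intro tendsto_intros LIMSEQ_power_zero) simp
      then show "(\<lambda>n. (cmod (poly (monom 1 n) z))\<^sup>2) \<longlonglongrightarrow> 0"
        by (simp add: poly_monom norm_power)
    qed
    show "AE z in \<mu>. norm ((cmod (poly (monom 1 n) z))\<^sup>2) \<le> 1" for n
    proof (rule AE_I2)
      fix z assume "z \<in> space \<mu>"
      then have "cmod z ^ n \<le> 1" by (intro power_le_one) (auto simp: mu.space_eq)
      then have "(cmod z ^ n)\<^sup>2 \<le> 1" by (rule power_le_one[OF zero_le_power[OF norm_ge_zero]])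
      then show "norm ((cmod (poly (monom 1 n) z))\<^sup>2) \<le> 1" by (simp add: poly_monom norm_power)
    qed
  qed auto
  define c where "c = exp (2 * t) / (max B 1)"
  have "c > 0" by (simp add: c_def)
  have "\<forall>\<^sub>F n in sequentially. L2sq \<mu> (monom 1 n) < c"
    using lim order_tendstoD(2)[OF _ \<open>c > 0\<close>] by (simp add: L2sq_def)
  then show ?thesis using eventually_gt_at_top[of 0]
  proof eventually_elim
    case (elim n)
    show ?case
    proof
      fix \<zeta> :: complex assume \<zeta>: "\<zeta> \<in> sphere 0 1"
      let ?z = "of_real (exp (t / real n)) * \<zeta>"
      have "(cmod (poly (monom 1 n) ?z))\<^sup>2 = exp (2 * t)"
        using \<zeta> elim by (simp add: poly_monom norm_mult norm_power exp_of_nat_mult[symmetric] exp_double[symmetric] flip: power_mult)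
      moreover have "(cmod (poly (monom 1 n) ?z))\<^sup>2 \<le> cd_kernel p n ?z * L2sq \<mu> (monom 1 n)"
        by (intro mu.kernel_extremal) (simp add: degree_monom_le)
      moreover have "cd_kernel p n ?z * L2sq \<mu> (monom 1 n) \<le> cd_kernel p n ?z * c"
        using elim mu.kernel_pos[of n ?z] by (intro mult_left_mono) auto
      ultimately have "exp (2 * t) \<le> cd_kernel p n ?z * c" by linarith
      then have "max B 1 * c \<le> cd_kernel p n ?z * c" by (simp add: c_def)
      then have "max B 1 \<le> cd_kernel p n ?z" using \<open>c > 0\<close> by simp
      then show "B \<le> cd_kernel p n ?z" by simp
    qed
  qed
qed

end

section \<open>The expected number of roots\<close>

lemma poly_random_poly:
  "poly (random_poly p \<eta> n \<omega>) z = (\<Sum>j\<le>n. poly (p j) z * \<eta> j \<omega>)"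
  by (simp add: random_poly_def poly_sum mult.commute)

lemma circle_pt_eq: "circle_pt s \<tau> = of_real (exp s) * circle_pt 0 \<tau>"
  by (simp add: circle_pt_def)

lemma root_count_disk_le:
  assumes "degree q \<le> n"
  shows "root_count_disk q v \<le> n"
proof (cases "q - [:v:] = 0")
  case True
  then show ?thesis by (simp add: root_count_disk_def)
next
  case False
  have "root_count_disk q v \<le> size (proots (q - [:v:]))"
    unfolding root_count_disk_def by (rule size_filter_mset_lesseq)
  also have "\<dots> \<le> degree (q - [:v:])" by (rule size_proots_le)
  also have "\<dots> \<le> n" using assms by (intro degree_diff_le) auto
  finally show ?thesis .
qed

locale gaussian_bergman = disk_weight \<mu> w p + prob_space M
  for \<mu> :: "complex measure" and w :: "complex \<Rightarrow> real" and p :: "nat \<Rightarrow> complex poly"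
    and M :: "'a measure" +
  fixes \<eta> :: "nat \<Rightarrow> 'a \<Rightarrow> complex" and v :: complex
  assumes \<eta>_indep: "indep_vars (\<lambda>_. borel) \<eta> UNIV"
    and \<eta>_normal: "\<And>j. distributed M lborel (\<eta> j) (\<lambda>z. ennreal (std_complex_normal_density z))"
begin

definition shifted :: "nat \<Rightarrow> 'a \<Rightarrow> complex poly" where
  "shifted n \<omega> = random_poly p \<eta> n \<omega> - [:v:]"

lemma poly_shifted: "poly (shifted n \<omega>) z = (\<Sum>j\<le>n. poly (p j) z * \<eta> j \<omega>) - v"
  by (simp add: shifted_def poly_random_poly)

lemma eta_measurable [measurable]: "\<eta> j \<in> borel_measurable M"
  using distributed_measurable[OF \<eta>_normal] by simp

lemma distributed_random_poly:
  "distributed M lborel (\<lambda>\<omega>. \<Sum>j\<le>n. poly (p j) z * \<eta> j \<omega>) (\<lambda>u. ennreal (cnormal_density (cd_kernel p n z) u))"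
  unfolding cd_kernel_def
proof (rule distributed_lincomb_cnormal[OF \<eta>_indep])
  show "distributed M lborel (\<eta> j) (\<lambda>z. ennreal (cnormal_density 1 z))" for j
    using \<eta>_normal by (simp add: cnormal_density_1)
  obtain b where b: "p 0 = [:b:]" using mu.degree_p[of 0] by (metis degree_eq_zeroE)
  then show "poly (p 0) z \<noteq> 0" using mu.p_nonzero[of 0] by auto
qed

lemma log_field_measurable:
  "(\<lambda>(\<tau>, \<omega>). ln (cmod (poly (shifted n \<omega>) (circle_pt s \<tau>)))) \<in> borel_measurable (unit_interval \<Otimes>\<^sub>M M)"
proof -
  have [measurable]: "(\<lambda>\<tau>. poly (p j) (circle_pt s \<tau>)) \<in> borel_measurable unit_interval" for j
    by (rule measurable_unit_interval) measurable
  show ?thesis unfolding poly_shifted by measurable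
qed

lemma log_mean_measurable: "(\<lambda>\<omega>. log_mean (shifted n \<omega>) s) \<in> borel_measurable M"
proof -
  interpret U: prob_space unit_interval by (rule prob_space_unit_interval)
  have "(\<lambda>(\<omega>, \<tau>). ln (cmod (poly (shifted n \<omega>) (circle_pt s \<tau>)))) \<in> borel_measurable (M \<Otimes>\<^sub>M unit_interval)"
    using measurable_comp[OF measurable_pair_swap' log_field_measurable[of n s]]
    by (simp add: o_def case_prod_beta)
  from U.borel_measurable_lebesgue_integral[OF this] show ?thesis
    by (simp add: log_mean_def)
qed

lemma root_count_measurable:
  "(\<lambda>\<omega>. real (root_count_disk (random_poly p \<eta> n \<omega>) v)) \<in> borel_measurable M"
proof (rule borel_measurable_LIMSEQ_real)
  show "(\<lambda>k. (log_mean (shifted n \<omega>) 0 - log_mean (shifted n \<omega>) (- (1 / real (Suc k)))) * real (Suc k))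
     \<longlonglongrightarrow> real (root_count_disk (random_poly p \<eta> n \<omega>) v)" for \<omega>
    unfolding shifted_def by (rule root_count_derivative)
  show "(\<lambda>\<omega>. (log_mean (shifted n \<omega>) 0 - log_mean (shifted n \<omega>) (- (1 / real (Suc k)))) * real (Suc k))
     \<in> borel_measurable M" for k
    by (intro borel_measurable_times borel_measurable_diff log_mean_measurable borel_measurable_const)
qed

lemma degree_random_poly: "degree (random_poly p \<eta> n \<omega>) \<le> n"
  unfolding random_poly_def
  by (intro degree_sum_le) (auto intro: order_trans[OF degree_smult_le] simp: mu.degree_p)

lemma root_count_integrable: "integrable M (\<lambda>\<omega>. real (root_count_disk (random_poly p \<eta> n \<omega>) v))"
  by (rule integrable_const_bound[where B="real n"])
     (auto intro!: root_count_measurable AE_I2 root_count_disk_le degree_random_poly)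

lemma expectation_log:
  assumes "cmod v \<le> sqrt (cd_kernel p n z)"
  shows "integrable M (\<lambda>\<omega>. ln (cmod (poly (shifted n \<omega>) z)))"
    and "expectation (\<lambda>\<omega>. ln (cmod (poly (shifted n \<omega>) z))) =
      ln (cd_kernel p n z) / 2 + log_potential (v / of_real (sqrt (cd_kernel p n z)))"
    and "expectation (\<lambda>\<omega>. \<bar>ln (cmod (poly (shifted n \<omega>) z))\<bar>) \<le>
      \<bar>ln (cd_kernel p n z)\<bar> / 2 + integral\<^sup>L lborel log_dominant"
proof -
  let ?k = "cd_kernel p n z"
  let ?X = "\<lambda>\<omega>. \<Sum>j\<le>n. poly (p j) z * \<eta> j \<omega>"
  have k: "?k > 0" by (rule mu.kernel_pos)
  note D = distributed_random_poly[where n=n and z=z]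
  note H = has_bochner_integral_ln_cnormal[OF k assms]
  note nn = cnormal_density_nonneg[OF k]
  have m: "(\<lambda>u. ln (cmod (u - v))) \<in> borel_measurable lborel" by measurable
  have m': "(\<lambda>u. \<bar>ln (cmod (u - v))\<bar>) \<in> borel_measurable lborel" by measurable
  show "integrable M (\<lambda>\<omega>. ln (cmod (poly (shifted n \<omega>) z)))"
    unfolding poly_shifted using distributed_integrable[OF D m nn] H(1)
    by (simp add: has_bochner_integral_iff mult.commute)
  show "expectation (\<lambda>\<omega>. ln (cmod (poly (shifted n \<omega>) z))) =
      ln ?k / 2 + log_potential (v / of_real (sqrt ?k))"
    unfolding poly_shifted using distributed_integral[OF D m nn] H(1)
    by (simp add: has_bochner_integral_iff mult.commute)
  show "expectation (\<lambda>\<omega>. \<bar>ln (cmod (poly (shifted n \<omega>) z))\<bar>) \<le> \<bar>ln ?k\<bar> / 2 + integral\<^sup>L lborel log_dominant"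
    unfolding poly_shifted using distributed_integral[OF D m' nn] H(2)
    by (simp add: mult.commute)
qed

lemma kernel_circle_bounded:
  obtains B where "\<And>\<tau>. \<tau> \<in> {0..1} \<Longrightarrow> \<bar>ln (cd_kernel p n (circle_pt s \<tau>))\<bar> \<le> B"
proof -
  have "cd_kernel p n z \<noteq> 0" for z using mu.kernel_pos[of n z] by simp
  moreover have "continuous_on {0..1} (\<lambda>\<tau>. cd_kernel p n (circle_pt s \<tau>))"
    unfolding cd_kernel_def by (intro continuous_intros)
  ultimately have "continuous_on {0..1} (\<lambda>\<tau>. ln (cd_kernel p n (circle_pt s \<tau>)))"
    by (intro continuous_on_ln) auto
  then have "bounded ((\<lambda>\<tau>. ln (cd_kernel p n (circle_pt s \<tau>))) ` {0..1})"
    by (intro compact_imp_bounded compact_continuous_image) auto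
  then obtain B where "\<forall>x\<in>(\<lambda>\<tau>. ln (cd_kernel p n (circle_pt s \<tau>))) ` {0..1}. norm x \<le> B"
    unfolding bounded_iff by blast
  then show ?thesis by (intro that[of B]) auto
qed

text \<open>The mean of \<open>ln \<bar>\<Phi>(z) - v\<bar>\<close> at a point \<open>z\<close> of the circle, where \<open>\<Phi>\<close> is the random polynomial.\<close>

definition mean_log_field :: "nat \<Rightarrow> real \<Rightarrow> real \<Rightarrow> real" where
  "mean_log_field n s \<tau> = ln (cd_kernel p n (circle_pt s \<tau>)) / 2 +
     log_potential (v / of_real (sqrt (cd_kernel p n (circle_pt s \<tau>))))"

text \<open>
Fubini's theorem: the absolute moments of \<open>ln \<bar>\<Phi> - v\<bar>\<close> are bounded along the circle, since \<open>ln K\<close> is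
continuous there. The hypothesis places \<open>v / sqrt K\<close> in the unit disk, where the logarithmic
moments were estimated.\<close>

lemma expectation_log_mean:
  assumes v: "\<And>\<tau>. \<tau> \<in> {0..1} \<Longrightarrow> cmod v \<le> sqrt (cd_kernel p n (circle_pt s \<tau>))"
  shows "integrable M (\<lambda>\<omega>. log_mean (shifted n \<omega>) s)"
    and "integrable unit_interval (mean_log_field n s)"
    and "expectation (\<lambda>\<omega>. log_mean (shifted n \<omega>) s) = integral\<^sup>L unit_interval (mean_log_field n s)"
proof -
  interpret U: prob_space unit_interval by (rule prob_space_unit_interval)
  interpret P: pair_sigma_finite unit_interval M ..
  let ?F = "\<lambda>\<tau> \<omega>. ln (cmod (poly (shifted n \<omega>) (circle_pt s \<tau>)))"
  have sp: "space unit_interval = {0..1}" by (simp add: unit_interval_def space_restrict_space)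
  obtain B where B: "\<And>\<tau>. \<tau> \<in> {0..1} \<Longrightarrow> \<bar>ln (cd_kernel p n (circle_pt s \<tau>))\<bar> \<le> B"
    using kernel_circle_bounded by blast
  have m: "(\<lambda>(\<tau>, \<omega>). ?F \<tau> \<omega>) \<in> borel_measurable (unit_interval \<Otimes>\<^sub>M M)"
    by (rule log_field_measurable)
  have mn: "(\<lambda>(\<tau>, \<omega>). norm (?F \<tau> \<omega>)) \<in> borel_measurable (unit_interval \<Otimes>\<^sub>M M)"
    using measurable_compose[OF m borel_measurable_norm] by (simp add: case_prod_beta)
  have int: "integrable (unit_interval \<Otimes>\<^sub>M M) (\<lambda>(\<tau>, \<omega>). ?F \<tau> \<omega>)"
  proof (rule P.Fubini_integrable[OF m])
    show "AE \<tau> in unit_interval. integrable M (\<lambda>\<omega>. case (\<tau>, \<omega>) of (\<tau>, \<omega>) \<Rightarrow> ?F \<tau> \<omega>)"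
      using expectation_log(1)[OF v] by (intro AE_I2) (simp add: sp)
    show "integrable unit_interval (\<lambda>\<tau>. expectation (\<lambda>\<omega>. norm (case (\<tau>, \<omega>) of (\<tau>, \<omega>) \<Rightarrow> ?F \<tau> \<omega>)))"
    proof (rule U.integrable_const_bound)
      show "AE \<tau> in unit_interval. norm (expectation (\<lambda>\<omega>. norm (case (\<tau>, \<omega>) of (\<tau>, \<omega>) \<Rightarrow> ?F \<tau> \<omega>)))
          \<le> B / 2 + integral\<^sup>L lborel log_dominant"
      proof (rule AE_I2)
        fix \<tau> assume "\<tau> \<in> space unit_interval"
        then have \<tau>: "\<tau> \<in> {0..1}" by (simp add: sp)
        have "0 \<le> expectation (\<lambda>\<omega>. \<bar>?F \<tau> \<omega>\<bar>)" by simp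
        moreover have "expectation (\<lambda>\<omega>. \<bar>?F \<tau> \<omega>\<bar>) \<le> \<bar>ln (cd_kernel p n (circle_pt s \<tau>))\<bar> / 2 + integral\<^sup>L lborel log_dominant"
          by (rule expectation_log(3)[OF v[OF \<tau>]])
        ultimately show "norm (expectation (\<lambda>\<omega>. norm (case (\<tau>, \<omega>) of (\<tau>, \<omega>) \<Rightarrow> ?F \<tau> \<omega>))) \<le> B / 2 + integral\<^sup>L lborel log_dominant"
          using B[OF \<tau>] by simp
      qed
      show "(\<lambda>\<tau>. expectation (\<lambda>\<omega>. norm (case (\<tau>, \<omega>) of (\<tau>, \<omega>) \<Rightarrow> ?F \<tau> \<omega>))) \<in> borel_measurable unit_interval"
        using borel_measurable_lebesgue_integral[OF mn] by simp
    qed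
  qed
  have E: "expectation (?F \<tau>) = mean_log_field n s \<tau>" if "\<tau> \<in> space unit_interval" for \<tau>
    using expectation_log(2)[OF v] that by (simp add: sp mean_log_field_def)
  show "integrable unit_interval (mean_log_field n s)"
    using P.integrable_fst'[OF int] E
    by (subst Bochner_Integration.integrable_cong[OF refl, of _ _ "\<lambda>\<tau>. expectation (?F \<tau>)"]) auto
  show "integrable M (\<lambda>\<omega>. log_mean (shifted n \<omega>) s)"
    using P.integrable_snd[of "?F", OF int] by (simp add: log_mean_def)
  have "expectation (\<lambda>\<omega>. log_mean (shifted n \<omega>) s) = (\<integral>\<tau>. expectation (?F \<tau>) \<partial>unit_interval)"
    unfolding log_mean_def by (rule P.Fubini_integral[OF int])
  also have "\<dots> = integral\<^sup>L unit_interval (mean_log_field n s)"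
    using E by (intro Bochner_Integration.integral_cong) auto
  finally show "expectation (\<lambda>\<omega>. log_mean (shifted n \<omega>) s) = integral\<^sup>L unit_interval (mean_log_field n s)" .
qed

text \<open>
The subgradient inequality at \<open>s = t / n\<close>, averaged over the randomness, bounds the left side by a
circle mean of \<open>ln K(exp (t/n) \<zeta>) / 2 - ln K(\<zeta>) / 2\<close> up to the contribution of \<open>v\<close>.\<close>

lemma mean_root_count_bound:
  assumes t: "\<bar>t\<bar> \<le> 1 / 8" and \<kappa>: "\<kappa> > 0"
  shows "\<forall>\<^sub>F n in sequentially.
     t * expectation (\<lambda>\<omega>. 1 / real n * real (root_count_disk (random_poly p \<eta> n \<omega>) v)) \<le> 2 * t / 3 + t\<^sup>2 + \<kappa>"
proof -
  interpret U: prob_space unit_interval by (rule prob_space_unit_interval)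
  have "\<kappa> / 4 > 0" using \<kappa> by simp
  then have "\<forall>\<^sub>F b in nhds 0. dist (log_potential b) (log_potential 0) < \<kappa> / 4"
    using log_potential_tendsto by (rule tendstoD[rotated])
  then obtain d where d: "d > 0" "\<And>b. cmod b < d \<Longrightarrow> \<bar>log_potential b - log_potential 0\<bar> < \<kappa> / 4"
    by (auto simp: eventually_nhds_metric dist_real_def)
  \<comment> \<open>A kernel value of at least \<open>B\<close> makes \<open>v / sqrt K\<close> so small that it lies in the unit disk and in the \<open>d\<close>-neighbourhood of \<open>0\<close>.\<close>
  define B where "B = (max (cmod v) (2 * cmod v / d))\<^sup>2 + 1"
  have small: "cmod v \<le> sqrt k \<and> \<bar>log_potential (v / of_real (sqrt k)) - log_potential 0\<bar> < \<kappa> / 4" if "B \<le> k" for k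
  proof -
    define y where "y = max (cmod v) (2 * cmod v / d)"
    have y0: "0 \<le> y" by (simp add: y_def le_max_iff_disj)
    have "y\<^sup>2 + 1 \<le> k" using that unfolding B_def y_def .
    then have k: "y\<^sup>2 < k" "k > 0" using zero_le_power2[of y] by linarith+
    have yk: "y < sqrt k" using k(1) by (rule real_less_rsqrt)
    then have "2 * cmod v / d < sqrt k" by (simp add: y_def)
    then have "2 * cmod v < d * sqrt k" using d(1) by (simp add: pos_divide_less_eq mult.commute)
    then have "cmod v < d * sqrt k" using norm_ge_zero[of v] by linarith
    then have "cmod (v / of_real (sqrt k)) < d"
      using k(2) by (simp add: norm_divide pos_divide_less_eq)
    then show ?thesis using d(2) yk by (simp add: y_def)
  qed
  have "\<forall>\<^sub>F n in sequentially. \<forall>\<zeta>\<in>sphere 0 1. B \<le> cd_kernel p n (of_real (exp (t / real n)) * \<zeta>)"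
    by (rule kernel_unbounded)
  moreover have "\<forall>\<^sub>F n in sequentially. \<forall>\<zeta>\<in>sphere 0 1. B \<le> cd_kernel p n (of_real (exp (0 / real n)) * \<zeta>)"
    by (rule kernel_unbounded)
  moreover have "\<forall>\<^sub>F n in sequentially. \<forall>\<zeta>\<in>sphere 0 1.
     cd_kernel p n (of_real (exp (t / real n)) * \<zeta>) \<le> (1 + 4 * t / 3 + 2 * t\<^sup>2 + \<kappa>) * cd_kernel p n \<zeta>"
    by (rule kernel_ratio[OF t \<kappa>])
  ultimately show ?thesis using eventually_gt_at_top[of 0]
  proof eventually_elim
    case (elim n)
    define s where "s = t / real n"
    have circ: "circle_pt 0 \<tau> \<in> sphere 0 1" for \<tau> by simp
    have B1: "B \<le> cd_kernel p n (circle_pt s \<tau>)" for \<tau>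
      using elim(1) circ[of \<tau>] by (subst circle_pt_eq) (simp add: s_def)
    have B0: "B \<le> cd_kernel p n (circle_pt 0 \<tau>)" for \<tau>
      using elim(2) circ[of \<tau>] by simp
    have v1: "cmod v \<le> sqrt (cd_kernel p n (circle_pt s \<tau>))" for \<tau> using small[OF B1] by blast
    have v0: "cmod v \<le> sqrt (cd_kernel p n (circle_pt 0 \<tau>))" for \<tau> using small[OF B0] by blast
    note I1 = expectation_log_mean[OF v1] and I0 = expectation_log_mean[OF v0]
    have "t * expectation (\<lambda>\<omega>. 1 / real n * real (root_count_disk (random_poly p \<eta> n \<omega>) v)) =
       expectation (\<lambda>\<omega>. s * real (root_count_disk (random_poly p \<eta> n \<omega>) v))"
      by (simp add: s_def)
    also have "\<dots> \<le> expectation (\<lambda>\<omega>. log_mean (shifted n \<omega>) s - log_mean (shifted n \<omega>) 0)"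
      unfolding shifted_def
      by (intro integral_mono integrable_mult_right root_count_integrable root_count_subgradient
          Bochner_Integration.integrable_diff I1(1)[unfolded shifted_def] I0(1)[unfolded shifted_def])
    also have "\<dots> = integral\<^sup>L unit_interval (mean_log_field n s) - integral\<^sup>L unit_interval (mean_log_field n 0)"
      by (simp add: Bochner_Integration.integral_diff[OF I1(1) I0(1)] I1(3) I0(3))
    also have "\<dots> = (\<integral>\<tau>. mean_log_field n s \<tau> - mean_log_field n 0 \<tau> \<partial>unit_interval)"
      by (rule Bochner_Integration.integral_diff[symmetric, OF I1(2) I0(2)])
    also have "\<dots> \<le> (\<integral>\<tau>. 2 * t / 3 + t\<^sup>2 + \<kappa> \<partial>unit_interval)"
    proof (intro integral_mono Bochner_Integration.integrable_diff I1(2) I0(2) U.integrable_const)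
      fix \<tau>
      define K1 where "K1 = cd_kernel p n (circle_pt s \<tau>)"
      define K0 where "K0 = cd_kernel p n (circle_pt 0 \<tau>)"
      define g where "g = 1 + 4 * t / 3 + 2 * t\<^sup>2 + \<kappa>"
      have K: "K1 > 0" "K0 > 0" unfolding K1_def K0_def by (rule mu.kernel_pos)+
      have "K1 \<le> g * K0"
        using elim(3) circ[of \<tau>] unfolding K1_def K0_def g_def
        by (subst circle_pt_eq) (simp add: s_def)
      then have "K1 / K0 \<le> g" using K by (simp add: pos_divide_le_eq)
      have "ln K1 - ln K0 = ln (K1 / K0)" using K by (simp add: ln_div)
      also have "\<dots> \<le> K1 / K0 - 1" using K by (intro ln_le_minus_one) simp
      also have "\<dots> \<le> g - 1" using \<open>K1 / K0 \<le> g\<close> by simp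
      finally have "ln K1 / 2 - ln K0 / 2 \<le> (g - 1) / 2" by simp
      moreover have "(g - 1) / 2 = 2 * t / 3 + t\<^sup>2 + \<kappa> / 2" by (simp add: g_def field_simps)
      moreover have "\<bar>log_potential (v / of_real (sqrt K1)) - log_potential 0\<bar> < \<kappa> / 4"
        using small[OF B1] by (simp add: K1_def)
      moreover have "\<bar>log_potential (v / of_real (sqrt K0)) - log_potential 0\<bar> < \<kappa> / 4"
        using small[OF B0] by (simp add: K0_def)
      ultimately show "mean_log_field n s \<tau> - mean_log_field n 0 \<tau> \<le> 2 * t / 3 + t\<^sup>2 + \<kappa>"
        unfolding mean_log_field_def K1_def[symmetric] K0_def[symmetric] by linarith
    qed
    also have "\<dots> = 2 * t / 3 + t\<^sup>2 + \<kappa>" by (simp add: U.prob_space)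
    finally show ?case .
  qed
qed

text \<open>
The previous bound for \<open>t\<close> and for \<open>- t\<close>, with error \<open>t r / 4\<close>, confines the mean to within
\<open>t + r / 4\<close> of \<open>2/3\<close>.\<close>

theorem mean_root_count_limit:
  "(\<lambda>n. expectation (\<lambda>\<omega>. 1 / real n * real (root_count_disk (random_poly p \<eta> n \<omega>) v))) \<longlonglongrightarrow> 2 / 3"
proof (rule LIMSEQ_I)
  fix r :: real assume r: "r > 0"
  define e where "e n = expectation (\<lambda>\<omega>. 1 / real n * real (root_count_disk (random_poly p \<eta> n \<omega>) v))" for n
  define t where "t = min (1 / 8) (r / 4)"
  have t: "0 < t" "t \<le> 1 / 8" "t \<le> r / 4" using r by (auto simp: t_def)
  have \<kappa>: "t * (r / 4) > 0" using t r by simp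
  have 1: "\<forall>\<^sub>F n in sequentially. t * e n \<le> 2 * t / 3 + t\<^sup>2 + t * (r / 4)"
    unfolding e_def using t by (intro mean_root_count_bound \<kappa>) auto
  have 2: "\<forall>\<^sub>F n in sequentially. (- t) * e n \<le> 2 * (- t) / 3 + (- t)\<^sup>2 + t * (r / 4)"
    unfolding e_def using t by (intro mean_root_count_bound \<kappa>) auto
  from 1 2 have "\<forall>\<^sub>F n in sequentially. norm (e n - 2 / 3) < r"
  proof eventually_elim
    case (elim n)
    have "t * (e n - 2 / 3) \<le> t * (t + r / 4)"
      using elim(1) by (simp add: algebra_simps power2_eq_square)
    then have "e n - 2 / 3 \<le> t + r / 4" using t by simp
    moreover have "t * (2 / 3 - e n) \<le> t * (t + r / 4)"
      using elim(2) by (simp add: algebra_simps power2_eq_square)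
    then have "2 / 3 - e n \<le> t + r / 4" using t by simp
    ultimately show ?case using t r by (simp add: abs_less_iff)
  qed
  then show "\<exists>no. \<forall>n\<ge>no. norm (e n - 2 / 3) < r"
    by (simp add: eventually_sequentially)
qed

end

theorem theorem8p3:
  fixes \<mu> :: "complex measure"
    and w :: "complex \<Rightarrow> real"
    and p :: "nat \<Rightarrow> complex poly"
    and M :: "'a measure"
    and \<eta> :: "nat \<Rightarrow> 'a \<Rightarrow> complex"
    and v :: complex
  assumes w_measurable: "w \<in> borel_measurable disk_area"
    and w_pos: "\<And>z. z \<in> cball 0 1 \<Longrightarrow> w z > 0"
    and w_cont: "\<And>z. z \<in> sphere 0 1 \<Longrightarrow> continuous (at z within cball 0 1) w"
    and \<mu>_density: "\<mu> = density disk_area (\<lambda>z. ennreal (w z))"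
    and \<mu>_finite: "finite_measure \<mu>"
    and bergman: "bergman_polynomials \<mu> p"
    and regular: "STU_regular p"
    and prob: "prob_space M"
    and \<eta>_indep: "prob_space.indep_vars M (\<lambda>_. borel) \<eta> UNIV"
    and \<eta>_normal:
      "\<And>j. distributed M lborel (\<eta> j) (\<lambda>z. ennreal (std_complex_normal_density z))"
  shows "(\<lambda>n. prob_space.expectation M
            (\<lambda>\<omega>. 1 / real n * real (root_count_disk (random_poly p \<eta> n \<omega>) v)))
          \<longlonglongrightarrow> 2 / 3"
proof -
  interpret gaussian_bergman \<mu> w p M \<eta> v
    using assms by (intro gaussian_bergman.intro disk_weight.intro gaussian_bergman_axioms.intro) auto
  show ?thesis by (rule mean_root_count_limit)
qed

end
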